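(* Let $\mathbb{F}=\mathbb{F}_p$ with $p$ an odd prime and let $a,b$ be non-negative integers. There are natural isomorphisms in $\mathcal{U}^{\mathrm{bi.gr}}$: 1. $F(0,b)\cong\hat{\mathcal{O}}\,r'(\Gamma^b)$; 2. $F(a,0)\cong\Psi\,r_{\mathcal{B}}(\Lambda^a)$.
   Context: Everything is $\mathbb{Z}/2$-graded with Koszul signs. $\mathcal{B}$ is the $\mathbb{Z}/2$-graded bialgebra $\Lambda(w,\tau_i\mid i\ge0)\otimes\mathbb{F}[u,\xi_j\mid j\ge0]$ ($u,\xi_j$ even; $w,\tau_i$ odd) with coproduct $$u\mapsto u\otimes u+w\otimes\tau_0,\ \ w\mapsto u\otimes w+w\otimes\xi_0,\ \ \tau_i\mapsto\sum_{s=0}^i\xi_{i-s}^{p^s}\otimes\tau_s+\tau_i\otimes u,\ \ \xi_j\mapsto\sum_{s=0}^j\xi_{j-s}^{p^s}\otimes\xi_s+\tau_j\otimes w,$$ and counit $u,\xi_0\mapsto1$, other generators $\mapsto0$. $\overline{\mathcal{B}}=\mathcal{B}/(w)$. The bialgebra morphisms $\mathcal{B}\to\overline{\mathcal{B}}\to\mathbb{F}[u,\xi_0]$ ($u,\xi_0$ grouplike; other generators $\mapsto0$) give left and right bidegrees (first entry the $u$-degree, second the $\xi_0$-degree). In $\overline{\mathcal B}$: left bidegrees of $u,\xi_j,\tau_i$ are $(1,0),(0,p^j),(0,p^i)$ and right bidegrees are $(1,0),(0,1),(1,0)$; in $\mathcal{B}$, $w$ has left bidegree $(1,0)$ and right bidegree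 $(0,1)$. $\mathcal{U}^{\mathrm{bi.gr}}$ (resp. $\mathcal{U}(\mathcal{B})$) is the category of graded right $\overline{\mathcal{B}}$- (resp. $\mathcal{B}$-) comodules: bigraded vector spaces $M=\bigoplus_{a,b\ge0}M_{(a,b)}$ (parity $a$ mod 2) with a coassociative counital coaction sending $M_{(a,b)}$ into $\prod_{(s,t)}M_{(s,t)}\otimes C_{(s,t),(a,b)}$, where $C=\overline{\mathcal{B}}$ (resp. $\mathcal{B}$) and $C_{(s,t),(a,b)}$ is the component of left bidegree $(s,t)$ and right bidegree $(a,b)$. $\Psi\colon\mathcal{U}(\mathcal{B})\to\mathcal{U}^{\mathrm{bi.gr}}$ is corestriction along $\mathcal{B}\to\overline{\mathcal{B}}$. $F(a,b)$: let $L\subset\overline{\mathcal{B}}$ be the part of right bidegree $(a,b)$ (that is, $\overline{\mathcal{B}}\,\Box_{\mathbb{F}[u,\xi_0]}\mathbb{F}(a,b)$), a left $\overline{\mathcal{B}}$-comodule via $\Delta$, with finite-dimensional components $L_{(s,t)}$ of left bidegree $(s,t)$. Then $F(a,b)_{(s,t)}=(L_{(s,t)})^*$, with right coaction adjoint to the left coaction on $L$: $\varphi\mapsto(\ell\mapsto(1\otimes\varphi)\Delta\ell)$. $\mathcal{F}$ is the category of functors from finite-dimensional $\mathbb{F}$-vector spaces to $\mathbb{F}$-vector spaces; $\Gamma^b(V)=(V^{\otimes b})^{\mathfrak{S}_b}$, $\Lambda^a$ the exterior power. There is an isomorphism of bialgebras $\mathcal{B}_{(s,t),(a,b)}\cong\mathrm{Hom}_{\mathcal{F}}(\Lambda^s\otimes\Gamma^t,\Lambda^a\otimes\Gamma^b)^*$,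 where the coproduct on the right is dual to composition and the product is dual to the coproduct coming from the exponential property of $\Lambda^*\otimes\Gamma^*$; $u,w,\xi_j,\tau_i$ are dual to the identity of $\Lambda^1$, the isomorphism $\Lambda^1\cong\Gamma^1$, the iterated Verschiebung $\Gamma^{p^j}\to\Gamma^1$ and the iterated Verschiebung $\Gamma^{p^i}\to\Gamma^1\cong\Lambda^1$, respectively. For $F\in\mathcal{F}$, $r_{\mathcal{B}}(F)\in\mathcal{U}(\mathcal{B})$ has $r_{\mathcal{B}}(F)_{(a,b)}=\mathrm{Hom}_{\mathcal{F}}(\Lambda^a\otimes\Gamma^b,F)$ with coaction adjoint to precomposition. $\hat{\mathcal{O}}r'(F)\in\mathcal{U}^{\mathrm{bi.gr}}$ is concentrated in bidegrees $(0,b)$, with component $\mathrm{Hom}_{\mathcal{F}}(\Gamma^b,F)$ there, and coaction adjoint to precomposition by morphisms $\Gamma^t\to\Gamma^b$, taking values in the sub-bialgebra $\mathbb{F}[\xi_j\mid j\ge0]\subset\overline{\mathcal{B}}$, whose component of left bidegree $(0,t)$ and right bidegree $(0,b)$ is identified with $\mathrm{Hom}_{\mathcal{F}}(\Gamma^t,\Gamma^b)^*$. *)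

theory Defs
  imports
    "HOL-Library.Poly_Mapping"
    "HOL-Library.FSet"
    "HOL-Library.Multiset"
    "HOL-Library.Function_Algebras"
    "HOL-Library.Product_Plus"
    "HOL-Combinatorics.Permutations"
    "Jordan_Normal_Form.Determinant"
    "Jordan_Normal_Form.DL_Submatrix"
begin

section \<open>The bialgebra B and its quotient by w\<close>

text \<open>
  The field is a type \<open>'k :: field\<close> with exactly \<open>p\<close> elements; \<open>p\<close> is an explicit parameter.
  A bidegree is a pair (\<open>u\<close>-degree, \<open>\<xi>\<^sub>0\<close>-degree).
\<close>

type_synonym bideg = "nat \<times> nat"

datatype odd_gen = W | Tau nat
datatype even_gen = U | Xi nat

text \<open>The generators are linearly ordered by \<open>w < \<tau>\<^sub>0 < \<tau>\<^sub>1 < \<dots>\<close> and \<open>u < \<xi>\<^sub>0 < \<xi>\<^sub>1 < \<dots>\<close>.\<close>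

fun odd_rank :: "odd_gen \<Rightarrow> nat" where
  "odd_rank W = 0"
| "odd_rank (Tau i) = Suc i"

fun even_rank :: "even_gen \<Rightarrow> nat" where
  "even_rank U = 0"
| "even_rank (Xi j) = Suc j"

lemma odd_rank_inj: "odd_rank g = odd_rank h \<Longrightarrow> g = h"
  by (cases g; cases h) auto

lemma even_rank_inj: "even_rank g = even_rank h \<Longrightarrow> g = h"
  by (cases g; cases h) auto

instantiation odd_gen :: linorder
begin
definition less_eq_odd_gen :: "odd_gen \<Rightarrow> odd_gen \<Rightarrow> bool" where
  "g \<le> h \<longleftrightarrow> odd_rank g \<le> odd_rank h"
definition less_odd_gen :: "odd_gen \<Rightarrow> odd_gen \<Rightarrow> bool" where
  "g < h \<longleftrightarrow> odd_rank g < odd_rank h"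
instance
  by standard (auto simp: less_eq_odd_gen_def less_odd_gen_def intro: odd_rank_inj)
end

instantiation even_gen :: linorder
begin
definition less_eq_even_gen :: "even_gen \<Rightarrow> even_gen \<Rightarrow> bool" where
  "g \<le> h \<longleftrightarrow> even_rank g \<le> even_rank h"
definition less_even_gen :: "even_gen \<Rightarrow> even_gen \<Rightarrow> bool" where
  "g < h \<longleftrightarrow> even_rank g < even_rank h"
instance
  by standard (auto simp: less_eq_even_gen_def less_even_gen_def intro: even_rank_inj)
end

text \<open>
  The monomial basis of \<open>\<Lambda>(w, \<tau>\<^sub>i) \<otimes> F[u, \<xi>\<^sub>j]\<close>: the pair \<open>(A, M)\<close> stands for the product of the
  odd generators in \<open>A\<close>, taken in increasing order, times the product of the multiset \<open>M\<close>.
\<close>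

type_synonym mon = "odd_gen fset \<times> even_gen multiset"

definition mon_one :: mon where
  "mon_one = ({||}, {#})"

definition odd_mon :: "odd_gen \<Rightarrow> mon" where
  "odd_mon g = ({|g|}, {#})"

definition even_mon :: "even_gen \<Rightarrow> nat \<Rightarrow> mon" where
  "even_mon g k = ({||}, replicate_mset k g)"

definition mon_mul :: "mon \<Rightarrow> mon \<Rightarrow> mon" where
  "mon_mul m n = (fst m |\<union>| fst n, snd m + snd n)"

text \<open>The sign counts the transpositions that sort the product; a repeated odd generator gives 0.\<close>

definition mon_sgn :: "mon \<Rightarrow> mon \<Rightarrow> 'k::field" where
  "mon_sgn m n =
     (if fst m |\<inter>| fst n = {||}
      then (-1) ^ card {(g, h). g |\<in>| fst m \<and> h |\<in>| fst n \<and> h < g} else 0)"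

definition b_mul :: "(mon \<Rightarrow>\<^sub>0 'k::field) \<Rightarrow> (mon \<Rightarrow>\<^sub>0 'k) \<Rightarrow> (mon \<Rightarrow>\<^sub>0 'k)" where
  "b_mul x y = (\<Sum>m\<in>Poly_Mapping.keys x. \<Sum>n\<in>Poly_Mapping.keys y.
     Poly_Mapping.single (mon_mul m n)
       (mon_sgn m n * Poly_Mapping.lookup x m * Poly_Mapping.lookup y n))"

definition mon_parity :: "mon \<Rightarrow> nat" where
  "mon_parity m = fcard (fst m)"

text \<open>
  Elements of the tensor square are finitely supported on pairs of monomials; its product is
  \<open>(m\<^sub>1 \<otimes> m\<^sub>2)(n\<^sub>1 \<otimes> n\<^sub>2) = (-1)\<^bsup>|m\<^sub>2||n\<^sub>1|\<^esup> m\<^sub>1n\<^sub>1 \<otimes> m\<^sub>2n\<^sub>2\<close>.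
\<close>

definition bb_mul ::
  "(mon \<times> mon \<Rightarrow>\<^sub>0 'k::field) \<Rightarrow> (mon \<times> mon \<Rightarrow>\<^sub>0 'k) \<Rightarrow> (mon \<times> mon \<Rightarrow>\<^sub>0 'k)" where
  "bb_mul x y = (\<Sum>m\<in>Poly_Mapping.keys x. \<Sum>n\<in>Poly_Mapping.keys y.
     Poly_Mapping.single (mon_mul (fst m) (fst n), mon_mul (snd m) (snd n))
       ((-1) ^ (mon_parity (snd m) * mon_parity (fst n))
         * mon_sgn (fst m) (fst n) * mon_sgn (snd m) (snd n)
         * Poly_Mapping.lookup x m * Poly_Mapping.lookup y n))"

definition bb_one :: "mon \<times> mon \<Rightarrow>\<^sub>0 'k::field" where
  "bb_one = Poly_Mapping.single (mon_one, mon_one) 1"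

definition pscale :: "'k::field \<Rightarrow> ('m \<Rightarrow>\<^sub>0 'k) \<Rightarrow> ('m \<Rightarrow>\<^sub>0 'k)" where
  "pscale c x = Poly_Mapping.map ((*) c) x"

fun coprod_odd :: "nat \<Rightarrow> odd_gen \<Rightarrow> (mon \<times> mon \<Rightarrow>\<^sub>0 'k::field)" where
  "coprod_odd p W =
     Poly_Mapping.single (even_mon U 1, odd_mon W) 1
     + Poly_Mapping.single (odd_mon W, even_mon (Xi 0) 1) 1"
| "coprod_odd p (Tau i) =
     (\<Sum>s\<le>i. Poly_Mapping.single (even_mon (Xi (i - s)) (p ^ s), odd_mon (Tau s)) 1)
     + Poly_Mapping.single (odd_mon (Tau i), even_mon U 1) 1"

fun coprod_even :: "nat \<Rightarrow> even_gen \<Rightarrow> (mon \<times> mon \<Rightarrow>\<^sub>0 'k::field)" where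
  "coprod_even p U =
     Poly_Mapping.single (even_mon U 1, even_mon U 1) 1
     + Poly_Mapping.single (odd_mon W, odd_mon (Tau 0)) 1"
| "coprod_even p (Xi j) =
     (\<Sum>s\<le>j. Poly_Mapping.single (even_mon (Xi (j - s)) (p ^ s), even_mon (Xi s) 1) 1)
     + Poly_Mapping.single (odd_mon (Tau j), odd_mon W) 1"

text \<open>The multiplicative extension to monomials, followed by the linear extension.\<close>

definition coprod_mon :: "nat \<Rightarrow> mon \<Rightarrow> (mon \<times> mon \<Rightarrow>\<^sub>0 'k::field)" where
  "coprod_mon p m =
     foldr bb_mul
       (map (coprod_odd p) (sorted_list_of_fset (fst m))
        @ map (coprod_even p) (sorted_list_of_multiset (snd m)))
       bb_one"

definition coprod :: "nat \<Rightarrow> (mon \<Rightarrow>\<^sub>0 'k::field) \<Rightarrow> (mon \<times> mon \<Rightarrow>\<^sub>0 'k)" where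
  "coprod p x =
     (\<Sum>m\<in>Poly_Mapping.keys x. pscale (Poly_Mapping.lookup x m) (coprod_mon p m))"

definition counit_mon :: "mon \<Rightarrow> 'k::field" where
  "counit_mon m = (if fst m = {||} \<and> set_mset (snd m) \<subseteq> {U, Xi 0} then 1 else 0)"

definition counit :: "(mon \<Rightarrow>\<^sub>0 'k::field) \<Rightarrow> 'k" where
  "counit x = (\<Sum>m\<in>Poly_Mapping.keys x. Poly_Mapping.lookup x m * counit_mon m)"

fun ldeg_odd :: "nat \<Rightarrow> odd_gen \<Rightarrow> bideg" where
  "ldeg_odd p W = (1, 0)"
| "ldeg_odd p (Tau i) = (0, p ^ i)"

fun ldeg_even :: "nat \<Rightarrow> even_gen \<Rightarrow> bideg" where
  "ldeg_even p U = (1, 0)"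
| "ldeg_even p (Xi j) = (0, p ^ j)"

fun rdeg_odd :: "odd_gen \<Rightarrow> bideg" where
  "rdeg_odd W = (0, 1)"
| "rdeg_odd (Tau i) = (1, 0)"

fun rdeg_even :: "even_gen \<Rightarrow> bideg" where
  "rdeg_even U = (1, 0)"
| "rdeg_even (Xi j) = (0, 1)"

definition ldeg :: "nat \<Rightarrow> mon \<Rightarrow> bideg" where
  "ldeg p m = (\<Sum>g\<in>fset (fst m). ldeg_odd p g) + (\<Sum>g\<in>#snd m. ldeg_even p g)"

definition rdeg :: "mon \<Rightarrow> bideg" where
  "rdeg m = (\<Sum>g\<in>fset (fst m). rdeg_odd g) + (\<Sum>g\<in>#snd m. rdeg_even g)"

text \<open>
  Sets \<open>S\<close> of monomials select the (co)algebra: \<open>UNIV\<close> for B, the \<open>w\<close>-free monomials for \<open>B/(w)\<close>,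
  the monomials in the \<open>\<xi>\<^sub>j\<close> alone for \<open>F[\<xi>\<^sub>j]\<close>.
\<close>

definition mons :: "nat \<Rightarrow> mon set \<Rightarrow> bideg \<Rightarrow> bideg \<Rightarrow> mon set" where
  "mons p S st ab = {m \<in> S. ldeg p m = st \<and> rdeg m = ab}"

lemma finite_mons:
  assumes p: "2 \<le> p"
  shows "finite (mons p S st ab)"
proof -
  have le_pow: "i \<le> p ^ i" for i
    using less_exp[of i] power_mono[OF p, of i] by linarith
  define X where "X = insert W (Tau ` {..snd st})"
  define Y where "Y = insert U (Xi ` {..snd st})"
  define Z where "Z = {A. fset A \<subseteq> X} \<times> mset ` {xs. set xs \<subseteq> Y \<and> length xs \<le> fst st + snd st}"
  have "finite {A. fset A \<subseteq> X}"
  proof (rule finite_imageD)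
    have "fset ` {A. fset A \<subseteq> X} \<subseteq> Pow X" by auto
    moreover have "finite X" by (simp add: X_def)
    ultimately show "finite (fset ` {A. fset A \<subseteq> X})" by (meson finite_Pow_iff finite_subset)
    show "inj_on fset {A. fset A \<subseteq> X}" by (simp add: fset_inject inj_on_def)
  qed
  moreover have "finite {xs. set xs \<subseteq> Y \<and> length xs \<le> fst st + snd st}"
    by (rule finite_lists_length_le) (simp add: Y_def)
  ultimately have "finite Z" by (simp add: Z_def)
  moreover have "mons p S st ab \<subseteq> Z"
  proof
    fix m assume "m \<in> mons p S st ab"
    then have deg: "ldeg p m = st" by (simp add: mons_def)
    have fst_mset: "fst (\<Sum>g\<in>#M. ldeg_even p g) = (\<Sum>g\<in>#M. fst (ldeg_even p g))"
      and snd_mset: "snd (\<Sum>g\<in>#M. ldeg_even p g) = (\<Sum>g\<in>#M. snd (ldeg_even p g))" for M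
      by (induction M) auto
    have deg_fst: "(\<Sum>g\<in>fset (fst m). fst (ldeg_odd p g)) + (\<Sum>g\<in>#snd m. fst (ldeg_even p g)) = fst st"
      using deg[symmetric] by (simp add: ldeg_def fst_sum fst_mset)
    have deg_snd: "(\<Sum>g\<in>fset (fst m). snd (ldeg_odd p g)) + (\<Sum>g\<in>#snd m. snd (ldeg_even p g)) = snd st"
      using deg[symmetric] by (simp add: ldeg_def snd_sum snd_mset)
    have "fset (fst m) \<subseteq> X"
    proof
      fix g assume g: "g \<in> fset (fst m)"
      then have "snd (ldeg_odd p g) \<le> snd st"
        using deg_snd member_le_sum[OF g, of "\<lambda>g. snd (ldeg_odd p g)"] by simp
      then show "g \<in> X"
        using le_pow by (cases g) (auto simp: X_def intro: order_trans)
    qed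
    moreover have "set_mset (snd m) \<subseteq> Y"
    proof
      fix g assume g: "g \<in># snd m"
      then have "snd (ldeg_even p g) \<le> (\<Sum>g\<in>#snd m. snd (ldeg_even p g))"
        by (metis insert_DiffM image_mset_add_mset sum_mset.add_mset le_add1)
      then have "snd (ldeg_even p g) \<le> snd st" using deg_snd by simp
      then show "g \<in> Y"
        using le_pow by (cases g) (auto simp: Y_def intro: order_trans)
    qed
    moreover have "size (snd m) \<le> fst st + snd st"
    proof -
      have "size M \<le> (\<Sum>g\<in>#M. fst (ldeg_even p g)) + (\<Sum>g\<in>#M. snd (ldeg_even p g))" for M
      proof (induction M)
        case (add g M)
        have "1 \<le> fst (ldeg_even p g) + snd (ldeg_even p g)"
          using p by (cases g) auto
        then show ?case using add by simp
      qed simp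
      from this[of "snd m"] show ?thesis using deg_fst deg_snd by linarith
    qed
    moreover obtain xs where "snd m = mset xs" by (metis ex_mset)
    ultimately show "m \<in> Z"
      by (cases m) (auto simp: Z_def)
  qed
  ultimately show ?thesis by (rule rev_finite_subset)
qed

definition bcomp :: "nat \<Rightarrow> mon set \<Rightarrow> bideg \<Rightarrow> bideg \<Rightarrow> (mon \<Rightarrow>\<^sub>0 'k::field) set" where
  "bcomp p S st ab = {x. Poly_Mapping.keys x \<subseteq> mons p S st ab}"

definition wfree :: "mon set" where
  "wfree = {m. W |\<notin>| fst m}"

definition xi_mons :: "mon set" where
  "xi_mons = {m. fst m = {||} \<and> set_mset (snd m) \<subseteq> range Xi}"

text \<open>
  A class in \<open>B/(w)\<close> is represented by its unique member supported on \<open>w\<close>-free monomials, and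
  \<open>bar_proj\<close> is the quotient map; its kernel is the ideal generated by \<open>w\<close>, see
  \<open>bar_proj_eq_0_iff\<close> below.
\<close>

definition bar_proj :: "(mon \<Rightarrow>\<^sub>0 'k::field) \<Rightarrow> (mon \<Rightarrow>\<^sub>0 'k)" where
  "bar_proj x = (\<Sum>m\<in>Poly_Mapping.keys x \<inter> wfree.
     Poly_Mapping.single m (Poly_Mapping.lookup x m))"

definition bar_coprod :: "nat \<Rightarrow> (mon \<Rightarrow>\<^sub>0 'k::field) \<Rightarrow> (mon \<times> mon \<Rightarrow>\<^sub>0 'k)" where
  "bar_coprod p x = (\<Sum>mn\<in>Poly_Mapping.keys (coprod p x) \<inter> wfree \<times> wfree.
     Poly_Mapping.single mn (Poly_Mapping.lookup (coprod p x) mn))"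

lemma lookup_bar_proj:
  "Poly_Mapping.lookup (bar_proj x) m = (if m \<in> wfree then Poly_Mapping.lookup x m else 0)"
proof -
  have "Poly_Mapping.lookup (bar_proj x) m =
    (\<Sum>n\<in>Poly_Mapping.keys x \<inter> wfree. if n = m then Poly_Mapping.lookup x n else 0)"
    by (simp add: bar_proj_def lookup_sum lookup_single when_def)
  also have "\<dots> = (if m \<in> wfree then Poly_Mapping.lookup x m else 0)"
    by (subst sum.delta) (auto simp: in_keys_iff)
  finally show ?thesis .
qed

lemma lookup_b_mul_W:
  fixes y :: "mon \<Rightarrow>\<^sub>0 'k::field"
  shows "Poly_Mapping.lookup (b_mul (Poly_Mapping.single (odd_mon W) 1) y) m =
    (if W |\<in>| fst m then Poly_Mapping.lookup y (fst m |-| {|W|}, snd m) else 0)"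
proof -
  have W_min: "\<not> h < W" for h
    by (simp add: less_odd_gen_def)
  have sgn: "mon_sgn (odd_mon W) n = (if W |\<in>| fst n then 0 else (1::'k))" for n
  proof -
    have "{(g, h). g |\<in>| fst (odd_mon W) \<and> h |\<in>| fst n \<and> h < g} = {}"
      by (auto simp: odd_mon_def W_min)
    then show ?thesis by (simp only: mon_sgn_def card.empty power_0) (simp add: odd_mon_def)
  qed
  have "Poly_Mapping.lookup (b_mul (Poly_Mapping.single (odd_mon W) 1) y) m =
    (\<Sum>n\<in>Poly_Mapping.keys y.
      if mon_mul (odd_mon W) n = m then mon_sgn (odd_mon W) n * Poly_Mapping.lookup y n else 0)"
    by (simp add: b_mul_def lookup_sum lookup_single when_def)
  also have "\<dots> = (\<Sum>n\<in>Poly_Mapping.keys y.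
      if (fst m |-| {|W|}, snd m) = n
      then (if W |\<in>| fst m then Poly_Mapping.lookup y n else 0) else 0)"
  proof (rule sum.cong[OF refl])
    fix n
    have "mon_mul (odd_mon W) n = m \<longleftrightarrow> W |\<in>| fst m \<and> (fst m |-| {|W|}, snd m) = n"
      if "W |\<notin>| fst n"
      using that by (cases m; cases n) (auto simp: mon_mul_def odd_mon_def)
    then show "(if mon_mul (odd_mon W) n = m
        then mon_sgn (odd_mon W) n * Poly_Mapping.lookup y n else 0) =
      (if (fst m |-| {|W|}, snd m) = n
       then if W |\<in>| fst m then Poly_Mapping.lookup y n else 0 else 0)"
      by (cases "W |\<in>| fst n") (auto simp: sgn)
  qed
  also have "\<dots> = (if W |\<in>| fst m then Poly_Mapping.lookup y (fst m |-| {|W|}, snd m) else 0)"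
    by (subst sum.delta') (auto simp: in_keys_iff)
  finally show ?thesis .
qed

lemma bar_proj_eq_0_iff:
  fixes x :: "mon \<Rightarrow>\<^sub>0 'k::field"
  shows "bar_proj x = 0 \<longleftrightarrow> (\<exists>y. x = b_mul (Poly_Mapping.single (odd_mon W) 1) y)"
proof
  assume x0: "bar_proj x = 0"
  have x_wfree: "Poly_Mapping.lookup x m = 0" if "W |\<notin>| fst m" for m
    using that lookup_bar_proj[of x m] by (simp add: x0 wfree_def)
  define y where "y = (\<Sum>m\<in>Poly_Mapping.keys x.
    Poly_Mapping.single (fst m |-| {|W|}, snd m) (Poly_Mapping.lookup x m))"
  have "x = b_mul (Poly_Mapping.single (odd_mon W) 1) y"
  proof (rule poly_mapping_eqI)
    fix m
    show "Poly_Mapping.lookup x m =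
      Poly_Mapping.lookup (b_mul (Poly_Mapping.single (odd_mon W) 1) y) m"
    proof (cases "W |\<in>| fst m")
      case False
      then show ?thesis by (simp add: lookup_b_mul_W x_wfree)
    next
      case True
      have "Poly_Mapping.lookup y (fst m |-| {|W|}, snd m) = (\<Sum>n\<in>Poly_Mapping.keys x.
        if (fst n |-| {|W|}, snd n) = (fst m |-| {|W|}, snd m)
        then Poly_Mapping.lookup x n else 0)"
        by (simp add: y_def lookup_sum lookup_single when_def)
      also have "\<dots> = (\<Sum>n\<in>Poly_Mapping.keys x. if m = n then Poly_Mapping.lookup x n else 0)"
      proof (rule sum.cong[OF refl])
        fix n assume "n \<in> Poly_Mapping.keys x"
        then have "W |\<in>| fst n"
          using x_wfree in_keys_iff by metis
        then have "(fst n |-| {|W|}, snd n) = (fst m |-| {|W|}, snd m) \<longleftrightarrow> m = n"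
          using True by (cases m; cases n) (metis finsert_fminus fst_conv prod.inject snd_conv)
        then show "(if (fst n |-| {|W|}, snd n) = (fst m |-| {|W|}, snd m)
            then Poly_Mapping.lookup x n else 0) =
          (if m = n then Poly_Mapping.lookup x n else 0)"
          by simp
      qed
      also have "\<dots> = Poly_Mapping.lookup x m"
        by (subst sum.delta') (auto simp: in_keys_iff)
      finally show ?thesis
        using True by (simp add: lookup_b_mul_W)
    qed
  qed
  then show "\<exists>y. x = b_mul (Poly_Mapping.single (odd_mon W) 1) y" ..
next
  assume "\<exists>y. x = b_mul (Poly_Mapping.single (odd_mon W) 1) y"
  then show "bar_proj x = 0"
    by (auto intro!: poly_mapping_eqI simp: lookup_bar_proj lookup_b_mul_W wfree_def)
qed

section \<open>Linear maps and duals\<close>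

definition lin_on ::
  "('k \<Rightarrow> 'm \<Rightarrow> 'm) \<Rightarrow> 'm set \<Rightarrow> ('k \<Rightarrow> 'n \<Rightarrow> 'n) \<Rightarrow> ('m::plus \<Rightarrow> 'n::plus) \<Rightarrow> bool" where
  "lin_on s V t f \<longleftrightarrow>
     (\<forall>x\<in>V. \<forall>y\<in>V. f (x + y) = f x + f y) \<and> (\<forall>c. \<forall>x\<in>V. f (s c x) = t c (f x))"

text \<open>Functions on a subspace are made unique by the value 0 outside it.\<close>

definition dual_space :: "('k::field \<Rightarrow> 'm::ab_group_add \<Rightarrow> 'm) \<Rightarrow> 'm set \<Rightarrow> ('m \<Rightarrow> 'k) set" where
  "dual_space s V = {\<phi>. lin_on s V (*) \<phi> \<and> (\<forall>x. x \<notin> V \<longrightarrow> \<phi> x = 0)}"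

definition fscale :: "'k::field \<Rightarrow> ('x \<Rightarrow> 'k) \<Rightarrow> ('x \<Rightarrow> 'k)" where
  "fscale c v = (\<lambda>i. c * v i)"

section \<open>Graded comodules\<close>

text \<open>
  A bigraded vector space is a family of subspaces \<open>gr M (a, b)\<close> of an ambient vector space, with
  scalar multiplication \<open>scl M\<close>. For the coalgebra with monomial basis \<open>S\<close>, the product of the
  \<open>gr M (s, t) \<otimes> C\<^bsub>(s, t),(a, b)\<^esub>\<close> over \<open>(s, t)\<close> consists of the families \<open>c\<close>, indexed by the
  monomials \<open>z\<close> in \<open>S\<close> of right bidegree \<open>(a, b)\<close>, with \<open>c z\<close> in \<open>gr M (ldeg p z)\<close>; such a \<open>c\<close>
  stands for the formal sum of all \<open>c z \<otimes> z\<close>. (There are finitely many monomials of a given left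
  bidegree, see \<open>finite_mons\<close>.)
\<close>

record ('k, 'm) gcomod =
  scl :: "'k \<Rightarrow> 'm \<Rightarrow> 'm"
  gr :: "bideg \<Rightarrow> 'm set"
  coact :: "bideg \<Rightarrow> 'm \<Rightarrow> mon \<Rightarrow> 'm"

definition graded_comodule ::
  "nat \<Rightarrow> mon set \<Rightarrow> ((mon \<Rightarrow>\<^sub>0 'k::field) \<Rightarrow> (mon \<times> mon \<Rightarrow>\<^sub>0 'k)) \<Rightarrow> ('k, 'm::ab_group_add) gcomod \<Rightarrow> bool"
  where
  "graded_comodule p S D M \<longleftrightarrow>
     vector_space (scl M) \<and>
     (\<forall>ab. module.subspace (scl M) (gr M ab)) \<and>
     (\<forall>ab. \<forall>m\<in>gr M ab. \<forall>z.
        (if z \<in> S \<and> rdeg z = ab then coact M ab m z \<in> gr M (ldeg p z) else coact M ab m z = 0)) \<and>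
     (\<forall>ab z. lin_on (scl M) (gr M ab) (scl M) (\<lambda>m. coact M ab m z)) \<and>
     (\<forall>ab. \<forall>m\<in>gr M ab. \<forall>x\<in>S. \<forall>y\<in>S.
        coact M (ldeg p y) (coact M ab m y) x =
        (\<Sum>z\<in>mons p S (ldeg p x) ab.
           scl M (Poly_Mapping.lookup (D (Poly_Mapping.single z 1)) (x, y)) (coact M ab m z))) \<and>
     (\<forall>ab. \<forall>m\<in>gr M ab.
        (\<Sum>z\<in>mons p S ab ab. scl M (counit_mon z) (coact M ab m z)) = m)"

definition U_bigr :: "nat \<Rightarrow> ('k::field, 'm::ab_group_add) gcomod \<Rightarrow> bool" where
  "U_bigr p M \<longleftrightarrow> graded_comodule p wfree (bar_coprod p) M"

definition U_bigr_hom ::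
  "nat \<Rightarrow> ('k::field, 'm::ab_group_add) gcomod \<Rightarrow> ('k, 'n::ab_group_add) gcomod \<Rightarrow> (bideg \<Rightarrow> 'm \<Rightarrow> 'n) \<Rightarrow> bool"
  where
  "U_bigr_hom p M N f \<longleftrightarrow>
     U_bigr p M \<and> U_bigr p N \<and>
     (\<forall>ab. f ab ` gr M ab \<subseteq> gr N ab \<and> lin_on (scl M) (gr M ab) (scl N) (f ab)) \<and>
     (\<forall>ab. \<forall>m\<in>gr M ab. \<forall>z\<in>wfree. rdeg z = ab \<longrightarrow>
        coact N ab (f ab m) z = f (ldeg p z) (coact M ab m z))"

definition U_bigr_iso ::
  "nat \<Rightarrow> ('k::field, 'm::ab_group_add) gcomod \<Rightarrow> ('k, 'n::ab_group_add) gcomod \<Rightarrow> (bideg \<Rightarrow> 'm \<Rightarrow> 'n) \<Rightarrow> bool"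
  where
  "U_bigr_iso p M N f \<longleftrightarrow>
     U_bigr_hom p M N f \<and>
     (\<exists>g. U_bigr_hom p N M g \<and>
        (\<forall>ab. (\<forall>m\<in>gr M ab. g ab (f ab m) = m) \<and> (\<forall>n\<in>gr N ab. f ab (g ab n) = n)))"

text \<open>Corestriction of a comodule over B along the quotient map to \<open>B/(w)\<close>.\<close>

definition Psi :: "('k, 'm::zero) gcomod \<Rightarrow> ('k, 'm) gcomod" where
  "Psi M = M\<lparr>coact := (\<lambda>ab m z. if z \<in> wfree then coact M ab m z else 0)\<rparr>"

text \<open>
  With \<open>L = \<Oplus>\<^sub>(\<^sub>s\<^sub>,\<^sub>t\<^sub>) bcomp p wfree (s, t) ab\<close>, the coaction below sends a functional \<open>\<phi>\<close> to the
  element of \<open>\<Prod> L\<^sup>* \<otimes> B/(w)\<close> that corresponds to \<open>\<ell> \<mapsto> (1 \<otimes> \<phi>)(\<Delta> \<ell>)\<close>; here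
  \<open>\<psi> \<otimes> x\<close> is \<open>\<ell> \<mapsto> \<psi>(\<ell>) x\<close> and \<open>(1 \<otimes> \<phi>)(x \<otimes> y) = \<phi>(y) x\<close>.
\<close>

definition F_proj :: "nat \<Rightarrow> bideg \<Rightarrow> ('k::field, (mon \<Rightarrow>\<^sub>0 'k) \<Rightarrow> 'k) gcomod" where
  "F_proj p ab =
     \<lparr>scl = fscale,
      gr = (\<lambda>st. dual_space pscale (bcomp p wfree st ab)),
      coact = (\<lambda>st \<phi> z l.
        if z \<in> wfree \<and> rdeg z = st \<and> l \<in> bcomp p wfree (ldeg p z) ab
        then (\<Sum>y\<in>mons p wfree st ab.
               Poly_Mapping.lookup (bar_coprod p l) (z, y) * \<phi> (Poly_Mapping.single y 1))
        else 0)\<rparr>"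

section \<open>Functors on finite-dimensional vector spaces\<close>

text \<open>
  The category of finite-dimensional vector spaces is taken in its skeletal form: an object is a
  natural number \<open>n\<close>, standing for the space \<open>F\<^sup>n\<close>, and a morphism from \<open>n\<close> to \<open>m\<close> is an \<open>m \<times> n\<close>
  matrix. The values of functors are subspaces of spaces of functions into the field (every vector
  space is of this form, by taking coordinates). Functors need not be additive.
\<close>

record ('k, 'x) vfunctor =
  fobj :: "nat \<Rightarrow> ('x \<Rightarrow> 'k) set"
  fmor :: "'k mat \<Rightarrow> ('x \<Rightarrow> 'k) \<Rightarrow> ('x \<Rightarrow> 'k)"

definition tensor_pow_obj :: "nat \<Rightarrow> nat \<Rightarrow> (nat list \<Rightarrow> 'k::field) set" where
  "tensor_pow_obj b n = {x. \<forall>K. x K \<noteq> 0 \<longrightarrow> length K = b \<and> set K \<subseteq> {..<n}}"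

definition tensor_pow_mor :: "nat \<Rightarrow> 'k::field mat \<Rightarrow> (nat list \<Rightarrow> 'k) \<Rightarrow> (nat list \<Rightarrow> 'k)" where
  "tensor_pow_mor b A x K =
     (if length K = b \<and> set K \<subseteq> {..<dim_row A}
      then \<Sum>J | set J \<subseteq> {..<dim_col A} \<and> length J = b. (\<Prod>i<b. A $$ (K ! i, J ! i)) * x J
      else 0)"

definition Gam :: "nat \<Rightarrow> ('k::field, nat list) vfunctor" where
  "Gam b =
     \<lparr>fobj = (\<lambda>n. {x \<in> tensor_pow_obj b n.
        \<forall>\<sigma>. \<sigma> permutes {..<b} \<longrightarrow> (\<forall>K. length K = b \<longrightarrow> x (permute_list \<sigma> K) = x K)}),
      fmor = tensor_pow_mor b\<rparr>"

text \<open>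
  The exterior power of \<open>F\<^sup>n\<close> has the basis of the \<open>e\<^sub>I\<close> for the \<open>a\<close>-element subsets \<open>I\<close> of
  \<open>{..<n}\<close>, where \<open>e\<^sub>I\<close> is the wedge of the \<open>e\<^sub>i\<close> in increasing order. A matrix acts by its minors.
\<close>

definition Lam :: "nat \<Rightarrow> ('k::field, nat set) vfunctor" where
  "Lam a =
     \<lparr>fobj = (\<lambda>n. {x. \<forall>I. x I \<noteq> 0 \<longrightarrow> I \<subseteq> {..<n} \<and> card I = a}),
      fmor = (\<lambda>A x J. if J \<subseteq> {..<dim_row A} \<and> card J = a
        then \<Sum>I | I \<subseteq> {..<dim_col A} \<and> card I = a. det (submatrix A J I) * x I
        else 0)\<rparr>"

text \<open>
  For subspaces of function spaces, \<open>x \<otimes> y\<close> is the function \<open>(i, j) \<mapsto> x(i) y(j)\<close>. The map \<open>f \<otimes> g\<close>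
  is computed by applying \<open>g\<close> in the second and then \<open>f\<close> in the first variable.
\<close>

definition tensor_functor ::
  "('k::field, 'x) vfunctor \<Rightarrow> ('k, 'y) vfunctor \<Rightarrow> ('k, 'x \<times> 'y) vfunctor" where
  "tensor_functor G H =
     \<lparr>fobj = (\<lambda>n. module.span fscale
        {(\<lambda>(i, j). x i * y j) | x y. x \<in> fobj G n \<and> y \<in> fobj H n}),
      fmor = (\<lambda>A z (j, k). fmor G A (\<lambda>i. fmor H A (\<lambda>l. z (i, l)) k) j)\<rparr>"

definition LG :: "bideg \<Rightarrow> ('k::field, nat set \<times> nat list) vfunctor" where
  "LG ab = tensor_functor (Lam (fst ab)) (Gam (snd ab))"

type_synonym ('k, 'x, 'y) trans = "nat \<Rightarrow> ('x \<Rightarrow> 'k) \<Rightarrow> ('y \<Rightarrow> 'k)"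

definition nat_trans ::
  "('k::field, 'x) vfunctor \<Rightarrow> ('k, 'y) vfunctor \<Rightarrow> ('k, 'x, 'y) trans set" where
  "nat_trans G H =
     {\<eta>. (\<forall>n. \<eta> n ` fobj G n \<subseteq> fobj H n \<and> lin_on fscale (fobj G n) fscale (\<eta> n) \<and>
              (\<forall>v. v \<notin> fobj G n \<longrightarrow> \<eta> n v = 0)) \<and>
         (\<forall>m n. \<forall>A\<in>carrier_mat m n. \<forall>v\<in>fobj G n.
              \<eta> m (fmor G A v) = fmor H A (\<eta> n v))}"

definition tscale :: "'k::field \<Rightarrow> ('k, 'x, 'y) trans \<Rightarrow> ('k, 'x, 'y) trans" where
  "tscale c \<eta> = (\<lambda>n v. fscale c (\<eta> n v))"

definition restr_trans ::
  "('k::field, 'x) vfunctor \<Rightarrow> (('x \<Rightarrow> 'k) \<Rightarrow> ('y \<Rightarrow> 'k)) \<Rightarrow> ('k, 'x, 'y) trans" where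
  "restr_trans G h = (\<lambda>n v. if v \<in> fobj G n then h v else 0)"

definition id_trans :: "('k::field, 'x) vfunctor \<Rightarrow> ('k, 'x, 'x) trans" where
  "id_trans G = restr_trans G (\<lambda>v. v)"

definition comp_trans ::
  "('k, 'y, 'z) trans \<Rightarrow> ('k, 'x, 'y) trans \<Rightarrow> ('k, 'x, 'z) trans" where
  "comp_trans g f = (\<lambda>n v. g n (f n v))"

text \<open>The isomorphism between \<open>\<Lambda>\<^sup>1 = \<Lambda>\<^sup>1 \<otimes> \<Gamma>\<^sup>0\<close> and \<open>\<Gamma>\<^sup>1 = \<Lambda>\<^sup>0 \<otimes> \<Gamma>\<^sup>1\<close>, and its inverse.\<close>

definition lam1_to_gam1 :: "('k::field, nat set \<times> nat list, nat set \<times> nat list) trans" where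
  "lam1_to_gam1 = restr_trans (LG (1, 0))
     (\<lambda>z (I, K). if I = {} \<and> length K = 1 then z ({hd K}, []) else 0)"

definition gam1_to_lam1 :: "('k::field, nat set \<times> nat list, nat set \<times> nat list) trans" where
  "gam1_to_lam1 = restr_trans (LG (0, 1))
     (\<lambda>z (I, K). if card I = 1 \<and> K = [] then z ({}, [the_elem I]) else 0)"

text \<open>
  The Verschiebung \<open>\<Gamma>\<^bsup>pn\<^esup> \<rightarrow> \<Gamma>\<^sup>n\<close>, dual to the \<open>p\<close>-th power map \<open>S\<^sup>n \<rightarrow> S\<^bsup>pn\<^esup>\<close>, reads off the coefficients
  at the lists in which every entry is repeated \<open>p\<close> times.
\<close>

definition verschiebung :: "nat \<Rightarrow> (nat list \<Rightarrow> 'k) \<Rightarrow> (nat list \<Rightarrow> 'k)" where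
  "verschiebung p x = (\<lambda>K. x (concat (map (replicate p) K)))"

definition versch_trans ::
  "nat \<Rightarrow> nat \<Rightarrow> ('k::field, nat set \<times> nat list, nat set \<times> nat list) trans" where
  "versch_trans p j = restr_trans (LG (0, p ^ j))
     (\<lambda>z (I, K). (verschiebung p ^^ j) (\<lambda>L. z (I, L)) K)"

section \<open>The identification of B with the dual of the category of the functors LG\<close>

text \<open>
  \<open>\<theta> (s, t) (a, b)\<close> maps the component of B to functionals on the natural transformations
  from \<open>LG (s, t)\<close> to \<open>LG (a, b)\<close>.
\<close>

type_synonym 'k pairing =
  "bideg \<Rightarrow> bideg \<Rightarrow> (mon \<Rightarrow>\<^sub>0 'k) \<Rightarrow> ('k, nat set \<times> nat list, nat set \<times> nat list) trans \<Rightarrow> 'k"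

definition linear_iso_pairing :: "nat \<Rightarrow> 'k::field pairing \<Rightarrow> bool" where
  "linear_iso_pairing p \<theta> \<longleftrightarrow>
     (\<forall>st ab. bij_betw (\<theta> st ab) (bcomp p UNIV st ab) (dual_space tscale (nat_trans (LG st) (LG ab)))
        \<and> lin_on pscale (bcomp p UNIV st ab) fscale (\<theta> st ab))"

text \<open>
  The coproduct is dual to composition. No sign appears: the sign \<open>(-1)\<^bsup>|f||g|\<^esup>\<close> from exchanging \<open>f\<close>
  and \<open>g\<close> in \<open>f \<otimes> g \<mapsto> g \<circ> f\<close> cancels the one from evaluating \<open>y \<otimes> z\<close> on \<open>f \<otimes> g\<close>.
\<close>

definition coalgebra_pairing :: "nat \<Rightarrow> 'k::field pairing \<Rightarrow> bool" where
  "coalgebra_pairing p \<theta> \<longleftrightarrow>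
     (\<forall>st cd ab. \<forall>x\<in>bcomp p UNIV st ab.
        \<forall>f\<in>nat_trans (LG st) (LG cd). \<forall>g\<in>nat_trans (LG cd) (LG ab).
          \<theta> st ab x (comp_trans g f) =
          (\<Sum>(y, z)\<in>mons p UNIV st cd \<times> mons p UNIV cd ab.
             Poly_Mapping.lookup (coprod p x) (y, z)
             * \<theta> st cd (Poly_Mapping.single y 1) f * \<theta> cd ab (Poly_Mapping.single z 1) g)) \<and>
     (\<forall>ab. \<forall>x\<in>bcomp p UNIV ab ab. \<theta> ab ab x (id_trans (LG ab)) = counit x)"

text \<open>
  The inclusion of \<open>LG st\<^sub>1 (F\<^sup>m) \<otimes> LG st\<^sub>2 (F\<^sup>n)\<close> as a summand of \<open>LG (st\<^sub>1 + st\<^sub>2) (F\<^bsup>m+n\<^esup>)\<close>, given by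
  the wedge product and the shuffle product, evaluated on \<open>v \<otimes> w\<close>. The first \<open>m\<close> of the \<open>m + n\<close>
  coordinates belong to \<open>F\<^sup>m\<close>.
\<close>

definition exp_incl ::
  "nat \<Rightarrow> (nat set \<times> nat list \<Rightarrow> 'k::field) \<Rightarrow> (nat set \<times> nat list \<Rightarrow> 'k) \<Rightarrow> (nat set \<times> nat list \<Rightarrow> 'k)"
  where
  "exp_incl m v w = (\<lambda>(I, K).
     v (I \<inter> {..<m}, filter (\<lambda>k. k < m) K)
     * w ({i. m + i \<in> I}, map (\<lambda>k. k - m) (filter (\<lambda>k. m \<le> k) K)))"

text \<open>
  The inverse of the exponential isomorphism, followed by the projection to the summand
  \<open>LG ab\<^sub>1 (F\<^sup>m) \<otimes> LG ab\<^sub>2 (F\<^sup>n)\<close>, written in coordinates.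
\<close>

definition exp_proj ::
  "nat \<Rightarrow> nat \<Rightarrow> bideg \<Rightarrow> bideg \<Rightarrow> (nat set \<times> nat list \<Rightarrow> 'k::field)
    \<Rightarrow> ((nat set \<times> nat list) \<times> (nat set \<times> nat list) \<Rightarrow> 'k)"
  where
  "exp_proj m n ab1 ab2 z = (\<lambda>((I1, K1), (I2, K2)).
     if I1 \<subseteq> {..<m} \<and> set K1 \<subseteq> {..<m} \<and> (card I1, length K1) = ab1 \<and>
        I2 \<subseteq> {..<n} \<and> set K2 \<subseteq> {..<n} \<and> (card I2, length K2) = ab2
     then z (I1 \<union> (+) m ` I2, K1 @ map ((+) m) K2) else 0)"

definition hom_parity :: "bideg \<Rightarrow> bideg \<Rightarrow> nat" where
  "hom_parity st ab = fst st + fst ab"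

text \<open>
  \<open>exp_coproduct \<dots> f N f1 f2\<close> says that the indicated component of the coproduct of \<open>f\<close> coming from
  the exponential property is \<open>\<Sum>\<^sub>i f1 i \<otimes> f2 i\<close>. Here
  \<open>(f1 \<otimes> f2)(v \<otimes> w) = (-1)\<^bsup>|f2||v|\<^esup> f1(v) \<otimes> f2(w)\<close>, where \<open>LG (s, t)\<close> has parity \<open>s\<close>.
\<close>

definition exp_coproduct ::
  "bideg \<Rightarrow> bideg \<Rightarrow> bideg \<Rightarrow> bideg
   \<Rightarrow> ('k::field, nat set \<times> nat list, nat set \<times> nat list) trans \<Rightarrow> nat
   \<Rightarrow> (nat \<Rightarrow> ('k, nat set \<times> nat list, nat set \<times> nat list) trans)
   \<Rightarrow> (nat \<Rightarrow> ('k, nat set \<times> nat list, nat set \<times> nat list) trans) \<Rightarrow> bool"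
  where
  "exp_coproduct st1 ab1 st2 ab2 f N f1 f2 \<longleftrightarrow>
     (\<forall>i<N. f1 i \<in> nat_trans (LG st1) (LG ab1) \<and> f2 i \<in> nat_trans (LG st2) (LG ab2)) \<and>
     (\<forall>m n. \<forall>v\<in>fobj (LG st1) m. \<forall>w\<in>fobj (LG st2) n. \<forall>k1 k2.
        exp_proj m n ab1 ab2 (f (m + n) (exp_incl m v w)) (k1, k2) =
        (\<Sum>i<N. (-1) ^ (hom_parity st2 ab2 * fst st1) * (f1 i m v k1 * f2 i n w k2)))"

text \<open>
  The product is dual to this coproduct, with \<open>(x \<otimes> y)(f1 \<otimes> f2) = (-1)\<^bsup>|y||f1|\<^esup> x(f1) y(f2)\<close>.
  The two signs together make the dual product graded commutative and, with the unsigned pairing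
  of the coproduct with composition, a bialgebra in the graded sense.
\<close>

definition algebra_pairing :: "nat \<Rightarrow> 'k::field pairing \<Rightarrow> bool" where
  "algebra_pairing p \<theta> \<longleftrightarrow>
     (\<forall>st1 ab1 st2 ab2. \<forall>x\<in>bcomp p UNIV st1 ab1. \<forall>y\<in>bcomp p UNIV st2 ab2.
        \<forall>f\<in>nat_trans (LG (st1 + st2)) (LG (ab1 + ab2)). \<forall>N f1 f2.
          exp_coproduct st1 ab1 st2 ab2 f N f1 f2 \<longrightarrow>
          \<theta> (st1 + st2) (ab1 + ab2) (b_mul x y) f =
          (\<Sum>i<N. (-1) ^ (hom_parity st2 ab2 * hom_parity st1 ab1)
                 * \<theta> st1 ab1 x (f1 i) * \<theta> st2 ab2 y (f2 i))) \<and>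
     \<theta> (0, 0) (0, 0) (Poly_Mapping.single mon_one 1) (id_trans (LG (0, 0))) = 1"

text \<open>
  In the bidegrees that occur here the component of B is spanned by the generator, so being dual to
  a transformation means taking the value 1 on it.
\<close>

definition normalized_pairing :: "nat \<Rightarrow> 'k::field pairing \<Rightarrow> bool" where
  "normalized_pairing p \<theta> \<longleftrightarrow>
     \<theta> (1, 0) (1, 0) (Poly_Mapping.single (even_mon U 1) 1) (id_trans (LG (1, 0))) = 1 \<and>
     \<theta> (1, 0) (0, 1) (Poly_Mapping.single (odd_mon W) 1) lam1_to_gam1 = 1 \<and>
     (\<forall>j. \<theta> (0, p ^ j) (0, 1) (Poly_Mapping.single (even_mon (Xi j) 1) 1) (versch_trans p j) = 1) \<and>
     (\<forall>i. \<theta> (0, p ^ i) (1, 0) (Poly_Mapping.single (odd_mon (Tau i)) 1)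
            (comp_trans gam1_to_lam1 (versch_trans p i)) = 1)"

definition bialgebra_iso :: "nat \<Rightarrow> 'k::field pairing \<Rightarrow> bool" where
  "bialgebra_iso p \<theta> \<longleftrightarrow>
     linear_iso_pairing p \<theta> \<and> coalgebra_pairing p \<theta> \<and> algebra_pairing p \<theta> \<and> normalized_pairing p \<theta>"

section \<open>The comodules attached to a functor\<close>

text \<open>
  The coaction of \<open>\<eta>\<close> is the family \<open>c\<close>, standing for the sum of the \<open>c z \<otimes> z\<close>, such that evaluating
  the second factors at any \<open>f\<close> gives \<open>\<eta> \<circ> f\<close>.
\<close>

definition r_B ::
  "nat \<Rightarrow> 'k::field pairing \<Rightarrow> ('k, 'x) vfunctor \<Rightarrow> ('k, ('k, nat set \<times> nat list, 'x) trans) gcomod"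
  where
  "r_B p \<theta> G =
     \<lparr>scl = tscale,
      gr = (\<lambda>ab. nat_trans (LG ab) G),
      coact = (\<lambda>ab \<eta>. THE c.
        (\<forall>z. if rdeg z = ab then c z \<in> nat_trans (LG (ldeg p z)) G else c z = 0) \<and>
        (\<forall>st. \<forall>f\<in>nat_trans (LG st) (LG ab).
           (\<Sum>z\<in>mons p UNIV st ab. tscale (\<theta> st ab (Poly_Mapping.single z 1) f) (c z))
           = comp_trans \<eta> f))\<rparr>"

text \<open>
  A transformation between divided powers, regarded as one between \<open>LG (0, t) = \<Lambda>\<^sup>0 \<otimes> \<Gamma>\<^sup>t\<close> and
  \<open>LG (0, b)\<close>. Through it the pairing identifies the component of \<open>F[\<xi>\<^sub>j]\<close> with the dual of the
  transformations from \<open>Gam t\<close> to \<open>Gam b\<close>.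
\<close>

definition lam0_tensor ::
  "nat \<Rightarrow> ('k::field, nat list, nat list) trans \<Rightarrow> ('k, nat set \<times> nat list, nat set \<times> nat list) trans"
  where
  "lam0_tensor t f = (\<lambda>n z. if z \<in> fobj (LG (0, t)) n then (\<lambda>(I, K). f n (\<lambda>L. z (I, L)) K) else 0)"

definition xi_pairing ::
  "'k::field pairing \<Rightarrow> nat \<Rightarrow> nat \<Rightarrow> (mon \<Rightarrow>\<^sub>0 'k) \<Rightarrow> ('k, nat list, nat list) trans \<Rightarrow> 'k" where
  "xi_pairing \<theta> t b x f = \<theta> (0, t) (0, b) x (lam0_tensor t f)"

definition O_r' ::
  "nat \<Rightarrow> 'k::field pairing \<Rightarrow> ('k, 'x) vfunctor \<Rightarrow> ('k, ('k, nat list, 'x) trans) gcomod" where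
  "O_r' p \<theta> G =
     \<lparr>scl = tscale,
      gr = (\<lambda>(a, b). if a = 0 then nat_trans (Gam b) G else {0}),
      coact = (\<lambda>(a, b) \<eta>. if a = 0 then
        (THE c.
          (\<forall>z. if z \<in> xi_mons \<and> rdeg z = (0, b) then c z \<in> nat_trans (Gam (snd (ldeg p z))) G
               else c z = 0) \<and>
          (\<forall>t. \<forall>f\<in>nat_trans (Gam t) (Gam b).
             (\<Sum>z\<in>mons p xi_mons (0, t) (0, b).
                tscale (xi_pairing \<theta> t b (Poly_Mapping.single z 1) f) (c z))
             = comp_trans \<eta> f))
        else 0)\<rparr>"

text \<open>The isomorphism of \<open>\<Lambda>\<^sup>a\<close> with \<open>LG (a, 0) = \<Lambda>\<^sup>a \<otimes> \<Gamma>\<^sup>0\<close>.\<close>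

definition tensor_gam0 :: "nat \<Rightarrow> ('k::field, nat set, nat set \<times> nat list) trans" where
  "tensor_gam0 a = restr_trans (Lam a) (\<lambda>x (I, K). if K = [] then x I else 0)"

end

theory Submission
  imports Defs
begin

text \<open>
  The components of B are finite-dimensional, so the pairing has dual bases and identifies the
  transformations from \<open>LG st\<close> to \<open>LG ab\<close> with the dual of the component of B; under this
  identification precomposition with the dual basis becomes the coaction of \<open>F(a, b)\<close>. The monomials
  of right bidegree \<open>(a, 0)\<close> do not contain \<open>w\<close>, and those of left bidegree \<open>(0, t)\<close> and right bidegree
  \<open>(0, b)\<close> involve only the \<open>\<xi>\<^sub>j\<close>; so passing from B to \<open>B/(w)\<close> loses nothing in these cases.
  Coassociativity and the counit law for \<open>F(a, b)\<close> come from those of composition, and the comodule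
  structure of the other side is transported along the isomorphism.
\<close>

section \<open>Linear algebra\<close>

text \<open>Nothing is assumed about the dimension of the spaces of transformations. That they have
  a finite basis dual to the monomials is extracted from \<open>\<theta>\<close> being injective and
  onto the full dual. The same basis resolves the definite descriptions in \<open>r_B\<close> and
  \<open>O_r'\<close>: the family describing the coaction of \<open>\<eta>\<close> must consist of
  the composites of \<open>\<eta>\<close> with the dual basis elements. The coproduct of a general
  monomial, a signed product of sums, is never multiplied out. Only two properties are proved from
  the formulas on generators: the bidegrees of its terms match, and if the monomial contains
  \<open>w\<close>, then each term has \<open>w\<close> in at least one factor. The second lets
  coassociativity pass from B to B/(w). The isomorphism is first built from the functor side to
  \<open>F(a, b)\<close>, because pairing is an explicit map in that direction. Its bijectivity
  makes the functor side a comodule, and its inverse is the map of the theorem.\<close>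

lemma vector_space_fscale: "vector_space (fscale :: 'k::field \<Rightarrow> ('x \<Rightarrow> 'k) \<Rightarrow> 'x \<Rightarrow> 'k)"
  by unfold_locales (auto simp: fscale_def fun_eq_iff algebra_simps)

lemma vector_space_tscale:
  "vector_space (tscale :: 'k::field \<Rightarrow> ('k, 'x, 'y) trans \<Rightarrow> ('k, 'x, 'y) trans)"
  by unfold_locales (auto simp: tscale_def fscale_def fun_eq_iff algebra_simps)

lemma lookup_pscale [simp]:
  "Poly_Mapping.lookup (pscale c x) m = c * Poly_Mapping.lookup x m"
  by (simp add: pscale_def Poly_Mapping.map.rep_eq when_def)

lemma vector_space_pscale: "vector_space (pscale :: 'k::field \<Rightarrow> ('m \<Rightarrow>\<^sub>0 'k) \<Rightarrow> ('m \<Rightarrow>\<^sub>0 'k))"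
  by unfold_locales (auto intro!: poly_mapping_eqI simp: lookup_add algebra_simps)

lemma sum_fun_apply: "(\<Sum>i\<in>A. f i) x = (\<Sum>i\<in>A. f i x)"
  by (induction A rule: infinite_finite_induct) auto

lemma subspace_sum_scale:
  assumes "vector_space s" "module.subspace s V" "\<And>i. i \<in> A \<Longrightarrow> g i \<in> V"
  shows "(\<Sum>i\<in>A. s (c i) (g i)) \<in> V"
proof -
  interpret vector_space s by fact
  show ?thesis using assms(2,3) by (intro subspace_sum subspace_scale) auto
qed

lemma lin_on_0:
  assumes "vector_space s" "module.subspace s V" "vector_space t" "lin_on s V t f"
  shows "f 0 = 0"
proof -
  interpret s: vector_space s by fact
  interpret t: vector_space t by fact
  have "0 \<in> V" using assms(2) by (rule s.subspace_0)
  then have "f (s 0 0) = t 0 (f 0)" using assms(4) unfolding lin_on_def by blast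
  then show ?thesis by simp
qed

lemma lin_on_sum:
  assumes s: "vector_space s" and V: "module.subspace s V" and t: "vector_space t"
    and f: "lin_on s V t f" and g: "\<And>i. i \<in> A \<Longrightarrow> g i \<in> V"
  shows "f (\<Sum>i\<in>A. s (c i) (g i)) = (\<Sum>i\<in>A. t (c i) (f (g i)))"
  using g
proof (induction A rule: infinite_finite_induct)
  case (insert x F)
  interpret s: vector_space s by fact
  have "s (c x) (g x) \<in> V" "(\<Sum>i\<in>F. s (c i) (g i)) \<in> V"
    using insert.prems V by (auto intro!: subspace_sum_scale[OF s] s.subspace_scale)
  moreover have "f (s (c x) (g x)) = t (c x) (f (g x))"
    using f insert.prems unfolding lin_on_def by blast
  ultimately show ?case
    using insert f unfolding lin_on_def by simp
qed (simp_all add: lin_on_0[OF s V t f])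

lemma vector_space_mult: "vector_space ((*) :: 'k::field \<Rightarrow> 'k \<Rightarrow> 'k)"
  by unfold_locales (auto simp: algebra_simps)

text \<open>Adjoining \<open>x\<close> to a basis of \<open>V\<close> keeps it independent, so
  values may be prescribed on it. With \<open>V = {0}\<close> this shows that functionals detect
  nonzero vectors; with \<open>V\<close> an image it is a test for surjectivity.\<close>

lemma separating_functional:
  fixes s :: "'k::field \<Rightarrow> 'm::ab_group_add \<Rightarrow> 'm"
  assumes s: "vector_space s" and V: "module.subspace s V" and x: "x \<notin> V"
  shows "\<exists>\<psi>. lin_on s UNIV (*) \<psi> \<and> (\<forall>v\<in>V. \<psi> v = 0) \<and> \<psi> x = 1"
proof -
  interpret vector_space s by fact
  interpret k: vector_space "(*) :: 'k \<Rightarrow> 'k \<Rightarrow> 'k" by (rule vector_space_mult)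
  interpret vp: vector_space_pair s "(*) :: 'k \<Rightarrow> 'k \<Rightarrow> 'k" by unfold_locales
  obtain B where B: "B \<subseteq> V" "independent B" "V \<subseteq> span B"
    using maximal_independent_subset by blast
  then have VB: "V = span B" using V span_minimal by blast
  then have ind: "independent (insert x B)" using B x by (simp add: independent_insert)
  define \<psi> where "\<psi> = vp.construct (insert x B) (\<lambda>b. if b = x then 1 else 0)"
  have lin: "Vector_Spaces.linear s (*) \<psi>" unfolding \<psi>_def by (rule vp.linear_construct[OF ind])
  have "\<psi> b = (if b = x then 1 else 0)" if "b \<in> insert x B" for b
    unfolding \<psi>_def by (rule vp.construct_basis[OF ind that])
  moreover have "x \<notin> B" using x VB span_base by blast
  ultimately have "\<psi> x = 1" "\<And>b. b \<in> B \<Longrightarrow> \<psi> b = 0" by auto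
  moreover have "\<psi> v = 0" if "v \<in> V" for v
    using vp.linear_eq_0_on_span[OF lin, of B v] calculation(2) that VB by blast
  moreover have "lin_on s UNIV (*) \<psi>"
    using vp.linear_add[OF lin] vp.linear_scale[OF lin] by (simp add: lin_on_def)
  ultimately show ?thesis by blast
qed

text \<open>\<open>V\<close> may have any dimension; only the family \<open>e\<close> is finite.
  Joint evaluation maps \<open>V\<close> to the functions on \<open>Z\<close>, and a functional
  vanishing on its image is a linear relation among the \<open>e y\<close>. Independence therefore
  puts every unit vector into the image.\<close>

lemma dual_basis_exists:
  fixes s :: "'k::field \<Rightarrow> 'm::ab_group_add \<Rightarrow> 'm" and e :: "'z \<Rightarrow> 'm \<Rightarrow> 'k"
  assumes s: "vector_space s" and V: "module.subspace s V" and Z: "finite Z"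
    and e: "\<And>z. z \<in> Z \<Longrightarrow> lin_on s V (*) (e z)"
    and indep: "\<And>c z. (\<And>v. v \<in> V \<Longrightarrow> (\<Sum>y\<in>Z. c y * e y v) = 0) \<Longrightarrow> z \<in> Z \<Longrightarrow> c z = 0"
    and z: "z \<in> Z"
  shows "\<exists>v\<in>V. \<forall>y\<in>Z. e y v = (if y = z then 1 else 0)"
proof -
  interpret s: vector_space s by fact
  interpret fs: vector_space "fscale :: 'k \<Rightarrow> ('z \<Rightarrow> 'k) \<Rightarrow> 'z \<Rightarrow> 'k" by (rule vector_space_fscale)
  \<comment> \<open>The value 0 outside \<open>Z\<close> makes \<open>T v\<close> a finite
    combination of the unit vectors \<open>\<delta> y\<close>.\<close>
  define T where "T v = (\<lambda>y. if y \<in> Z then e y v else 0)" for v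
  define \<delta> :: "'z \<Rightarrow> 'z \<Rightarrow> 'k" where "\<delta> y = (\<lambda>x. if x = y then 1 else 0)" for y
  have Tlin: "T (v + w) = T v + T w" "T (s c v) = fscale c (T v)" if "v \<in> V" "w \<in> V" for v w c
    using e that by (auto simp: T_def fun_eq_iff lin_on_def fscale_def)
  have W: "fs.subspace (T ` V)"
  proof (rule fs.subspaceI)
    have V0: "0 \<in> V" using V by (rule s.subspace_0)
    then have "T 0 = 0" using Tlin(2)[of 0 0 0] by (simp add: fscale_def fun_eq_iff)
    then show "0 \<in> T ` V" using V0 by force
  next
    fix x y assume "x \<in> T ` V" "y \<in> T ` V"
    then obtain v w where "x = T v" "y = T w" "v \<in> V" "w \<in> V" by blast
    then show "x + y \<in> T ` V"
      using Tlin(1)[of v w] s.subspace_add[OF V] by (metis imageI)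
  next
    fix c x assume "x \<in> T ` V"
    then obtain v where "x = T v" "v \<in> V" by blast
    then show "fscale c x \<in> T ` V"
      using Tlin(2)[of v v c] s.subspace_scale[OF V] by (metis imageI)
  qed
  have "\<delta> z \<in> T ` V"
  proof (rule ccontr)
    assume "\<delta> z \<notin> T ` V"
    then obtain \<psi> where \<psi>: "lin_on fscale UNIV (*) \<psi>" "\<And>w. w \<in> T ` V \<Longrightarrow> \<psi> w = 0" "\<psi> (\<delta> z) = 1"
      using separating_functional[OF vector_space_fscale W] by blast
    have "(\<Sum>y\<in>Z. \<psi> (\<delta> y) * e y v) = 0" if "v \<in> V" for v
    proof -
      have "T v = (\<Sum>y\<in>Z. fscale (e y v) (\<delta> y))"
        using Z by (auto simp: fun_eq_iff T_def sum_fun_apply fscale_def \<delta>_def if_distrib cong: if_cong)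
      then have "\<psi> (T v) = (\<Sum>y\<in>Z. e y v * \<psi> (\<delta> y))"
        by (simp add: lin_on_sum[OF vector_space_fscale fs.subspace_UNIV vector_space_mult \<psi>(1)])
      then show ?thesis using \<psi>(2) that by (simp add: mult.commute)
    qed
    then show False using indep[of "\<lambda>y. \<psi> (\<delta> y)" z] z \<psi>(3) by simp
  qed
  then obtain v where "v \<in> V" "T v = \<delta> z" by auto
  then show ?thesis by (intro bexI[of _ v]) (auto simp: T_def \<delta>_def fun_eq_iff split: if_splits)
qed

section \<open>Homogeneity of the coproduct\<close>

text \<open>The disjointness comes from \<open>mon_sgn\<close>, which kills repeated odd generators.
  It matters because \<open>mon_mul\<close> takes a union of sets, so degrees add only for disjoint
  odd parts.\<close>

lemma keys_bb_mul:
  assumes "k \<in> Poly_Mapping.keys (bb_mul x y)"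
  obtains m n where "m \<in> Poly_Mapping.keys x" "n \<in> Poly_Mapping.keys y"
    "k = (mon_mul (fst m) (fst n), mon_mul (snd m) (snd n))"
    "fst (fst m) |\<inter>| fst (fst n) = {||}" "fst (snd m) |\<inter>| fst (snd n) = {||}"
proof -
  have "Poly_Mapping.lookup (bb_mul x y) k \<noteq> 0"
    using assms by (simp add: in_keys_iff)
  then obtain m n where mn: "m \<in> Poly_Mapping.keys x" "n \<in> Poly_Mapping.keys y"
    "Poly_Mapping.lookup (Poly_Mapping.single (mon_mul (fst m) (fst n), mon_mul (snd m) (snd n))
       ((-1) ^ (mon_parity (snd m) * mon_parity (fst n))
         * mon_sgn (fst m) (fst n) * mon_sgn (snd m) (snd n)
         * Poly_Mapping.lookup x m * Poly_Mapping.lookup y n)) k \<noteq> 0"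
    unfolding bb_mul_def lookup_sum by (meson sum.not_neutral_contains_not_neutral)
  show thesis
    by (rule that[OF mn(1,2)])
      (use mn(3) in \<open>auto simp: lookup_single when_def mon_sgn_def split: if_splits\<close>)
qed

lemma ldeg_mon_mul:
  "fst m |\<inter>| fst n = {||} \<Longrightarrow> ldeg p (mon_mul m n) = ldeg p m + ldeg p n"
  unfolding ldeg_def mon_mul_def
  by (subst fst_conv, subst union_fset, subst sum.union_disjoint) (auto simp: algebra_simps)

lemma rdeg_mon_mul:
  "fst m |\<inter>| fst n = {||} \<Longrightarrow> rdeg (mon_mul m n) = rdeg m + rdeg n"
  unfolding rdeg_def mon_mul_def
  by (subst fst_conv, subst union_fset, subst sum.union_disjoint) (auto simp: algebra_simps)

text \<open>The middle equation says that the two gradings agree across the tensor sign: all terms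
  lie in products of a component from \<open>st\<close> to some \<open>cd\<close> with a component
  from the same \<open>cd\<close> to \<open>ab\<close>.\<close>

definition homog :: "nat \<Rightarrow> (mon \<times> mon \<Rightarrow>\<^sub>0 'k::field) \<Rightarrow> bideg \<Rightarrow> bideg \<Rightarrow> bool" where
  "homog p x st ab \<longleftrightarrow> (\<forall>(m, n)\<in>Poly_Mapping.keys x.
     ldeg p m = st \<and> rdeg m = ldeg p n \<and> rdeg n = ab)"

lemma homogD:
  assumes "homog p x st ab" "(m, n) \<in> Poly_Mapping.keys x"
  shows "ldeg p m = st" "rdeg m = ldeg p n" "rdeg n = ab"
  using assms by (auto simp: homog_def)

lemma homog_bb_mul:
  assumes "homog p x st ab" "homog p y st' ab'"
  shows "homog p (bb_mul x y) (st + st') (ab + ab')"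
  unfolding homog_def
proof safe
  fix m n assume k: "(m, n) \<in> Poly_Mapping.keys (bb_mul x y)"
  obtain m1 n1 m2 n2 where "(m1, n1) \<in> Poly_Mapping.keys x" "(m2, n2) \<in> Poly_Mapping.keys y"
    "m = mon_mul m1 m2" "n = mon_mul n1 n2"
    "fst m1 |\<inter>| fst m2 = {||}" "fst n1 |\<inter>| fst n2 = {||}"
    using k by (elim keys_bb_mul) force
  then show "ldeg p m = st + st'" "rdeg m = ldeg p n" "rdeg n = ab + ab'"
    using homogD[OF assms(1)] homogD[OF assms(2)] by (simp_all add: ldeg_mon_mul rdeg_mon_mul)
qed

lemma homog_add: "homog p x st ab \<Longrightarrow> homog p y st ab \<Longrightarrow> homog p (x + y) st ab"
  using Poly_Mapping.keys_add[of x y] by (fastforce simp: homog_def)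

lemma homog_sum: "(\<And>i. i \<in> A \<Longrightarrow> homog p (x i) st ab) \<Longrightarrow> homog p (\<Sum>i\<in>A. x i) st ab"
  by (induction A rule: infinite_finite_induct) (auto simp: homog_add, auto simp: homog_def)

lemma deg_gen [simp]:
  "ldeg p (odd_mon g) = ldeg_odd p g" "rdeg (odd_mon g) = rdeg_odd g"
  "ldeg p (even_mon h n) = (n * fst (ldeg_even p h), n * snd (ldeg_even p h))"
  "rdeg (even_mon h n) = (n * fst (rdeg_even h), n * snd (rdeg_even h))"
proof -
  show "ldeg p (odd_mon g) = ldeg_odd p g" "rdeg (odd_mon g) = rdeg_odd g"
    by (simp_all add: ldeg_def rdeg_def odd_mon_def)
  show "ldeg p (even_mon h n) = (n * fst (ldeg_even p h), n * snd (ldeg_even p h))"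
    "rdeg (even_mon h n) = (n * fst (rdeg_even h), n * snd (rdeg_even h))"
    by (induction n) (simp_all add: ldeg_def rdeg_def even_mon_def prod_eq_iff)
qed

lemma homog_single: "ldeg p m = st \<Longrightarrow> rdeg m = ldeg p n \<Longrightarrow> rdeg n = ab \<Longrightarrow>
  homog p (Poly_Mapping.single (m, n) c) st ab"
  by (simp add: homog_def)

text \<open>The exponents in the coproduct are made for this: the \<open>p ^ s\<close>-th power of
  \<open>Xi (i - s)\<close> has left bidegree \<open>(0, p ^ i)\<close>, and its right bidegree
  \<open>(0, p ^ s)\<close> is the left bidegree of \<open>Tau s\<close>.\<close>

lemma homog_coprod_odd: "homog p (coprod_odd p g) (ldeg_odd p g) (rdeg_odd g)"
  by (cases g) (auto intro!: homog_add homog_sum homog_single simp flip: power_add)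

lemma homog_coprod_even: "homog p (coprod_even p g) (ldeg_even p g) (rdeg_even g)"
  by (cases g) (auto intro!: homog_add homog_sum homog_single simp flip: power_add)

lemma homog_foldr:
  assumes "homog p y st ab" "\<And>g. g \<in> set gs \<Longrightarrow> homog p (f g) (d g) (e g)"
  shows "homog p (foldr bb_mul (map f gs) y) (sum_list (map d gs) + st) (sum_list (map e gs) + ab)"
  using assms by (induction gs) (auto simp: add.assoc intro!: homog_bb_mul)

lemma homog_coprod_mon: "homog p (coprod_mon p m) (ldeg p m) (rdeg m)"
proof -
  have "homog p bb_one 0 0"
    by (auto simp: bb_one_def homog_def mon_one_def ldeg_def rdeg_def)
  then have "homog p (coprod_mon p m)
    (sum_list (map (ldeg_odd p) (sorted_list_of_fset (fst m)))
      + (sum_list (map (ldeg_even p) (sorted_list_of_multiset (snd m))) + 0))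
    (sum_list (map rdeg_odd (sorted_list_of_fset (fst m)))
      + (sum_list (map rdeg_even (sorted_list_of_multiset (snd m))) + 0))"
    unfolding coprod_mon_def foldr_append
    by (intro homog_foldr homog_coprod_even homog_coprod_odd)
  moreover have "sum_list (map f (sorted_list_of_fset A)) = sum f (fset A)"
    for f :: "odd_gen \<Rightarrow> bideg" and A
    by (simp add: sorted_list_of_fset.rep_eq sum_list_distinct_conv_sum_set)
  moreover have "sum_list (map f (sorted_list_of_multiset M)) = (\<Sum>g\<in>#M. f g)"
    for f :: "even_gen \<Rightarrow> bideg" and M
    by (metis mset_map mset_sorted_list_of_multiset sum_mset_sum_list)
  ultimately show ?thesis
    by (simp add: ldeg_def rdeg_def)
qed

text \<open>The ideal generated by \<open>w\<close> is a coideal. Both terms of the coproduct of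
  \<open>w\<close> have \<open>w\<close> in one factor, and multiplication by anything keeps this or
  gives 0, so one such element in the list to be multiplied suffices.\<close>

lemma W_coprod_mon:
  assumes "W |\<in>| fst m" "(x, y) \<in> Poly_Mapping.keys (coprod_mon p m :: _ \<Rightarrow>\<^sub>0 'k::field)"
  shows "\<not> (x \<in> wfree \<and> y \<in> wfree)"
proof -
  define hasW where
    "hasW z \<longleftrightarrow> (\<forall>(x, y)\<in>Poly_Mapping.keys z. W |\<in>| fst x \<or> W |\<in>| fst y)" for z :: "mon \<times> mon \<Rightarrow>\<^sub>0 'k"
  have mul: "hasW (bb_mul z z')" if "hasW z \<or> hasW z'" for z z' :: "mon \<times> mon \<Rightarrow>\<^sub>0 'k"
    unfolding hasW_def
  proof safe
    fix x y assume k: "(x, y) \<in> Poly_Mapping.keys (bb_mul z z')" "W |\<notin>| fst y"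
    obtain m n m' n' where "(m, n) \<in> Poly_Mapping.keys z" "(m', n') \<in> Poly_Mapping.keys z'"
      "x = mon_mul m m'" "y = mon_mul n n'"
      using k(1) by (elim keys_bb_mul) force
    then show "W |\<in>| fst x"
      using that k(2) by (fastforce simp: hasW_def mon_mul_def)
  qed
  have fold: "hasW (foldr bb_mul zs z)" if "\<exists>z'\<in>set zs. hasW z'" for zs and z :: "mon \<times> mon \<Rightarrow>\<^sub>0 'k"
    using that by (induction zs) (auto intro: mul)
  have "hasW (coprod_odd p W)"
    using Poly_Mapping.keys_add[of "Poly_Mapping.single (even_mon U 1, odd_mon W) (1::'k)"
      "Poly_Mapping.single (odd_mon W, even_mon (Xi 0) 1) 1"]
    by (auto simp: hasW_def odd_mon_def)
  then have "hasW (coprod_mon p m)"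
    unfolding coprod_mon_def using assms(1)
    by (intro fold bexI[of _ "coprod_odd p W"]) (auto simp del: coprod_odd.simps)
  then show ?thesis using assms(2) by (auto simp: hasW_def wfree_def)
qed

text \<open>Summing over any finite superset of the support lets two elements be expanded over one
  index set, which is what additivity of \<open>coprod\<close> requires.\<close>

lemma lookup_coprod:
  assumes "Poly_Mapping.keys x \<subseteq> A" "finite A"
  shows "Poly_Mapping.lookup (coprod p x) k =
    (\<Sum>m\<in>A. Poly_Mapping.lookup x m * Poly_Mapping.lookup (coprod_mon p m) k)"
  unfolding coprod_def lookup_sum lookup_pscale
  using assms by (intro sum.mono_neutral_left) (auto simp: in_keys_iff)

lemma coprod_single [simp]: "coprod p (Poly_Mapping.single m 1) = coprod_mon p m"
  by (rule poly_mapping_eqI) (simp add: lookup_coprod[of _ "{m}"])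

lemma lookup_coprod_add:
  "Poly_Mapping.lookup (coprod p (x + y)) k =
   Poly_Mapping.lookup (coprod p x) k + Poly_Mapping.lookup (coprod p y) k"
proof -
  let ?A = "Poly_Mapping.keys x \<union> Poly_Mapping.keys y"
  show ?thesis
    using Poly_Mapping.keys_add[of x y]
    by (simp add: lookup_coprod[of _ ?A] lookup_add distrib_right sum.distrib)
qed

lemma lookup_coprod_pscale:
  "Poly_Mapping.lookup (coprod p (pscale c x)) k = c * Poly_Mapping.lookup (coprod p x) k"
proof -
  have "Poly_Mapping.keys (pscale c x) \<subseteq> Poly_Mapping.keys x" by (auto simp: in_keys_iff)
  then show ?thesis
    by (simp add: lookup_coprod[of _ "Poly_Mapping.keys x"] sum_distrib_left mult.assoc)
qed

lemma lookup_bar_coprod: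
  "Poly_Mapping.lookup (bar_coprod p x) (m, n) =
   (if m \<in> wfree \<and> n \<in> wfree then Poly_Mapping.lookup (coprod p x) (m, n) else 0)"
proof -
  have "Poly_Mapping.lookup (bar_coprod p x) (m, n) =
    (\<Sum>k\<in>Poly_Mapping.keys (coprod p x) \<inter> wfree \<times> wfree.
      if k = (m, n) then Poly_Mapping.lookup (coprod p x) k else 0)"
    by (simp add: bar_coprod_def lookup_sum lookup_single when_def)
  also have "\<dots> = (if m \<in> wfree \<and> n \<in> wfree then Poly_Mapping.lookup (coprod p x) (m, n) else 0)"
    by (subst sum.delta) (auto simp: in_keys_iff)
  finally show ?thesis .
qed

lemma coprod_bcomp_support:
  assumes "x \<in> bcomp p S st ab" "Poly_Mapping.lookup (coprod p x) (m, n) \<noteq> 0"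
  shows "ldeg p m = st" "rdeg m = ldeg p n" "rdeg n = ab"
proof -
  have "(\<Sum>k\<in>Poly_Mapping.keys x. Poly_Mapping.lookup x k * Poly_Mapping.lookup (coprod_mon p k) (m, n)) \<noteq> 0"
    using assms(2) by (simp add: lookup_coprod[of _ "Poly_Mapping.keys x"])
  then obtain k where k: "k \<in> Poly_Mapping.keys x"
    "Poly_Mapping.lookup x k * Poly_Mapping.lookup (coprod_mon p k) (m, n) \<noteq> 0"
    by (rule sum.not_neutral_contains_not_neutral)
  then have "(m, n) \<in> Poly_Mapping.keys (coprod_mon p k :: _ \<Rightarrow>\<^sub>0 'a)"
    by (simp add: in_keys_iff)
  then show "ldeg p m = st" "rdeg m = ldeg p n" "rdeg n = ab"
    using assms(1) k(1) homog_coprod_mon[of p k] by (fastforce simp: bcomp_def mons_def homog_def)+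
qed

section \<open>Components of the bialgebra\<close>

lemma single_in_bcomp [simp]: "m \<in> mons p S st ab \<Longrightarrow> Poly_Mapping.single m c \<in> bcomp p S st ab"
  by (simp add: bcomp_def)

lemma subspace_bcomp: "module.subspace pscale (bcomp p S st ab)"
proof -
  interpret vector_space "pscale :: 'a \<Rightarrow> (mon \<Rightarrow>\<^sub>0 'a) \<Rightarrow> _" by (rule vector_space_pscale)
  show ?thesis
  proof (rule subspaceI)
    fix x y :: "mon \<Rightarrow>\<^sub>0 'a" and c
    assume x: "x \<in> bcomp p S st ab"
    then show "pscale c x \<in> bcomp p S st ab"
      by (auto simp: bcomp_def in_keys_iff)
    assume "y \<in> bcomp p S st ab"
    with x show "x + y \<in> bcomp p S st ab"
      using Poly_Mapping.keys_add[of x y] by (auto simp: bcomp_def)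
  qed (simp add: bcomp_def)
qed

lemma bcomp_expand:
  assumes "2 \<le> p" "x \<in> bcomp p S st ab"
  shows "x = (\<Sum>m\<in>mons p S st ab. pscale (Poly_Mapping.lookup x m) (Poly_Mapping.single m 1))"
proof (rule poly_mapping_eqI)
  fix k
  show "Poly_Mapping.lookup x k = Poly_Mapping.lookup
    (\<Sum>m\<in>mons p S st ab. pscale (Poly_Mapping.lookup x m) (Poly_Mapping.single m 1)) k"
    using assms finite_mons[OF assms(1), of S st ab]
    by (auto simp: lookup_sum lookup_single when_def if_distrib in_keys_iff bcomp_def cong: if_cong)
qed

lemma lin_on_bcomp_expand:
  assumes "2 \<le> p" "vector_space t" "lin_on pscale (bcomp p S st ab) t f" "x \<in> bcomp p S st ab"
  shows "f x = (\<Sum>m\<in>mons p S st ab. t (Poly_Mapping.lookup x m) (f (Poly_Mapping.single m 1)))"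
  by (subst bcomp_expand[OF assms(1,4)], subst lin_on_sum[OF vector_space_pscale subspace_bcomp assms(2,3)])
    simp_all

lemma subspace_dual_space:
  assumes "vector_space s"
  shows "module.subspace fscale (dual_space s V)"
proof -
  interpret vector_space "fscale :: 'a \<Rightarrow> ('b \<Rightarrow> 'a) \<Rightarrow> _" by (rule vector_space_fscale)
  show ?thesis
    by (rule subspaceI) (auto simp: dual_space_def lin_on_def fscale_def algebra_simps)
qed

section \<open>Linear functors and their transformations\<close>

text \<open>The record \<open>vfunctor\<close> carries no axioms; these make
  \<open>nat_trans G H\<close> a vector space that composition respects. Linearity refers to each
  single map \<open>fmor G A\<close>, not to the dependence on \<open>A\<close>. It is asked on all
  functions because \<open>tensor_functor\<close> applies \<open>fmor\<close> to slices that are not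
  known to lie in \<open>fobj\<close>.\<close>

definition linear_functor :: "('k::field, 'x) vfunctor \<Rightarrow> bool" where
  "linear_functor G \<longleftrightarrow>
     (\<forall>n. module.subspace fscale (fobj G n)) \<and>
     (\<forall>A. lin_on fscale UNIV fscale (fmor G A)) \<and>
     (\<forall>m n. \<forall>A\<in>carrier_mat m n. fmor G A ` fobj G n \<subseteq> fobj G m)"

lemma linear_functorD:
  assumes "linear_functor G"
  shows "module.subspace fscale (fobj G n)"
    and "fmor G A (x + y) = fmor G A x + fmor G A y"
    and "fmor G A (fscale c x) = fscale c (fmor G A x)"
    and "A \<in> carrier_mat m n \<Longrightarrow> x \<in> fobj G n \<Longrightarrow> fmor G A x \<in> fobj G m"
  using assms unfolding linear_functor_def lin_on_def image_subset_iff by blast+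

lemma linear_functor_fobj:
  assumes "linear_functor G"
  shows "0 \<in> fobj G n" "x \<in> fobj G n \<Longrightarrow> y \<in> fobj G n \<Longrightarrow> x + y \<in> fobj G n"
    "x \<in> fobj G n \<Longrightarrow> fscale c x \<in> fobj G n"
proof -
  interpret vector_space "fscale :: 'a \<Rightarrow> ('b \<Rightarrow> 'a) \<Rightarrow> _" by (rule vector_space_fscale)
  note S = linear_functorD(1)[OF assms]
  show "0 \<in> fobj G n" "x \<in> fobj G n \<Longrightarrow> y \<in> fobj G n \<Longrightarrow> x + y \<in> fobj G n"
    "x \<in> fobj G n \<Longrightarrow> fscale c x \<in> fobj G n"
    using subspace_0[OF S] subspace_add[OF S] subspace_scale[OF S] by blast+
qed

lemma fobj_Lam:
  "x \<in> fobj (Lam a) n \<longleftrightarrow> (\<forall>I. \<not> (I \<subseteq> {..<n} \<and> card I = a) \<longrightarrow> x I = 0)"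
  by (auto simp: Lam_def)

lemma fobj_Gam:
  "x \<in> fobj (Gam b) n \<longleftrightarrow> (\<forall>K. \<not> (length K = b \<and> set K \<subseteq> {..<n}) \<longrightarrow> x K = 0) \<and>
     (\<forall>\<sigma> K. \<sigma> permutes {..<b} \<longrightarrow> length K = b \<longrightarrow> x (permute_list \<sigma> K) = x K)"
  by (auto simp: Gam_def tensor_pow_obj_def)

lemma fscale_apply: "fscale c v x = c * v x"
  by (simp add: fscale_def)

lemma linear_functor_Lam: "linear_functor (Lam a :: ('k::field, nat set) vfunctor)"
proof -
  interpret vector_space "fscale :: 'k \<Rightarrow> (nat set \<Rightarrow> 'k) \<Rightarrow> _" by (rule vector_space_fscale)
  show ?thesis
    unfolding linear_functor_def
  proof (intro conjI allI ballI)
    fix n show "subspace (fobj (Lam a :: ('k, nat set) vfunctor) n)"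
      by (rule subspaceI) (auto simp: fobj_Lam fscale_def)
  qed (auto simp: Lam_def lin_on_def fscale_def fun_eq_iff algebra_simps sum.distrib sum_distrib_left
      split: if_splits)
qed

text \<open>Permuting row and column indices together only reorders the factors of each product. So
  \<open>\<sigma>\<close> can be moved from \<open>K\<close> to the summation index, where the
  symmetry of \<open>x\<close> absorbs it.\<close>

lemma tensor_pow_mor_permute:
  assumes x: "\<And>K. length K = b \<Longrightarrow> x (permute_list \<sigma> K) = x K"
    and \<sigma>: "\<sigma> permutes {..<b}" and K: "length K = b"
  shows "tensor_pow_mor b A x (permute_list \<sigma> K) = tensor_pow_mor b A x K"
proof (cases "set K \<subseteq> {..<dim_row A}")
  case True
  let ?J = "{J. set J \<subseteq> {..<dim_col A} \<and> length J = b}"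
  have inv: "inv_into UNIV \<sigma> permutes {..<b}" using \<sigma> by (rule permutes_inv)
  have "(\<Sum>J\<in>?J. (\<Prod>i<b. A $$ (K ! i, J ! i)) * x J) =
    (\<Sum>J\<in>?J. (\<Prod>i<b. A $$ (permute_list \<sigma> K ! i, J ! i)) * x J)"
  proof (rule sum.reindex_bij_witness[of _ "permute_list (inv_into UNIV \<sigma>)" "permute_list \<sigma>"])
    fix J assume J: "J \<in> ?J"
    show "permute_list (inv_into UNIV \<sigma>) (permute_list \<sigma> J) = J" "permute_list \<sigma> (permute_list (inv_into UNIV \<sigma>) J) = J"
      using J \<sigma> inv
      by (simp_all add: permutes_inv_o flip: permute_list_compose)
    show "permute_list \<sigma> J \<in> ?J" "permute_list (inv_into UNIV \<sigma>) J \<in> ?J"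
      using J \<sigma> inv by simp_all
    have "(\<Prod>i<b. A $$ (permute_list \<sigma> K ! i, permute_list \<sigma> J ! i)) = (\<Prod>i<b. A $$ (K ! \<sigma> i, J ! \<sigma> i))"
      using J K \<sigma> by (intro prod.cong) (simp_all add: permute_list_nth)
    also have "\<dots> = (\<Prod>i<b. A $$ (K ! i, J ! i))"
      using prod.permute[OF \<sigma>, of "\<lambda>i. A $$ (K ! i, J ! i)"] by (simp add: o_def)
    finally show "(\<Prod>i<b. A $$ (permute_list \<sigma> K ! i, permute_list \<sigma> J ! i)) * x (permute_list \<sigma> J) =
      (\<Prod>i<b. A $$ (K ! i, J ! i)) * x J"
      using x J by simp
  qed
  then show ?thesis using True K \<sigma> by (simp add: tensor_pow_mor_def)
qed (use K \<sigma> in \<open>simp add: tensor_pow_mor_def\<close>)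

lemma linear_functor_Gam: "linear_functor (Gam b :: ('k::field, nat list) vfunctor)"
proof -
  interpret vector_space "fscale :: 'k \<Rightarrow> (nat list \<Rightarrow> 'k) \<Rightarrow> _" by (rule vector_space_fscale)
  show ?thesis
    unfolding linear_functor_def
  proof (intro conjI allI ballI)
    fix n show "subspace (fobj (Gam b :: ('k, nat list) vfunctor) n)"
      by (rule subspaceI) (auto simp: fobj_Gam fscale_def)
  next
    fix A :: "'k mat"
    show "lin_on fscale UNIV fscale (fmor (Gam b) A)"
      by (auto simp: Gam_def tensor_pow_mor_def lin_on_def fscale_def fun_eq_iff algebra_simps
          sum.distrib sum_distrib_left)
  next
    fix m n and A :: "'k mat"
    assume "A \<in> carrier_mat m n"
    then show "fmor (Gam b) A ` fobj (Gam b) n \<subseteq> fobj (Gam b) m"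
      by (auto simp: Gam_def tensor_pow_mor_permute)
        (auto simp: tensor_pow_obj_def tensor_pow_mor_def split: if_splits)
  qed
qed

text \<open>Linearity is inherited slice by slice. That values are preserved need only be checked on
  pure tensors, where the two factors are acted on separately, since these span
  \<open>fobj\<close>.\<close>

lemma linear_functor_tensor:
  fixes G :: "('k::field, 'x) vfunctor" and H :: "('k, 'y) vfunctor"
  assumes G: "linear_functor G" and H: "linear_functor H"
  shows "linear_functor (tensor_functor G H)"
proof -
  interpret vector_space "fscale :: 'k \<Rightarrow> ('x \<times> 'y \<Rightarrow> 'k) \<Rightarrow> _" by (rule vector_space_fscale)
  let ?T = "tensor_functor G H"
  have add: "fmor ?T A (z + z') = fmor ?T A z + fmor ?T A z'" for A z z'
  proof -
    have "(\<lambda>i. fmor H A (\<lambda>l. z (i, l) + z' (i, l)) k) =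
      (\<lambda>i. fmor H A (\<lambda>l. z (i, l)) k) + (\<lambda>i. fmor H A (\<lambda>l. z' (i, l)) k)" for k
      using linear_functorD(2)[OF H, of A "\<lambda>l. z (_, l)" "\<lambda>l. z' (_, l)"]
      by (auto simp: fun_eq_iff plus_fun_def)
    then have "fmor G A (\<lambda>i. fmor H A (\<lambda>l. z (i, l) + z' (i, l)) k) =
        fmor G A (\<lambda>i. fmor H A (\<lambda>l. z (i, l)) k) + fmor G A (\<lambda>i. fmor H A (\<lambda>l. z' (i, l)) k)" for k
      by (simp only: linear_functorD(2)[OF G])
    then show ?thesis
      by (simp add: tensor_functor_def fun_eq_iff)
  qed
  have scale: "fmor ?T A (fscale c z) = fscale c (fmor ?T A z)" for A c z
  proof -
    have "(\<lambda>i. fmor H A (\<lambda>l. fscale c z (i, l)) k) = fscale c (\<lambda>i. fmor H A (\<lambda>l. z (i, l)) k)" for k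
      using linear_functorD(3)[OF H, of A c "\<lambda>l. z (_, l)"]
      by (auto simp: fun_eq_iff fscale_def)
    then show ?thesis
      by (auto simp: tensor_functor_def fun_eq_iff linear_functorD(3)[OF G]) (simp add: fscale_def)
  qed
  have pres: "fmor ?T A z \<in> fobj ?T m" if A: "A \<in> carrier_mat m n" and z: "z \<in> fobj ?T n" for A m n z
  proof -
    have sp: "subspace (fobj ?T k)" for k by (simp add: tensor_functor_def)
    have "z \<in> span {(\<lambda>(i, j). x i * y j) | x y. x \<in> fobj G n \<and> y \<in> fobj H n}"
      using z by (simp add: tensor_functor_def)
    then show ?thesis
    proof (induction rule: span_induct_alt)
      case base
      have "fmor ?T A 0 = 0"
        using scale[of A 0 0] by (simp add: fscale_def zero_fun_def)
      then show ?case using subspace_0[OF sp] by metis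
    next
      case (step c z w)
      then obtain x y where xy: "z = (\<lambda>(i, j). x i * y j)" "x \<in> fobj G n" "y \<in> fobj H n" by blast
      have "fmor ?T A z (j, k) = fmor G A x j * fmor H A y k" for j k
      proof -
        have 1: "fmor H A (\<lambda>l. x i * y l) = fscale (x i) (fmor H A y)" for i
          using linear_functorD(3)[OF H, of A "x i" y] by (simp add: fscale_def)
        have "fmor G A (\<lambda>i. x i * fmor H A y k) = fscale (fmor H A y k) (fmor G A x)"
          using linear_functorD(3)[OF G, of A "fmor H A y k" x] by (simp add: fscale_def mult.commute)
        then show ?thesis
          by (simp add: tensor_functor_def xy(1) 1) (simp add: fscale_def)
      qed
      then have "fmor ?T A z = (\<lambda>(j, k). fmor G A x j * fmor H A y k)" by auto
      then have "fmor ?T A z \<in> fobj ?T m"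
        using linear_functorD(4)[OF G A xy(2)] linear_functorD(4)[OF H A xy(3)]
        by (auto simp: tensor_functor_def intro!: span_base)
      then show ?case
        unfolding add scale using step.IH by (intro subspace_add[OF sp] subspace_scale[OF sp])
    qed
  qed
  show ?thesis
    unfolding linear_functor_def
    using add scale pres by (auto simp: lin_on_def) (simp add: tensor_functor_def)
qed

lemma linear_functor_LG: "linear_functor (LG ab)"
  unfolding LG_def by (intro linear_functor_tensor linear_functor_Lam linear_functor_Gam)

section \<open>Spaces of natural transformations and their composition\<close>

lemma nat_transD:
  assumes "\<eta> \<in> nat_trans G H"
  shows "v \<in> fobj G n \<Longrightarrow> \<eta> n v \<in> fobj H n"
    "v \<notin> fobj G n \<Longrightarrow> \<eta> n v = 0"
    "v \<in> fobj G n \<Longrightarrow> w \<in> fobj G n \<Longrightarrow> \<eta> n (v + w) = \<eta> n v + \<eta> n w"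
    "v \<in> fobj G n \<Longrightarrow> \<eta> n (fscale c v) = fscale c (\<eta> n v)"
    "A \<in> carrier_mat m n \<Longrightarrow> v \<in> fobj G n \<Longrightarrow> \<eta> m (fmor G A v) = fmor H A (\<eta> n v)"
  using assms unfolding nat_trans_def lin_on_def image_subset_iff by blast+

lemma nat_transI:
  assumes "\<And>n v. v \<in> fobj G n \<Longrightarrow> \<eta> n v \<in> fobj H n"
    "\<And>n v. v \<notin> fobj G n \<Longrightarrow> \<eta> n v = 0"
    "\<And>n v w. v \<in> fobj G n \<Longrightarrow> w \<in> fobj G n \<Longrightarrow> \<eta> n (v + w) = \<eta> n v + \<eta> n w"
    "\<And>n c v. v \<in> fobj G n \<Longrightarrow> \<eta> n (fscale c v) = fscale c (\<eta> n v)"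
    "\<And>m n A v. A \<in> carrier_mat m n \<Longrightarrow> v \<in> fobj G n \<Longrightarrow> \<eta> m (fmor G A v) = fmor H A (\<eta> n v)"
  shows "\<eta> \<in> nat_trans G H"
  using assms unfolding nat_trans_def lin_on_def image_subset_iff by blast

lemma nat_trans_0:
  assumes "linear_functor G" "\<eta> \<in> nat_trans G H"
  shows "\<eta> n 0 = 0"
  using nat_transD(4)[OF assms(2) linear_functor_fobj(1)[OF assms(1)], of n 0]
  by (simp add: fscale_def zero_fun_def)

text \<open>The default value 0 outside \<open>fobj G n\<close> also lies in the subspace
  \<open>fobj H n\<close>, so no condition on \<open>v\<close> is needed.\<close>

lemma nat_trans_in:
  assumes "linear_functor H" "\<eta> \<in> nat_trans G H"
  shows "\<eta> n v \<in> fobj H n"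
  using nat_transD(1,2)[OF assms(2)] linear_functor_fobj(1)[OF assms(1)] by metis

lemma subspace_nat_trans:
  assumes "linear_functor H"
  shows "module.subspace tscale (nat_trans G H)"
proof -
  interpret vector_space "tscale :: 'a \<Rightarrow> ('a, 'c, 'b) trans \<Rightarrow> _" by (rule vector_space_tscale)
  interpret fs: vector_space "fscale :: 'a \<Rightarrow> ('b \<Rightarrow> 'a) \<Rightarrow> _" by (rule vector_space_fscale)
  note H = linear_functor_fobj[OF assms]
  have H0: "fmor H A 0 = 0" for A
    using linear_functorD(3)[OF assms, of A 0 0] by simp
  show ?thesis
  proof (rule subspaceI)
    show "0 \<in> nat_trans G H"
      by (rule nat_transI) (simp_all add: H H0)
    fix \<eta> \<zeta> :: "('a, 'c, 'b) trans" and c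
    assume \<eta>: "\<eta> \<in> nat_trans G H"
    show "tscale c \<eta> \<in> nat_trans G H"
      by (rule nat_transI)
        (auto simp: tscale_def nat_transD[OF \<eta>] H linear_functorD(3)[OF assms]
          fs.scale_right_distrib mult.commute)
    assume \<zeta>: "\<zeta> \<in> nat_trans G H"
    show "\<eta> + \<zeta> \<in> nat_trans G H"
      by (rule nat_transI)
        (auto simp: nat_transD[OF \<eta>] nat_transD[OF \<zeta>] H linear_functorD(2)[OF assms]
          fs.scale_right_distrib algebra_simps)
  qed
qed

text \<open>Linearity of \<open>H\<close> ensures that \<open>g\<close> sends 0, the value of
  \<open>f\<close> outside \<open>fobj G n\<close>, to 0.\<close>

lemma comp_trans_in_nat_trans:
  assumes "linear_functor H" "f \<in> nat_trans G H" "g \<in> nat_trans H K"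
  shows "comp_trans g f \<in> nat_trans G K"
  by (rule nat_transI)
    (auto simp: comp_trans_def nat_transD[OF assms(2)] nat_transD[OF assms(3)] nat_trans_0[OF assms(1,3)])

lemma id_trans_in_nat_trans:
  assumes "linear_functor G"
  shows "id_trans G \<in> nat_trans G G"
  by (rule nat_transI)
    (auto simp: id_trans_def restr_trans_def linear_functor_fobj[OF assms] linear_functorD(4)[OF assms])

lemma comp_trans_assoc: "comp_trans (comp_trans h g) f = comp_trans h (comp_trans g f)"
  by (simp add: comp_trans_def)

lemma comp_trans_id:
  assumes "linear_functor G" "f \<in> nat_trans G H"
  shows "comp_trans f (id_trans G) = f" "comp_trans (id_trans H) f = f"
  using nat_transD[OF assms(2)] nat_trans_0[OF assms]
  by (auto simp: comp_trans_def id_trans_def restr_trans_def fun_eq_iff) fastforce+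

lemma lin_on_comp_right:
  assumes "linear_functor H" "g \<in> nat_trans H K"
  shows "lin_on tscale (nat_trans G H) tscale (\<lambda>f. comp_trans g f)"
  by (simp add: lin_on_def comp_trans_def tscale_def fun_eq_iff
      nat_transD(3,4)[OF assms(2)] nat_trans_in[OF assms(1)])

definition inverse_trans ::
  "('k::field, 'x) vfunctor \<Rightarrow> ('k, 'y) vfunctor \<Rightarrow> ('k, 'x, 'y) trans \<Rightarrow> ('k, 'y, 'x) trans \<Rightarrow> bool"
  where
  "inverse_trans G H \<kappa> \<kappa>' \<longleftrightarrow> \<kappa> \<in> nat_trans G H \<and> \<kappa>' \<in> nat_trans H G \<and>
     comp_trans \<kappa>' \<kappa> = id_trans G \<and> comp_trans \<kappa> \<kappa>' = id_trans H"

lemma inverse_trans_sym: "inverse_trans G H \<kappa> \<kappa>' \<Longrightarrow> inverse_trans H G \<kappa>' \<kappa>"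
  by (simp add: inverse_trans_def)

lemma inverse_trans_cancel:
  assumes "linear_functor F" "inverse_trans G H \<kappa> \<kappa>'" "f \<in> nat_trans F G"
  shows "comp_trans \<kappa>' (comp_trans \<kappa> f) = f"
  using assms comp_trans_id(2)[OF assms(1,3)] by (simp add: inverse_trans_def flip: comp_trans_assoc)

lemma inverse_trans_cancel_right:
  assumes "linear_functor G" "inverse_trans G H \<kappa> \<kappa>'" "f \<in> nat_trans G K"
  shows "comp_trans (comp_trans f \<kappa>') \<kappa> = f"
  using assms comp_trans_id(1)[OF assms(1,3)] by (simp add: inverse_trans_def comp_trans_assoc)

section \<open>Tensoring with \<open>\<Lambda>\<^sup>0\<close> and \<open>\<Gamma>\<^sup>0\<close>\<close>

lemma fobj_Gam0: "x \<in> fobj (Gam 0) n \<longleftrightarrow> (\<forall>K. K \<noteq> [] \<longrightarrow> x K = 0)"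
  by (auto simp: fobj_Gam)

lemma fobj_LG_span:
  "fobj (LG (a, b)) n = module.span fscale
     {(\<lambda>(i, j). x i * y j) | x y. x \<in> fobj (Lam a) n \<and> y \<in> fobj (Gam b) n}"
  by (simp add: LG_def tensor_functor_def)

text \<open>The right-hand side defines a subspace containing all pure tensors, hence their span.
  Conversely, such a \<open>z\<close> is itself pure: its slice at \<open>[]\<close> times the
  indicator of \<open>[]\<close>, the generator of \<Gamma>^0.\<close>

lemma fobj_LG_Gam0:
  "z \<in> fobj (LG (a, 0)) n \<longleftrightarrow> (\<lambda>I. z (I, [])) \<in> fobj (Lam a) n \<and> (\<forall>I K. K \<noteq> [] \<longrightarrow> z (I, K) = 0)"
  for z :: "nat set \<times> nat list \<Rightarrow> 'k::field"
proof
  interpret vector_space "fscale :: 'k \<Rightarrow> (nat set \<times> nat list \<Rightarrow> 'k) \<Rightarrow> _" by (rule vector_space_fscale)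
  note L = linear_functor_fobj[OF linear_functor_Lam]
  let ?S = "{z :: nat set \<times> nat list \<Rightarrow> 'k. (\<lambda>I. z (I, [])) \<in> fobj (Lam a) n \<and> (\<forall>I K. K \<noteq> [] \<longrightarrow> z (I, K) = 0)}"
  have "subspace ?S"
  proof (rule subspaceI)
    fix x y c assume x: "x \<in> ?S"
    then show "fscale c x \<in> ?S"
      using L(3)[of "\<lambda>I. x (I, [])" a n c] by (simp add: fscale_def)
    assume "y \<in> ?S"
    with x show "x + y \<in> ?S"
      using L(2)[of "\<lambda>I. x (I, [])" a n "\<lambda>I. y (I, [])"] by (simp add: plus_fun_def)
  qed (use L(1)[of a n] in \<open>simp add: zero_fun_def\<close>)
  moreover have "{(\<lambda>(i, j). x i * y j) | x y. x \<in> fobj (Lam a) n \<and> y \<in> fobj (Gam 0) n} \<subseteq> ?S"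
    by (auto simp: fobj_Lam fobj_Gam0)
  ultimately have "fobj (LG (a, 0)) n \<subseteq> ?S"
    unfolding fobj_LG_span by (intro span_minimal)
  then show "(\<lambda>I. z (I, [])) \<in> fobj (Lam a) n \<and> (\<forall>I K. K \<noteq> [] \<longrightarrow> z (I, K) = 0)"
    if "z \<in> fobj (LG (a, 0)) n" using that by blast
  assume z: "(\<lambda>I. z (I, [])) \<in> fobj (Lam a) n \<and> (\<forall>I K. K \<noteq> [] \<longrightarrow> z (I, K) = 0)"
  define \<delta> :: "nat list \<Rightarrow> 'k" where "\<delta> K = (if K = [] then 1 else 0)" for K
  have "z = (\<lambda>(I, K). z (I, []) * \<delta> K)" using z by (auto simp: fun_eq_iff \<delta>_def)
  moreover have "\<delta> \<in> fobj (Gam 0) n" by (simp add: fobj_Gam0 \<delta>_def)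
  ultimately show "z \<in> fobj (LG (a, 0)) n"
    unfolding fobj_LG_span
    by (intro span_base CollectI exI[of _ "\<lambda>I. z (I, [])"] exI[of _ \<delta>] conjI) (use z in blast)+
qed

lemma fobj_LG_Lam0:
  "z \<in> fobj (LG (0, b)) n \<longleftrightarrow> (\<lambda>K. z ({}, K)) \<in> fobj (Gam b) n \<and> (\<forall>I K. I \<noteq> {} \<longrightarrow> z (I, K) = 0)"
  for z :: "nat set \<times> nat list \<Rightarrow> 'k::field"
proof
  interpret vector_space "fscale :: 'k \<Rightarrow> (nat set \<times> nat list \<Rightarrow> 'k) \<Rightarrow> _" by (rule vector_space_fscale)
  note G = linear_functor_fobj[OF linear_functor_Gam]
  let ?S = "{z :: nat set \<times> nat list \<Rightarrow> 'k. (\<lambda>K. z ({}, K)) \<in> fobj (Gam b) n \<and> (\<forall>I K. I \<noteq> {} \<longrightarrow> z (I, K) = 0)}"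
  have "subspace ?S"
  proof (rule subspaceI)
    fix x y c assume x: "x \<in> ?S"
    then show "fscale c x \<in> ?S"
      using G(3)[of "\<lambda>K. x ({}, K)" b n c] by (simp add: fscale_def)
    assume "y \<in> ?S"
    with x show "x + y \<in> ?S"
      using G(2)[of "\<lambda>K. x ({}, K)" b n "\<lambda>K. y ({}, K)"] by (simp add: plus_fun_def)
  qed (use G(1)[of b n] in \<open>simp add: zero_fun_def\<close>)
  moreover have "{(\<lambda>(i, j). x i * y j) | x y. x \<in> fobj (Lam 0) n \<and> y \<in> fobj (Gam b) n} \<subseteq> ?S"
  proof -
    have "(\<lambda>(i, j). x i * y j) \<in> ?S" if x: "x \<in> fobj (Lam 0) n" and y: "y \<in> fobj (Gam b) n" for x y
    proof -
      have "x I = 0" if "I \<noteq> {}" for I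
      proof -
        \<comment> \<open>\<open>card I = 0\<close> also holds for infinite \<open>I\<close>; the
          bound by \<open>{..<n}\<close> excludes these.\<close>
        have "\<not> (I \<subseteq> {..<n} \<and> card I = 0)"
          using that finite_subset[of I "{..<n}"] by auto
        then show ?thesis using x unfolding fobj_Lam by blast
      qed
      then show ?thesis using G(3)[OF y, of "x {}"] by (simp add: fscale_def)
    qed
    then show ?thesis by blast
  qed
  ultimately have "fobj (LG (0, b)) n \<subseteq> ?S"
    unfolding fobj_LG_span by (intro span_minimal)
  then show "(\<lambda>K. z ({}, K)) \<in> fobj (Gam b) n \<and> (\<forall>I K. I \<noteq> {} \<longrightarrow> z (I, K) = 0)"
    if "z \<in> fobj (LG (0, b)) n" using that by blast
  assume z: "(\<lambda>K. z ({}, K)) \<in> fobj (Gam b) n \<and> (\<forall>I K. I \<noteq> {} \<longrightarrow> z (I, K) = 0)"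
  define \<delta> :: "nat set \<Rightarrow> 'k" where "\<delta> I = (if I = {} then 1 else 0)" for I
  have "z = (\<lambda>(I, K). \<delta> I * z ({}, K))" using z by (auto simp: fun_eq_iff \<delta>_def)
  moreover have "\<delta> \<in> fobj (Lam 0) n" by (simp add: fobj_Lam \<delta>_def)
  ultimately show "z \<in> fobj (LG (0, b)) n"
    unfolding fobj_LG_span
    by (intro span_base CollectI exI[of _ "\<lambda>K. z ({}, K)"] exI[of _ \<delta>] conjI) (use z in blast)+
qed

lemma tensor_pow_mor_0: "tensor_pow_mor 0 A x K = (if K = [] then x [] else 0)"
proof -
  have "{J. set J \<subseteq> {..<dim_col A} \<and> length J = 0} = {[]}" by auto
  then show ?thesis by (simp add: tensor_pow_mor_def)
qed

text \<open>The only minor involved is the empty one, the determinant 1 of a matrix of size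
  0.\<close>

lemma fmor_Lam_0: "fmor (Lam 0) A x J = (if J = {} then x {} else 0)"
proof -
  have "{I. I \<subseteq> {..<dim_col A} \<and> card I = 0} = {{}}" "J \<subseteq> {..<dim_row A} \<and> card J = 0 \<longleftrightarrow> J = {}"
    by (auto dest: finite_subset)
  moreover have "det (submatrix A {} {}) = 1"
    by (intro det_dim_zero carrier_matI) (simp_all add: dim_submatrix)
  ultimately show ?thesis by (simp add: Lam_def)
qed

lemma fmor_LG_Gam0: "fmor (LG (a, 0)) A z (J, K) = (if K = [] then fmor (Lam a) A (\<lambda>I. z (I, [])) J else 0)"
proof -
  have "fmor (Lam a) A (\<lambda>_. 0) = 0"
    using linear_functorD(3)[OF linear_functor_Lam, of a A 0 0] by (simp add: fscale_def zero_fun_def)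
  then show ?thesis
    by (simp add: LG_def tensor_functor_def) (simp add: Gam_def tensor_pow_mor_0)
qed

lemma fmor_LG_Lam0: "fmor (LG (0, b)) A z (J, K) = (if J = {} then fmor (Gam b) A (\<lambda>L. z ({}, L)) K else 0)"
  by (simp add: LG_def tensor_functor_def fmor_Lam_0)

lemma inverse_trans_tensor_gam0:
  "inverse_trans (Lam a) (LG (a, 0)) (tensor_gam0 a :: ('k::field, _, _) trans)
     (restr_trans (LG (a, 0)) (\<lambda>z I. z (I, [])))"
proof -
  let ?k' = "restr_trans (LG (a, 0) :: ('k, _) vfunctor) (\<lambda>z I. z (I, []))"
  have "tensor_gam0 a \<in> nat_trans (Lam a) (LG (a, 0) :: ('k, _) vfunctor)"
  proof (rule nat_transI)
    fix m n and A :: "'k mat" and v :: "nat set \<Rightarrow> 'k"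
    assume "A \<in> carrier_mat m n" "v \<in> fobj (Lam a) n"
    then show "tensor_gam0 a m (fmor (Lam a) A v) = fmor (LG (a, 0)) A (tensor_gam0 a n v)"
      using linear_functorD(4)[OF linear_functor_Lam, of A m n v a]
      by (auto simp: tensor_gam0_def restr_trans_def fmor_LG_Gam0 fun_eq_iff)
  qed (auto simp: tensor_gam0_def restr_trans_def fobj_LG_Gam0 fscale_def fun_eq_iff
      linear_functor_fobj[OF linear_functor_Lam, unfolded fscale_def])
  moreover have "?k' \<in> nat_trans (LG (a, 0)) (Lam a)"
  proof (rule nat_transI)
    fix m n and A :: "'k mat" and v :: "nat set \<times> nat list \<Rightarrow> 'k"
    assume "A \<in> carrier_mat m n" "v \<in> fobj (LG (a, 0)) n"
    then show "?k' m (fmor (LG (a, 0)) A v) = fmor (Lam a) A (?k' n v)"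
      using linear_functorD(4)[OF linear_functor_LG, of A m n v]
      by (auto simp: restr_trans_def fmor_LG_Gam0 fun_eq_iff)
  qed (auto simp: restr_trans_def linear_functor_fobj[OF linear_functor_LG] fun_eq_iff fscale_apply,
      simp add: fobj_LG_Gam0)
  ultimately show ?thesis
    by (auto simp: inverse_trans_def comp_trans_def id_trans_def tensor_gam0_def restr_trans_def
        fun_eq_iff fobj_LG_Gam0)
qed

text \<open>With \<open>lam0_proj\<close> this is the isomorphism between \<Gamma>^b and \<Lambda>^0
  \<otimes> \<Gamma>^b. Conjugation by it describes \<open>lam0_tensor\<close>, whose properties
  then follow formally.\<close>

definition lam0_incl :: "nat \<Rightarrow> ('k::field, nat list, nat set \<times> nat list) trans" where
  "lam0_incl b = restr_trans (Gam b) (\<lambda>x (I, K). if I = {} then x K else 0)"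

definition lam0_proj :: "nat \<Rightarrow> ('k::field, nat set \<times> nat list, nat list) trans" where
  "lam0_proj b = restr_trans (LG (0, b)) (\<lambda>z K. z ({}, K))"

lemma inverse_trans_lam0:
  "inverse_trans (Gam b) (LG (0, b)) (lam0_incl b :: ('k::field, _, _) trans) (lam0_proj b)"
proof -
  have "lam0_incl b \<in> nat_trans (Gam b) (LG (0, b) :: ('k, _) vfunctor)"
  proof (rule nat_transI)
    fix m n and A :: "'k mat" and v :: "nat list \<Rightarrow> 'k"
    assume "A \<in> carrier_mat m n" "v \<in> fobj (Gam b) n"
    then show "lam0_incl b m (fmor (Gam b) A v) = fmor (LG (0, b)) A (lam0_incl b n v)"
      using linear_functorD(4)[OF linear_functor_Gam, of A m n v]
      by (auto simp: lam0_incl_def restr_trans_def fmor_LG_Lam0 fun_eq_iff)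
  qed (auto simp: lam0_incl_def restr_trans_def fobj_LG_Lam0 fscale_def fun_eq_iff
      linear_functor_fobj[OF linear_functor_Gam, unfolded fscale_def])
  moreover have "lam0_proj b \<in> nat_trans (LG (0, b) :: ('k, _) vfunctor) (Gam b)"
  proof (rule nat_transI)
    fix m n and A :: "'k mat" and v :: "nat set \<times> nat list \<Rightarrow> 'k"
    assume "A \<in> carrier_mat m n" "v \<in> fobj (LG (0, b)) n"
    then show "lam0_proj b m (fmor (LG (0, b)) A v) = fmor (Gam b) A (lam0_proj b n v)"
      using linear_functorD(4)[OF linear_functor_LG, of A m n v]
      by (auto simp: lam0_proj_def restr_trans_def fmor_LG_Lam0 fun_eq_iff)
  qed (auto simp: lam0_proj_def restr_trans_def linear_functor_fobj[OF linear_functor_LG] fun_eq_iff fscale_apply,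
      simp add: fobj_LG_Lam0)
  ultimately show ?thesis
    by (auto simp: inverse_trans_def comp_trans_def id_trans_def lam0_incl_def lam0_proj_def restr_trans_def
        fun_eq_iff fobj_LG_Lam0)
qed

text \<open>\<open>lam0_tensor\<close> applies \<open>f\<close> to every slice
  \<open>z (I, _)\<close>. The slices at nonempty \<open>I\<close> vanish and \<open>f\<close>
  preserves 0, so only the slice at \<open>{}\<close> contributes.\<close>

lemma lam0_tensor_eq:
  assumes "f \<in> nat_trans (Gam t) (Gam b)"
  shows "lam0_tensor t f = comp_trans (comp_trans (lam0_incl b) f) (lam0_proj t)"
proof (intro ext)
  fix n and z :: "nat set \<times> nat list \<Rightarrow> 'a" and IK :: "nat set \<times> nat list"
  obtain I K where IK: "IK = (I, K)" by (cases IK)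
  have f0: "f n 0 = 0" by (rule nat_trans_0[OF linear_functor_Gam assms])
  show "lam0_tensor t f n z IK = comp_trans (comp_trans (lam0_incl b) f) (lam0_proj t) n z IK"
  proof (cases "z \<in> fobj (LG (0, t)) n")
    case True
    then have z: "(\<lambda>L. z ({}, L)) \<in> fobj (Gam t) n" "I \<noteq> {} \<Longrightarrow> (\<lambda>L. z (I, L)) = 0"
      by (auto simp: fobj_LG_Lam0)
    have "lam0_tensor t f n z IK = f n (\<lambda>L. z (I, L)) K"
      using True by (simp add: lam0_tensor_def IK)
    also have "\<dots> = (if I = {} then f n (\<lambda>L. z ({}, L)) K else 0)"
      using z(2) f0 by simp
    also have "\<dots> = comp_trans (comp_trans (lam0_incl b) f) (lam0_proj t) n z IK"
      using True nat_transD(1)[OF assms z(1)]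
      by (simp add: comp_trans_def lam0_incl_def lam0_proj_def restr_trans_def IK)
    finally show ?thesis .
  next
    case False
    have "lam0_incl b n (0 :: nat list \<Rightarrow> 'a) = 0"
      by (simp add: lam0_incl_def restr_trans_def fun_eq_iff)
    then show ?thesis
      using False f0 by (simp add: lam0_tensor_def comp_trans_def lam0_proj_def restr_trans_def)
  qed
qed

section \<open>Transport of comodules along linear isomorphisms\<close>

lemma lin_on_apply:
  assumes "lin_on s V t f" "x \<in> V"
  shows "y \<in> V \<Longrightarrow> f (x + y) = f x + f y" "f (s c x) = t c (f x)"
  using assms by (auto simp: lin_on_def)

lemma lin_on_inv_into:
  assumes s: "vector_space s" and V: "module.subspace s V"
    and bij: "bij_betw f V V'" and lin: "lin_on s V t f"
  shows "lin_on t V' s (inv_into V f)"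
proof -
  interpret vector_space s by fact
  have inv: "inv_into V f w \<in> V" "f (inv_into V f w) = w" if "w \<in> V'" for w
    using that bij by (metis bij_betw_def inv_into_into, metis bij_betw_inv_into_right)
  have eq: "inv_into V f (f v) = v" if "v \<in> V" for v
    using that bij by (metis bij_betw_inv_into_left)
  show ?thesis
    unfolding lin_on_def
  proof (intro conjI ballI allI)
    fix x y assume xy: "x \<in> V'" "y \<in> V'"
    have "x + y = f (inv_into V f x + inv_into V f y)"
      using xy inv lin by (simp add: lin_on_apply)
    then show "inv_into V f (x + y) = inv_into V f x + inv_into V f y"
      using eq[OF subspace_add[OF V inv(1)[OF xy(1)] inv(1)[OF xy(2)]]] by simp
  next
    fix c x assume x: "x \<in> V'"
    have "t c x = f (s c (inv_into V f x))"
      using x inv lin by (simp add: lin_on_apply)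
    then show "inv_into V f (t c x) = s c (inv_into V f x)"
      using eq[OF subspace_scale[OF V inv(1)[OF x]]] by simp
  qed
qed

lemma graded_comoduleD:
  assumes "graded_comodule p S D M" "m \<in> gr M ab"
  shows "z \<in> S \<Longrightarrow> rdeg z = ab \<Longrightarrow> coact M ab m z \<in> gr M (ldeg p z)"
    "\<not> (z \<in> S \<and> rdeg z = ab) \<Longrightarrow> coact M ab m z = 0"
    "lin_on (scl M) (gr M ab) (scl M) (\<lambda>m. coact M ab m z)"
    "x \<in> S \<Longrightarrow> y \<in> S \<Longrightarrow> coact M (ldeg p y) (coact M ab m y) x =
        (\<Sum>z\<in>mons p S (ldeg p x) ab.
           scl M (Poly_Mapping.lookup (D (Poly_Mapping.single z 1)) (x, y)) (coact M ab m z))"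
    "(\<Sum>z\<in>mons p S ab ab. scl M (counit_mon z) (coact M ab m z)) = m"
proof -
  have "if z \<in> S \<and> rdeg z = ab then coact M ab m z \<in> gr M (ldeg p z) else coact M ab m z = 0" for z
    using assms unfolding graded_comodule_def by blast
  then show "z \<in> S \<Longrightarrow> rdeg z = ab \<Longrightarrow> coact M ab m z \<in> gr M (ldeg p z)"
    "\<not> (z \<in> S \<and> rdeg z = ab) \<Longrightarrow> coact M ab m z = 0"
    by metis+
qed (use assms in \<open>unfold graded_comodule_def, blast+\<close>)

text \<open>\<open>Q\<close> leads from the family \<open>N\<close>, not yet known to be a comodule,
  to the known comodule \<open>M\<close>. Being injective and compatible with the coactions, it
  reflects every comodule law from \<open>M\<close> to \<open>N\<close>, so none has to be verified
  directly in \<open>N\<close>.\<close>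

lemma U_bigr_transport:
  fixes M :: "('k::field, 'm::ab_group_add) gcomod" and N :: "('k, 'n::ab_group_add) gcomod"
  assumes M: "U_bigr p M" and vs: "vector_space (scl N)"
    and sub: "\<And>ab. module.subspace (scl N) (gr N ab)"
    and bij: "\<And>ab. bij_betw (Q ab) (gr N ab) (gr M ab)"
    and lin: "\<And>ab. lin_on (scl N) (gr N ab) (scl M) (Q ab)"
    and co: "\<And>ab n z. n \<in> gr N ab \<Longrightarrow> z \<in> wfree \<Longrightarrow> rdeg z = ab \<Longrightarrow>
      coact N ab n z \<in> gr N (ldeg p z) \<and> Q (ldeg p z) (coact N ab n z) = coact M ab (Q ab n) z"
    and co0: "\<And>ab n z. n \<in> gr N ab \<Longrightarrow> \<not> (z \<in> wfree \<and> rdeg z = ab) \<Longrightarrow> coact N ab n z = 0"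
  shows "U_bigr_iso p M N (\<lambda>ab. inv_into (gr N ab) (Q ab))"
proof -
  have gM: "graded_comodule p wfree (bar_coprod p) M" using M by (simp add: U_bigr_def)
  note MD = graded_comoduleD[OF gM]
  have vsM: "vector_space (scl M)"
    using gM unfolding graded_comodule_def by blast
  interpret N: vector_space "scl N" by fact
  interpret M: vector_space "scl M" by fact
  have inj: "u = v" if "Q ab u = Q ab v" "u \<in> gr N ab" "v \<in> gr N ab" for ab u v
    using that bij[of ab] by (metis bij_betw_def inj_onD)
  have Q_in: "Q ab n \<in> gr M ab" if "n \<in> gr N ab" for ab n
    using that bij[of ab] by (auto simp: bij_betw_def)
  \<comment> \<open>Where the coaction is 0 by default, membership and compatibility hold trivially.
    Stating them for all \<open>z\<close> removes the side conditions from the rewriting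
    below.\<close>
  have co_in: "coact N ab n z \<in> gr N (ldeg p z)" if "n \<in> gr N ab" for ab n z
    using co[OF that] co0[OF that] N.subspace_0[OF sub] by metis
  have Q0: "Q ab 0 = 0" for ab by (rule lin_on_0[OF vs sub vsM lin])
  have coQ: "Q (ldeg p z) (coact N ab n z) = coact M ab (Q ab n) z" if "n \<in> gr N ab" for ab n z
    using co[OF that, of z] co0[OF that, of z] MD(2)[OF Q_in[OF that], of z] Q0 by metis
  have N: "U_bigr p N"
    unfolding U_bigr_def graded_comodule_def
  proof (intro conjI allI ballI)
    show "vector_space (scl N)" "\<And>ab. N.subspace (gr N ab)" by fact+
    fix ab z n assume n: "n \<in> gr N ab"
    show "if z \<in> wfree \<and> rdeg z = ab then coact N ab n z \<in> gr N (ldeg p z) else coact N ab n z = 0"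
      using co[OF n] co0[OF n] by auto
  next
    fix ab z
    show "lin_on (scl N) (gr N ab) (scl N) (\<lambda>m. coact N ab m z)"
      unfolding lin_on_def
    proof (intro conjI ballI allI)
      fix m n c assume m: "m \<in> gr N ab"
      have mm: "scl N c m \<in> gr N ab" using m by (rule N.subspace_scale[OF sub])
      have "coact M ab (scl M c (Q ab m)) z = scl M c (coact M ab (Q ab m) z)"
        using lin_on_apply(2)[OF MD(3)[OF Q_in[OF m]] Q_in[OF m]] .
      then show "coact N ab (scl N c m) z = scl N c (coact N ab m z)"
        using m mm by (intro inj[of "ldeg p z"])
          (simp_all add: coQ lin_on_apply(2)[OF lin] co_in N.subspace_scale[OF sub])
      assume n: "n \<in> gr N ab"
      have mn: "m + n \<in> gr N ab" using m n by (rule N.subspace_add[OF sub])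
      have "coact M ab (Q ab m + Q ab n) z = coact M ab (Q ab m) z + coact M ab (Q ab n) z"
        using lin_on_apply(1)[OF MD(3)[OF Q_in[OF m]] Q_in[OF m] Q_in[OF n]] .
      then show "coact N ab (m + n) z = coact N ab m z + coact N ab n z"
        using m n mn by (intro inj[of "ldeg p z"])
          (simp_all add: coQ lin_on_apply(1)[OF lin] co_in N.subspace_add[OF sub])
    qed
  next
    fix ab n x y assume n: "n \<in> gr N ab" and x: "x \<in> wfree" and y: "y \<in> wfree"
    let ?c = "\<lambda>z. Poly_Mapping.lookup (bar_coprod p (Poly_Mapping.single z 1)) (x, y) :: 'k"
    have in1: "coact N ab n z \<in> gr N (ldeg p x)" if "z \<in> mons p wfree (ldeg p x) ab" for z
      using co_in[OF n, of z] that by (simp add: mons_def)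
    show "coact N (ldeg p y) (coact N ab n y) x =
      (\<Sum>z\<in>mons p wfree (ldeg p x) ab. scl N (?c z) (coact N ab n z))"
    proof (rule inj)
      have "Q (ldeg p x) (coact N (ldeg p y) (coact N ab n y) x) =
          coact M (ldeg p y) (coact M ab (Q ab n) y) x"
        by (simp add: coQ n co_in)
      also have "\<dots> = (\<Sum>z\<in>mons p wfree (ldeg p x) ab. scl M (?c z) (coact M ab (Q ab n) z))"
        by (rule MD(4)[OF Q_in[OF n] x y])
      also have "\<dots> = (\<Sum>z\<in>mons p wfree (ldeg p x) ab. scl M (?c z) (Q (ldeg p x) (coact N ab n z)))"
        by (intro sum.cong refl) (auto simp: mons_def simp flip: coQ[OF n])
      also have "\<dots> = Q (ldeg p x) (\<Sum>z\<in>mons p wfree (ldeg p x) ab. scl N (?c z) (coact N ab n z))"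
        by (rule lin_on_sum[OF vs sub vsM lin in1, symmetric])
      finally show "Q (ldeg p x) (coact N (ldeg p y) (coact N ab n y) x) = \<dots>" .
    qed (auto intro!: co_in n subspace_sum_scale[OF vs sub] in1)
  next
    fix ab n assume n: "n \<in> gr N ab"
    have in1: "coact N ab n z \<in> gr N ab" if "z \<in> mons p wfree ab ab" for z
      using co_in[OF n, of z] that by (simp add: mons_def)
    show "(\<Sum>z\<in>mons p wfree ab ab. scl N (counit_mon z) (coact N ab n z)) = n"
    proof (rule inj)
      have "Q ab (\<Sum>z\<in>mons p wfree ab ab. scl N (counit_mon z) (coact N ab n z)) =
        (\<Sum>z\<in>mons p wfree ab ab. scl M (counit_mon z) (Q ab (coact N ab n z)))"
        by (rule lin_on_sum[OF vs sub vsM lin in1])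
      also have "\<dots> = (\<Sum>z\<in>mons p wfree ab ab. scl M (counit_mon z) (coact M ab (Q ab n) z))"
        by (intro sum.cong refl) (auto simp: mons_def simp flip: coQ[OF n])
      also have "\<dots> = Q ab n" by (rule MD(5)[OF Q_in[OF n]])
      finally show "Q ab (\<Sum>z\<in>mons p wfree ab ab. scl N (counit_mon z) (coact N ab n z)) = Q ab n" .
    qed (auto intro!: n subspace_sum_scale[OF vs sub] in1)
  qed
  define \<Phi> where "\<Phi> ab = inv_into (gr N ab) (Q ab)" for ab
  have \<Phi>: "\<Phi> ab m \<in> gr N ab" "Q ab (\<Phi> ab m) = m" if "m \<in> gr M ab" for ab m
    using that bij[of ab] unfolding \<Phi>_def
    by (metis bij_betw_def inv_into_into, metis bij_betw_inv_into_right)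
  have \<Phi>Q: "\<Phi> ab (Q ab n) = n" if "n \<in> gr N ab" for ab n
    using that bij[of ab] unfolding \<Phi>_def by (metis bij_betw_inv_into_left)
  have "U_bigr_hom p N M Q"
    unfolding U_bigr_hom_def using N M Q_in lin coQ by auto
  moreover have "U_bigr_hom p M N \<Phi>"
    unfolding U_bigr_hom_def
  proof (intro conjI allI ballI impI)
    fix ab m z assume m: "m \<in> gr M ab"
    have "\<Phi> (ldeg p z) (Q (ldeg p z) (coact N ab (\<Phi> ab m) z)) = coact N ab (\<Phi> ab m) z"
      by (intro \<Phi>Q co_in \<Phi> m)
    then show "coact N ab (\<Phi> ab m) z = \<Phi> (ldeg p z) (coact M ab m z)"
      using coQ[OF \<Phi>(1)[OF m]] \<Phi>(2)[OF m] by simp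
  next
    fix ab show "lin_on (scl M) (gr M ab) (scl N) (\<Phi> ab)"
      unfolding \<Phi>_def by (rule lin_on_inv_into[OF vs sub bij lin])
  qed (use M N \<Phi>(1) in auto)
  ultimately show ?thesis
    unfolding U_bigr_iso_def \<Phi>_def[symmetric] using \<Phi>(2) \<Phi>Q by blast
qed

section \<open>Consequences of the duality\<close>

locale dual_pairing =
  fixes p :: nat and \<theta> :: "'k::field pairing"
  assumes p: "2 \<le> p" and iso: "linear_iso_pairing p \<theta>" and coalg: "coalgebra_pairing p \<theta>"
begin

abbreviation Hom ::
  "bideg \<Rightarrow> bideg \<Rightarrow> ('k, nat set \<times> nat list, nat set \<times> nat list) trans set" where
  "Hom st ab \<equiv> nat_trans (LG st) (LG ab)"

abbreviation basis :: "mon \<Rightarrow> (mon \<Rightarrow>\<^sub>0 'k)" where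
  "basis z \<equiv> Poly_Mapping.single z 1"

section \<open>Dual bases for the components of B\<close>

lemma bij_theta: "bij_betw (\<theta> st ab) (bcomp p UNIV st ab) (dual_space tscale (Hom st ab))"
  using iso unfolding linear_iso_pairing_def by blast

lemma theta_lin:
  assumes "x \<in> bcomp p UNIV st ab"
  shows "lin_on tscale (Hom st ab) (*) (\<theta> st ab x)"
proof -
  have "\<theta> st ab x \<in> dual_space tscale (Hom st ab)"
    using bij_betwE[OF bij_theta] assms by blast
  then show ?thesis by (simp add: dual_space_def)
qed

lemma theta_expand:
  assumes "x \<in> bcomp p UNIV st ab"
  shows "\<theta> st ab x f = (\<Sum>z\<in>mons p UNIV st ab. Poly_Mapping.lookup x z * \<theta> st ab (basis z) f)"
proof -
  have lin: "lin_on pscale (bcomp p UNIV st ab) fscale (\<theta> st ab)"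
    using iso unfolding linear_iso_pairing_def by blast
  show ?thesis
    by (subst lin_on_bcomp_expand[OF p vector_space_fscale lin assms])
      (simp add: sum_fun_apply fscale_def)
qed

text \<open>Because \<open>\<theta>\<close> is onto the whole dual, every functional on
  \<open>Hom st ab\<close> is a combination of the \<open>\<theta> st ab (basis z)\<close>. If these
  all kill \<open>f\<close>, so does every functional, and a nonzero vector would be detected by
  one.\<close>

lemma theta_separates:
  assumes f: "f \<in> Hom st ab" and 0: "\<And>z. z \<in> mons p UNIV st ab \<Longrightarrow> \<theta> st ab (basis z) f = 0"
  shows "f = 0"
proof (rule ccontr)
  interpret vector_space "tscale :: 'k \<Rightarrow> ('k, nat set \<times> nat list, nat set \<times> nat list) trans \<Rightarrow> _"
    by (rule vector_space_tscale)
  note sub = subspace_nat_trans[OF linear_functor_LG, of "LG st" ab]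
  assume "f \<noteq> 0"
  then have "f \<notin> {0}" by simp
  then obtain \<psi> where \<psi>: "lin_on tscale UNIV (*) \<psi>" "\<psi> f = 1"
    using separating_functional[OF vector_space_tscale subspace_single_0] by blast
  \<comment> \<open>Elements of \<open>dual_space\<close> must take the value 0 outside the space,
    so \<open>\<psi>\<close> is cut off.\<close>
  define \<phi> where "\<phi> v = (if v \<in> Hom st ab then \<psi> v else 0)" for v
  have "\<phi> \<in> dual_space tscale (Hom st ab)"
    using \<psi>(1) subspace_add[OF sub] subspace_scale[OF sub]
    by (auto simp: dual_space_def \<phi>_def lin_on_def)
  then obtain x where x: "x \<in> bcomp p UNIV st ab" "\<theta> st ab x = \<phi>"
    using bij_betw_imp_surj_on[OF bij_theta, of st ab] by (metis imageE)
  have "\<phi> f = 0" unfolding x(2)[symmetric] theta_expand[OF x(1)] by (simp add: 0)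
  then show False using \<psi>(2) f by (simp add: \<phi>_def)
qed

text \<open>Injectivity of \<open>\<theta>\<close> makes the functionals
  \<open>\<theta> st ab (basis y)\<close> independent: a relation among them is the image of one
  element \<open>x\<close> of B, which must then be 0.\<close>

lemma dual_element_exists:
  assumes z: "z \<in> mons p UNIV st ab"
  shows "\<exists>f\<in>Hom st ab. \<forall>y\<in>mons p UNIV st ab. \<theta> st ab (basis y) f = (if y = z then 1 else 0)"
proof (rule dual_basis_exists[OF vector_space_tscale subspace_nat_trans[OF linear_functor_LG]
      finite_mons[OF p] _ _ z])
  show "lin_on tscale (Hom st ab) (*) (\<theta> st ab (basis y))" if "y \<in> mons p UNIV st ab" for y
    using that by (intro theta_lin) simp
  fix c :: "mon \<Rightarrow> 'k" and y
  assume 0: "\<And>f. f \<in> Hom st ab \<Longrightarrow> (\<Sum>y\<in>mons p UNIV st ab. c y * \<theta> st ab (basis y) f) = 0"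
    and y: "y \<in> mons p UNIV st ab"
  define x where "x = (\<Sum>y\<in>mons p UNIV st ab. pscale (c y) (basis y))"
  have x: "x \<in> bcomp p UNIV st ab"
    unfolding x_def by (intro subspace_sum_scale[OF vector_space_pscale subspace_bcomp]) simp
  have lookup_x: "Poly_Mapping.lookup x z = c z" if "z \<in> mons p UNIV st ab" for z
    using that finite_mons[OF p]
    by (simp add: x_def lookup_sum lookup_single when_def if_distrib cong: if_cong)
  have x0: "0 \<in> bcomp p UNIV st ab" by (simp add: bcomp_def)
  have dual: "\<theta> st ab x \<in> dual_space tscale (Hom st ab)" "\<theta> st ab 0 \<in> dual_space tscale (Hom st ab)"
    using bij_betwE[OF bij_theta] x x0 by blast+
  have "\<theta> st ab x = \<theta> st ab 0"
  proof
    fix f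
    show "\<theta> st ab x f = \<theta> st ab 0 f"
    proof (cases "f \<in> Hom st ab")
      case True
      then show ?thesis
        using 0[OF True] by (simp add: theta_expand[OF x] theta_expand[OF x0] lookup_x)
    qed (use dual in \<open>simp add: dual_space_def\<close>)
  qed
  then have "x = 0"
    using inj_onD[OF bij_betw_imp_inj_on[OF bij_theta]] x x0 by blast
  then show "c y = 0" using lookup_x[OF y] by simp
qed

text \<open>By \<open>theta_separates\<close> there is only one such element, so the choice is
  harmless. Both bidegrees are read off from \<open>z\<close>, which makes \<open>z\<close> the only
  argument.\<close>

definition db :: "mon \<Rightarrow> ('k, nat set \<times> nat list, nat set \<times> nat list) trans" where
  "db z = (SOME f. f \<in> Hom (ldeg p z) (rdeg z) \<and> (\<forall>y\<in>mons p UNIV (ldeg p z) (rdeg z).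
     \<theta> (ldeg p z) (rdeg z) (basis y) f = (if y = z then 1 else 0)))"

lemma db:
  assumes "z \<in> mons p UNIV st ab"
  shows db_in: "db z \<in> Hom st ab"
    and theta_db: "y \<in> mons p UNIV st ab \<Longrightarrow> \<theta> st ab (basis y) (db z) = (if y = z then 1 else 0)"
proof -
  have "ldeg p z = st" "rdeg z = ab" using assms by (auto simp: mons_def)
  moreover have "z \<in> mons p UNIV (ldeg p z) (rdeg z)" by (simp add: mons_def)
  from dual_element_exists[OF this]
  have "\<exists>f. f \<in> Hom (ldeg p z) (rdeg z) \<and> (\<forall>y\<in>mons p UNIV (ldeg p z) (rdeg z).
     \<theta> (ldeg p z) (rdeg z) (basis y) f = (if y = z then 1 else 0))" by blast
  then have "db z \<in> Hom (ldeg p z) (rdeg z) \<and> (\<forall>y\<in>mons p UNIV (ldeg p z) (rdeg z).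
     \<theta> (ldeg p z) (rdeg z) (basis y) (db z) = (if y = z then 1 else 0))"
    unfolding db_def by (rule someI_ex)
  ultimately show "db z \<in> Hom st ab"
    "y \<in> mons p UNIV st ab \<Longrightarrow> \<theta> st ab (basis y) (db z) = (if y = z then 1 else 0)" by blast+
qed

lemma theta_db_bcomp:
  assumes "x \<in> bcomp p UNIV st ab" "z \<in> mons p UNIV st ab"
  shows "\<theta> st ab x (db z) = Poly_Mapping.lookup x z"
  using assms finite_mons[OF p]
  by (simp add: theta_expand[OF assms(1)] theta_db[OF assms(2)] if_distrib[of "\<lambda>c. _ * c"] cong: if_cong)

text \<open>Each \<open>\<theta> st ab (basis y)\<close> takes the same value on both sides, so
  their difference is 0 by \<open>theta_separates\<close>. In particular \<open>Hom st ab\<close> is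
  finite-dimensional.\<close>

lemma Hom_expand:
  assumes f: "f \<in> Hom st ab"
  shows "f = (\<Sum>z\<in>mons p UNIV st ab. tscale (\<theta> st ab (basis z) f) (db z))"
proof -
  interpret vector_space "tscale :: 'k \<Rightarrow> ('k, nat set \<times> nat list, nat set \<times> nat list) trans \<Rightarrow> _"
    by (rule vector_space_tscale)
  note sub = subspace_nat_trans[OF linear_functor_LG, of "LG st" ab]
  define g where "g = (\<Sum>z\<in>mons p UNIV st ab. tscale (\<theta> st ab (basis z) f) (db z))"
  have g: "g \<in> Hom st ab"
    unfolding g_def by (intro subspace_sum_scale[OF vector_space_tscale sub] db_in)
  have "f + tscale (-1) g = 0"
  proof (rule theta_separates)
    have g': "tscale (-1) g \<in> Hom st ab" by (intro subspace_scale[OF sub] g)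
    then show "f + tscale (-1) g \<in> Hom st ab" by (intro subspace_add[OF sub] f)
    fix y assume y: "y \<in> mons p UNIV st ab"
    then have lin: "lin_on tscale (Hom st ab) (*) (\<theta> st ab (basis y))"
      by (intro theta_lin) simp
    have "\<theta> st ab (basis y) g = (\<Sum>z\<in>mons p UNIV st ab. \<theta> st ab (basis z) f * \<theta> st ab (basis y) (db z))"
      unfolding g_def by (intro lin_on_sum[OF vector_space_tscale sub vector_space_mult lin] db_in)
    also have "\<dots> = \<theta> st ab (basis y) f"
      using y finite_mons[OF p] by (simp add: theta_db if_distrib[of "\<lambda>c. _ * c"] cong: if_cong)
    finally show "\<theta> st ab (basis y) (f + tscale (-1) g) = 0"
      using lin_on_apply(1)[OF lin f g'] lin_on_apply(2)[OF lin g, of "-1"] by simp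
  qed
  then show ?thesis unfolding g_def[symmetric] by (simp add: scale_minus_left)
qed

section \<open>Coproduct coefficients as structure constants of composition\<close>

lemma theta_comp:
  assumes "x \<in> bcomp p UNIV st ab" "f \<in> Hom st cd" "g \<in> Hom cd ab"
  shows "\<theta> st ab x (comp_trans g f) =
    (\<Sum>y\<in>mons p UNIV st cd. \<Sum>z\<in>mons p UNIV cd ab.
       Poly_Mapping.lookup (coprod p x) (y, z) * \<theta> st cd (basis y) f * \<theta> cd ab (basis z) g)"
proof -
  have "\<theta> st ab x (comp_trans g f) =
    (\<Sum>(y, z)\<in>mons p UNIV st cd \<times> mons p UNIV cd ab.
       Poly_Mapping.lookup (coprod p x) (y, z) * \<theta> st cd (basis y) f * \<theta> cd ab (basis z) g)"
    using coalg assms unfolding coalgebra_pairing_def by blast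
  then show ?thesis by (simp add: sum.cartesian_product)
qed

lemma theta_comp_db:
  assumes x: "x \<in> bcomp p UNIV st ab" and z: "z \<in> mons p UNIV st cd" and g: "g \<in> Hom cd ab"
  shows "\<theta> st ab x (comp_trans g (db z)) =
    (\<Sum>u\<in>mons p UNIV cd ab. Poly_Mapping.lookup (coprod p x) (z, u) * \<theta> cd ab (basis u) g)"
proof -
  have "\<theta> st ab x (comp_trans g (db z)) = (\<Sum>y\<in>mons p UNIV st cd. if y = z then
      \<Sum>u\<in>mons p UNIV cd ab. Poly_Mapping.lookup (coprod p x) (y, u) * \<theta> cd ab (basis u) g else 0)"
    unfolding theta_comp[OF x db_in[OF z] g] by (intro sum.cong refl) (simp add: theta_db[OF z])
  then show ?thesis using z finite_mons[OF p] by simp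
qed

lemma theta_db_comp:
  assumes x: "x \<in> bcomp p UNIV st ab" and z: "z \<in> mons p UNIV cd ab" and f: "f \<in> Hom st cd"
  shows "\<theta> st ab x (comp_trans (db z) f) =
    (\<Sum>u\<in>mons p UNIV st cd. Poly_Mapping.lookup (coprod p x) (u, z) * \<theta> st cd (basis u) f)"
  unfolding theta_comp[OF x f db_in[OF z]]
  using z finite_mons[OF p]
  by (intro sum.cong refl) (simp add: theta_db[OF z] if_distrib[of "\<lambda>c. _ * c"] cong: if_cong)

text \<open>Composing dual basis elements has the coefficients of the coproduct as structure
  constants. This translates laws of composition into identities in B. The map applied first
  corresponds to the left tensor factor.\<close>

lemma theta_db_comp_db:
  assumes x: "x \<in> bcomp p UNIV st ab" and y: "y \<in> mons p UNIV st cd" and z: "z \<in> mons p UNIV cd ab"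
  shows "\<theta> st ab x (comp_trans (db z) (db y)) = Poly_Mapping.lookup (coprod p x) (y, z)"
  using y finite_mons[OF p]
  by (simp add: theta_db_comp[OF x z db_in[OF y]] theta_db[OF y] if_distrib[of "\<lambda>c. _ * c"] cong: if_cong)

text \<open>Both sums are the value of \<open>x\<close> on the threefold composite of
  \<open>db k\<close>, \<open>db m\<close> and \<open>db n\<close>; the left one splits off
  \<open>db k\<close>, the right one \<open>db n\<close>.\<close>

lemma coprod_coassoc:
  fixes x :: "mon \<Rightarrow>\<^sub>0 'k"
  assumes x: "x \<in> bcomp p UNIV st ab"
    and k: "k \<in> mons p UNIV st cd" and m: "m \<in> mons p UNIV cd ef" and n: "n \<in> mons p UNIV ef ab"
  shows "(\<Sum>v\<in>mons p UNIV cd ab.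
      Poly_Mapping.lookup (coprod p x) (k, v) * Poly_Mapping.lookup (coprod_mon p v) (m, n)) =
    (\<Sum>v\<in>mons p UNIV st ef.
      Poly_Mapping.lookup (coprod p x) (v, n) * Poly_Mapping.lookup (coprod_mon p v) (k, m))"
    (is "?l = ?r")
proof -
  note comp = comp_trans_in_nat_trans[OF linear_functor_LG]
  have "?l = \<theta> st ab x (comp_trans (comp_trans (db n) (db m)) (db k))"
    unfolding theta_comp_db[OF x k comp[OF db_in[OF m] db_in[OF n]]]
    by (intro sum.cong refl) (simp add: theta_db_comp_db[OF _ m n])
  also have "\<dots> = \<theta> st ab x (comp_trans (db n) (comp_trans (db m) (db k)))"
    by (simp only: comp_trans_assoc)
  also have "\<dots> = ?r"
    unfolding theta_db_comp[OF x n comp[OF db_in[OF k] db_in[OF m]]]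
    by (intro sum.cong refl) (simp add: theta_db_comp_db[OF _ k m])
  finally show ?thesis .
qed

lemma theta_id: "z \<in> mons p UNIV ab ab \<Longrightarrow> \<theta> ab ab (basis z) (id_trans (LG ab)) = counit_mon z"
proof -
  assume "z \<in> mons p UNIV ab ab"
  then have "basis z \<in> bcomp p UNIV ab ab" by simp
  then have "\<theta> ab ab (basis z) (id_trans (LG ab)) = counit (basis z)"
    using coalg unfolding coalgebra_pairing_def by blast
  then show ?thesis by (simp add: counit_def)
qed

text \<open>Evaluate \<open>x\<close> on the composite of \<open>db n\<close> with the identity of
  \<open>LG st\<close>. Precomposing places the counit on the left tensor factor, the one that the
  coaction of \<open>F_proj\<close> retains.\<close>

lemma coprod_counit:
  fixes x :: "mon \<Rightarrow>\<^sub>0 'k"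
  assumes x: "x \<in> bcomp p UNIV st ab" and n: "n \<in> mons p UNIV st ab"
  shows "(\<Sum>v\<in>mons p UNIV st st. Poly_Mapping.lookup (coprod p x) (v, n) * counit_mon v) =
    Poly_Mapping.lookup x n"
  using theta_db_comp[OF x n id_trans_in_nat_trans[OF linear_functor_LG]]
  by (simp add: comp_trans_id(1)[OF linear_functor_LG db_in[OF n]] theta_db_bcomp[OF x n] theta_id)

section \<open>The comodules \<open>F(a, b)\<close>\<close>

lemma mons_mono: "S \<subseteq> T \<Longrightarrow> mons p S st ab \<subseteq> mons p T st ab"
  by (auto simp: mons_def)

lemma mons_wfreeD: "z \<in> mons p wfree st ab \<Longrightarrow> z \<in> mons p UNIV st ab \<and> z \<in> wfree"
  by (auto simp: mons_def)

lemma bcomp_wfreeD: "x \<in> bcomp p wfree st ab \<Longrightarrow> x \<in> bcomp p UNIV st ab"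
  using mons_mono[of wfree UNIV st ab] by (auto simp: bcomp_def)

lemma coprod_mon_not_wfree:
  assumes "z \<notin> wfree" "m \<in> wfree" "n \<in> wfree"
  shows "Poly_Mapping.lookup (coprod_mon p z :: _ \<Rightarrow>\<^sub>0 'k) (m, n) = 0"
  using W_coprod_mon[of z m n p, where ?'k = 'k] assms
  by (auto simp: in_keys_iff wfree_def)

lemma F_proj_simps [simp]:
  "scl (F_proj p ab) = (fscale :: 'k \<Rightarrow> _)"
  "gr (F_proj p ab) st = dual_space (pscale :: 'k \<Rightarrow> _) (bcomp p wfree st ab)"
  by (simp_all add: F_proj_def)

text \<open>Both monomials that index the coefficient are \<open>w\<close>-free, so
  \<open>bar_coprod\<close> may be replaced by \<open>coprod\<close> and identities in B become
  applicable.\<close>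

lemma coact_F_proj:
  "coact (F_proj p ab) st \<phi> z l =
     (if z \<in> wfree \<and> rdeg z = st \<and> l \<in> bcomp p wfree (ldeg p z) ab
      then \<Sum>y\<in>mons p wfree st ab. Poly_Mapping.lookup (coprod p l) (z, y) * \<phi> (basis y)
      else 0)"
  by (auto simp: F_proj_def lookup_bar_coprod mons_def intro!: sum.cong)

text \<open>Coassociativity in B/(w). The intermediate monomials that contain \<open>w\<close> can
  be added to both sums, since their coproducts have no term with two \<open>w\<close>-free factors;
  then the law in B applies.\<close>

lemma coprod_coassoc_wfree:
  fixes l :: "mon \<Rightarrow>\<^sub>0 'k"
  assumes l: "l \<in> bcomp p wfree st ab"
    and k: "k \<in> mons p wfree st cd" and m: "m \<in> mons p wfree cd ef" and n: "n \<in> mons p wfree ef ab"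
  shows "(\<Sum>v\<in>mons p wfree cd ab.
      Poly_Mapping.lookup (coprod p l) (k, v) * Poly_Mapping.lookup (coprod_mon p v) (m, n)) =
    (\<Sum>v\<in>mons p wfree st ef.
      Poly_Mapping.lookup (coprod p l) (v, n) * Poly_Mapping.lookup (coprod_mon p v) (k, m))"
    (is "sum ?f _ = sum ?g _")
proof -
  note K = mons_wfreeD[OF k] and M = mons_wfreeD[OF m] and N = mons_wfreeD[OF n]
  have drop: "Poly_Mapping.lookup (coprod_mon p v :: _ \<Rightarrow>\<^sub>0 'k) (m, n) = 0"
    if "m \<in> wfree" "n \<in> wfree" "v \<in> mons p UNIV cd' ab' - mons p wfree cd' ab'" for cd' ab' m n v
  proof -
    have "v \<notin> wfree" using that(3) unfolding mons_def by blast
    then show ?thesis using that(1,2) by (rule coprod_mon_not_wfree)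
  qed
  have "sum ?f (mons p wfree cd ab) = sum ?f (mons p UNIV cd ab)"
    using M N drop[of m n _ cd ab]
    by (intro sum.mono_neutral_left finite_mons[OF p] mons_mono ballI) simp_all
  also have "\<dots> = sum ?g (mons p UNIV st ef)"
    using K M N by (intro coprod_coassoc bcomp_wfreeD[OF l]) auto
  also have "\<dots> = sum ?g (mons p wfree st ef)"
    using K M drop[of k m _ st ef]
    by (intro sum.mono_neutral_right finite_mons[OF p] mons_mono ballI) simp_all
  finally show ?thesis .
qed

lemma F_proj_coassoc:
  fixes \<phi> :: "(mon \<Rightarrow>\<^sub>0 'k) \<Rightarrow> 'k"
  assumes \<phi>: "\<phi> \<in> gr (F_proj p ab) st" and x: "x \<in> wfree" and y: "y \<in> wfree"
  shows "coact (F_proj p ab) (ldeg p y) (coact (F_proj p ab) st \<phi> y) x l =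
    (\<Sum>z\<in>mons p wfree (ldeg p x) st.
       Poly_Mapping.lookup (coprod_mon p z) (x, y) * coact (F_proj p ab) st \<phi> z l)"
proof (cases "l \<in> bcomp p wfree (ldeg p x) ab")
  case False
  then show ?thesis by (auto simp: coact_F_proj mons_def intro!: sum.neutral)
next
  case l: True
  let ?c = "\<lambda>l x y. Poly_Mapping.lookup (coprod p l) (x, y)"
  let ?d = "\<lambda>z x y. Poly_Mapping.lookup (coprod_mon p z :: _ \<Rightarrow>\<^sub>0 'k) (x, y)"
  let ?M = "mons p wfree"
  show ?thesis
  proof (cases "rdeg x = ldeg p y \<and> rdeg y = st")
    \<comment> \<open>For bidegrees that do not match, the left side is 0 by the definition of the
      coaction and the right side by homogeneity of the coproduct.\<close>
    case False
    have "?d z x y = 0" if "z \<in> ?M (ldeg p x) st" for z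
    proof (rule ccontr)
      assume "?d z x y \<noteq> 0"
      then have "?c (basis z) x y \<noteq> 0" by simp
      from coprod_bcomp_support[OF single_in_bcomp[OF that] this] False show False by simp
    qed
    then show ?thesis using False by (auto simp: coact_F_proj)
  next
    case True
    have xM: "x \<in> ?M (ldeg p x) (ldeg p y)" and yM: "y \<in> ?M (ldeg p y) st"
      using True x y by (auto simp: mons_def)
    have inner: "coact (F_proj p ab) st \<phi> y (basis v) = (\<Sum>u\<in>?M st ab. ?d v y u * \<phi> (basis u))"
      if "v \<in> ?M (ldeg p y) ab" for v
      using that y True by (simp add: coact_F_proj)
    have "coact (F_proj p ab) (ldeg p y) (coact (F_proj p ab) st \<phi> y) x l =
      (\<Sum>v\<in>?M (ldeg p y) ab. ?c l x v * coact (F_proj p ab) st \<phi> y (basis v))"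
      using x True l by (simp add: coact_F_proj[of ab "ldeg p y"])
    also have "\<dots> = (\<Sum>v\<in>?M (ldeg p y) ab. \<Sum>u\<in>?M st ab. (?c l x v * ?d v y u) * \<phi> (basis u))"
      by (intro sum.cong refl) (simp add: inner sum_distrib_left mult.assoc)
    also have "\<dots> = (\<Sum>u\<in>?M st ab. (\<Sum>v\<in>?M (ldeg p y) ab. ?c l x v * ?d v y u) * \<phi> (basis u))"
      unfolding sum_distrib_right by (rule sum.swap)
    also have "\<dots> = (\<Sum>u\<in>?M st ab. (\<Sum>z\<in>?M (ldeg p x) st. ?c l z u * ?d z x y) * \<phi> (basis u))"
      by (intro sum.cong refl arg_cong2[of _ _ _ _ "(*)"] coprod_coassoc_wfree[OF l xM yM])
    also have "\<dots> = (\<Sum>z\<in>?M (ldeg p x) st. \<Sum>u\<in>?M st ab. ?c l z u * ?d z x y * \<phi> (basis u))"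
      unfolding sum_distrib_right by (rule sum.swap)
    also have "\<dots> = (\<Sum>z\<in>?M (ldeg p x) st. ?d z x y * coact (F_proj p ab) st \<phi> z l)"
      using l by (intro sum.cong refl)
        (auto simp: coact_F_proj mons_def sum_distrib_left mult_ac intro!: sum.cong)
    finally show ?thesis .
  qed
qed

lemma F_proj_counit:
  fixes \<phi> :: "(mon \<Rightarrow>\<^sub>0 'k) \<Rightarrow> 'k"
  assumes \<phi>: "\<phi> \<in> gr (F_proj p ab) st"
  shows "(\<Sum>z\<in>mons p wfree st st. counit_mon z * coact (F_proj p ab) st \<phi> z l) = \<phi> l"
proof (cases "l \<in> bcomp p wfree st ab")
  case False
  then have "\<phi> l = 0" using \<phi> by (simp add: dual_space_def)
  then show ?thesis
    using False by (auto simp: coact_F_proj mons_def intro!: sum.neutral)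
next
  case l: True
  let ?c = "\<lambda>x y. Poly_Mapping.lookup (coprod p l) (x, y)"
  let ?M = "mons p wfree"
  have "(\<Sum>z\<in>?M st st. counit_mon z * coact (F_proj p ab) st \<phi> z l) =
    (\<Sum>z\<in>?M st st. \<Sum>u\<in>?M st ab. ?c z u * counit_mon z * \<phi> (basis u))"
    using l by (intro sum.cong refl)
      (auto simp: coact_F_proj mons_def sum_distrib_left mult_ac intro!: sum.cong)
  also have "\<dots> = (\<Sum>u\<in>?M st ab. (\<Sum>z\<in>?M st st. ?c z u * counit_mon z) * \<phi> (basis u))"
    unfolding sum_distrib_right by (rule sum.swap)
  also have "\<dots> = (\<Sum>u\<in>?M st ab. Poly_Mapping.lookup l u * \<phi> (basis u))"
  proof (intro sum.cong refl arg_cong2[of _ _ _ _ "(*)"])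
    fix u assume u: "u \<in> ?M st ab"
    \<comment> \<open>The counit vanishes on monomials containing \<open>w\<close>, so the sum
      extends to B, where the counit law is available.\<close>
    have "(\<Sum>z\<in>?M st st. ?c z u * counit_mon z) = (\<Sum>z\<in>mons p UNIV st st. ?c z u * counit_mon z)"
      by (intro sum.mono_neutral_left finite_mons[OF p] mons_mono)
        (auto simp: mons_def counit_mon_def wfree_def)
    also have "\<dots> = Poly_Mapping.lookup l u"
      using coprod_counit[OF bcomp_wfreeD[OF l]] mons_wfreeD[OF u] by blast
    finally show "(\<Sum>z\<in>?M st st. ?c z u * counit_mon z) = Poly_Mapping.lookup l u" .
  qed
  also have "\<dots> = \<phi> l"
    using \<phi> by (intro lin_on_bcomp_expand[OF p vector_space_mult _ l, symmetric]) (simp add: dual_space_def)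
  finally show ?thesis .
qed

lemma U_bigr_F_proj: "U_bigr p (F_proj p ab :: ('k, _) gcomod)"
  unfolding U_bigr_def graded_comodule_def
proof (intro conjI allI ballI)
  let ?F = "F_proj p ab :: ('k, _) gcomod"
  interpret vector_space "pscale :: 'k \<Rightarrow> (mon \<Rightarrow>\<^sub>0 'k) \<Rightarrow> _" by (rule vector_space_pscale)
  show "vector_space (scl ?F)" by (simp add: vector_space_fscale)
  show "module.subspace (scl ?F) (gr ?F st)" for st
    by (simp add: subspace_dual_space[OF vector_space_pscale])
  show "lin_on (scl ?F) (gr ?F st) (scl ?F) (\<lambda>\<phi>. coact ?F st \<phi> z)" for st z
    by (auto simp: lin_on_def fun_eq_iff coact_F_proj fscale_apply sum.distrib algebra_simps sum_distrib_left)
  fix st \<phi> assume \<phi>: "\<phi> \<in> gr ?F st"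
  show "if z \<in> wfree \<and> rdeg z = st then coact ?F st \<phi> z \<in> gr ?F (ldeg p z) else coact ?F st \<phi> z = 0" for z
    using subspace_add[OF subspace_bcomp[of p wfree "ldeg p z" ab]]
      subspace_scale[OF subspace_bcomp[of p wfree "ldeg p z" ab]]
    by (auto simp: dual_space_def lin_on_def coact_F_proj fun_eq_iff lookup_coprod_add
        lookup_coprod_pscale distrib_right sum.distrib sum_distrib_left mult.assoc)
  show "coact ?F (ldeg p y) (coact ?F st \<phi> y) x = (\<Sum>z\<in>mons p wfree (ldeg p x) st.
      scl ?F (Poly_Mapping.lookup (bar_coprod p (Poly_Mapping.single z 1)) (x, y)) (coact ?F st \<phi> z))"
    if "x \<in> wfree" "y \<in> wfree" for x y
    using that
    by (auto simp: fun_eq_iff sum_fun_apply fscale_apply F_proj_coassoc[OF \<phi> that] lookup_bar_coprod)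
  show "(\<Sum>z\<in>mons p wfree st st. scl ?F (counit_mon z) (coact ?F st \<phi> z)) = \<phi>"
    by (auto simp: fun_eq_iff sum_fun_apply fscale_apply F_proj_counit[OF \<phi>])
qed

text \<open>The comparison map from \<open>Hom st ab\<close> to the component of
  \<open>F(a, b)\<close>. It kills \<open>db z\<close> for every \<open>z\<close> containing
  \<open>w\<close>, whence the hypothesis \<open>eq\<close> in
  \<open>bij_pairing_with\<close>.\<close>

definition pairing_with ::
  "bideg \<Rightarrow> bideg \<Rightarrow> ('k, nat set \<times> nat list, nat set \<times> nat list) trans \<Rightarrow> (mon \<Rightarrow>\<^sub>0 'k) \<Rightarrow> 'k" where
  "pairing_with st ab f = (\<lambda>l. if l \<in> bcomp p wfree st ab then \<theta> st ab l f else 0)"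

lemma lin_on_pairing_with: "lin_on tscale (Hom st ab) fscale (pairing_with st ab)"
  using theta_lin[OF bcomp_wfreeD, of _ st ab]
  by (auto simp: lin_on_def pairing_with_def fun_eq_iff fscale_apply)

lemma bij_pairing_with:
  assumes eq: "mons p UNIV st ab = mons p wfree st ab"
  shows "bij_betw (pairing_with st ab) (Hom st ab) (dual_space pscale (bcomp p wfree st ab))"
proof -
  interpret vector_space "tscale :: 'k \<Rightarrow> ('k, nat set \<times> nat list, nat set \<times> nat list) trans \<Rightarrow> _"
    by (rule vector_space_tscale)
  interpret ps: vector_space "pscale :: 'k \<Rightarrow> (mon \<Rightarrow>\<^sub>0 'k) \<Rightarrow> _" by (rule vector_space_pscale)
  have B: "bcomp p UNIV st ab = (bcomp p wfree st ab :: (mon \<Rightarrow>\<^sub>0 'k) set)"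
    by (simp add: bcomp_def eq)
  note sub = subspace_nat_trans[OF linear_functor_LG, of "LG st" ab]
  have inj: "f = g" if f: "f \<in> Hom st ab" and g: "g \<in> Hom st ab" and fg: "pairing_with st ab f = pairing_with st ab g" for f g
  proof -
    have "\<theta> st ab (basis z) f = \<theta> st ab (basis z) g" if "z \<in> mons p UNIV st ab" for z
    proof -
      have "basis z \<in> bcomp p wfree st ab" using that by (simp add: eq)
      then show ?thesis using fun_cong[OF fg, of "basis z"] by (simp add: pairing_with_def)
    qed
    then show ?thesis by (subst Hom_expand[OF f], subst Hom_expand[OF g]) simp
  qed
  have surj: "\<exists>f\<in>Hom st ab. pairing_with st ab f = \<phi>" if \<phi>: "\<phi> \<in> dual_space pscale (bcomp p wfree st ab)" for \<phi>
  proof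
    \<comment> \<open>The preimage is forced: its coefficients in the dual basis are the values of
      \<open>\<phi>\<close> on monomials.\<close>
    let ?f = "\<Sum>z\<in>mons p UNIV st ab. tscale (\<phi> (basis z)) (db z)"
    show "?f \<in> Hom st ab" by (intro subspace_sum_scale[OF vector_space_tscale sub] db_in)
    show "pairing_with st ab ?f = \<phi>"
    proof
      fix l
      show "pairing_with st ab ?f l = \<phi> l"
      proof (cases "l \<in> bcomp p wfree st ab")
        case True
        then have l: "l \<in> bcomp p UNIV st ab" by (rule bcomp_wfreeD)
        have "pairing_with st ab ?f l = \<theta> st ab l ?f" using True by (simp add: pairing_with_def)
        also have "\<dots> = (\<Sum>z\<in>mons p UNIV st ab. \<phi> (basis z) * \<theta> st ab l (db z))"
          by (intro lin_on_sum[OF vector_space_tscale sub vector_space_mult theta_lin[OF l]] db_in)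
        also have "\<dots> = (\<Sum>z\<in>mons p UNIV st ab. Poly_Mapping.lookup l z * \<phi> (basis z))"
          by (intro sum.cong refl) (simp add: theta_db_bcomp[OF l] mult.commute)
        also have "\<dots> = \<phi> l"
          using \<phi> unfolding eq
          by (intro lin_on_bcomp_expand[OF p vector_space_mult _ True, symmetric]) (simp add: dual_space_def)
        finally show ?thesis .
      qed (use \<phi> in \<open>simp add: pairing_with_def dual_space_def\<close>)
    qed
  qed
  have "pairing_with st ab f \<in> dual_space pscale (bcomp p wfree st ab)" for f
  proof -
    have "lin_on pscale (bcomp p UNIV st ab) fscale (\<theta> st ab)"
      using iso unfolding linear_iso_pairing_def by blast
    then show ?thesis
      using ps.subspace_add[OF subspace_bcomp[of p wfree st ab]]
        ps.subspace_scale[OF subspace_bcomp[of p wfree st ab]]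
      by (auto simp: dual_space_def pairing_with_def lin_on_def B fscale_apply)
  qed
  then show ?thesis
    unfolding bij_betw_def using inj surj by (force intro: inj_onI)
qed

text \<open>The heart of the comparison. Evaluating \<open>l\<close> on a composite with
  \<open>db z\<close> selects the terms of the coproduct of \<open>l\<close> with left factor
  \<open>z\<close>, and so does the coaction of \<open>F_proj\<close> at \<open>z\<close>. The
  hypothesis \<open>eq\<close> makes the sums over right factors agree.\<close>

lemma pairing_with_comp_db:
  assumes g: "g \<in> Hom st ab" and z: "z \<in> wfree" "rdeg z = st"
    and eq: "mons p UNIV st ab = mons p wfree st ab"
  shows "pairing_with (ldeg p z) ab (comp_trans g (db z)) = coact (F_proj p ab) st (pairing_with st ab g) z"
proof
  fix l
  have zM: "z \<in> mons p UNIV (ldeg p z) st" using z by (simp add: mons_def)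
  show "pairing_with (ldeg p z) ab (comp_trans g (db z)) l = coact (F_proj p ab) st (pairing_with st ab g) z l"
    using z by (auto simp: pairing_with_def coact_F_proj theta_comp_db[OF bcomp_wfreeD zM g] eq intro!: sum.cong)
qed

end

section \<open>Monomials of special bidegrees\<close>

lemma deg_odd_le:
  assumes "g |\<in>| fst m"
  shows "fst (ldeg_odd p g) \<le> fst (ldeg p m)" "fst (rdeg_odd g) \<le> fst (rdeg m)"
    "snd (rdeg_odd g) \<le> snd (rdeg m)"
  using assms member_le_sum[of g "fset (fst m)" "\<lambda>g. fst (ldeg_odd p g)"]
    member_le_sum[of g "fset (fst m)" "\<lambda>g. fst (rdeg_odd g)"]
    member_le_sum[of g "fset (fst m)" "\<lambda>g. snd (rdeg_odd g)"]
  by (simp_all add: ldeg_def rdeg_def fst_sum snd_sum)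

lemma deg_even_le:
  assumes "g \<in># snd m"
  shows "fst (ldeg_even p g) \<le> fst (ldeg p m)" "fst (rdeg_even g) \<le> fst (rdeg m)"
    "snd (rdeg_even g) \<le> snd (rdeg m)"
proof -
  obtain M where "snd m = add_mset g M" using assms by (metis multi_member_split)
  then show "fst (ldeg_even p g) \<le> fst (ldeg p m)" "fst (rdeg_even g) \<le> fst (rdeg m)"
    "snd (rdeg_even g) \<le> snd (rdeg m)"
    by (simp_all add: ldeg_def rdeg_def)
qed

text \<open>\<open>w\<close> contributes 1 to the second right degree, which is 0 here.\<close>

lemma mons_rdeg_a0: "mons p UNIV st (a, 0) = mons p wfree st (a, 0)"
proof -
  have "W |\<notin>| fst m" if "rdeg m = (a, 0)" for m
    using deg_odd_le(3)[of W m] that by auto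
  then show ?thesis unfolding mons_def wfree_def by blast
qed

text \<open>\<open>u\<close> and each \<open>\<tau>\<close> contribute 1 to the first right degree;
  once \<open>w\<close> is excluded, only the \<open>\<xi>\<close> remain.\<close>

lemma rdeg_0b_xi_mons:
  assumes "W |\<notin>| fst m" "rdeg m = (0, b)"
  shows "m \<in> xi_mons"
proof -
  have "fst m = {||}"
  proof (rule ccontr)
    assume "fst m \<noteq> {||}"
    then obtain g where "g |\<in>| fst m" by auto
    then show False using deg_odd_le(2)[of g m] assms by (cases g) auto
  qed
  moreover have "g \<in> range Xi" if "g \<in># snd m" for g
    using deg_even_le(2)[OF that] assms by (cases g) auto
  ultimately show ?thesis by (auto simp: xi_mons_def)
qed

lemma xi_mons_fst_ldeg:
  assumes "m \<in> xi_mons"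
  shows "fst (ldeg p m) = 0"
proof -
  have "fst (\<Sum>g\<in>#M. ldeg_even p g) = 0" if "set_mset M \<subseteq> range Xi" for M
    using that by (induction M) auto
  then show ?thesis using assms by (simp add: xi_mons_def ldeg_def)
qed

lemma xi_mons_wfree: "xi_mons \<subseteq> wfree"
  by (auto simp: xi_mons_def wfree_def)

lemma wfree_0b_xi_mons: "m \<in> wfree \<Longrightarrow> rdeg m = (0, b) \<Longrightarrow> m \<in> xi_mons"
  using rdeg_0b_xi_mons by (simp add: wfree_def)

text \<open>In B the left bidegree excludes \<open>w\<close>, which contributes 1 to its first
  entry; the right bidegree alone would allow it.\<close>

lemma mons_0t_0b:
  "mons p UNIV (0, t) (0, b) = mons p xi_mons (0, t) (0, b)"
  "mons p wfree (0, t) (0, b) = mons p xi_mons (0, t) (0, b)"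
proof -
  have "W |\<notin>| fst m" if "ldeg p m = (0, t)" for m
    using deg_odd_le(1)[of W m p] that by auto
  then show "mons p UNIV (0, t) (0, b) = mons p xi_mons (0, t) (0, b)"
    "mons p wfree (0, t) (0, b) = mons p xi_mons (0, t) (0, b)"
    using rdeg_0b_xi_mons xi_mons_wfree by (auto simp: mons_def simp del: split_paired_All)
qed

text \<open>Hence \<open>F(0, b)\<close> vanishes outside the bidegrees \<open>(0, t)\<close>,
  matching the concentration built into \<open>O_r'\<close>.\<close>

lemma mons_wfree_0b_empty: "fst st \<noteq> 0 \<Longrightarrow> mons p wfree st (0, b) = {}"
  using wfree_0b_xi_mons xi_mons_fst_ldeg by (fastforce simp: mons_def)

section \<open>The coactions on \<open>r_B\<close> and \<open>O_r'\<close>\<close>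

lemma bij_betw_comp_iso:
  assumes F: "linear_functor F" and G: "linear_functor G" and H: "linear_functor H"
    and inv: "inverse_trans G H \<kappa> \<kappa>'"
  shows "bij_betw (comp_trans \<kappa>) (nat_trans F G) (nat_trans F H)"
proof (rule bij_betw_byWitness[of _ "comp_trans \<kappa>'"])
  show "\<forall>f\<in>nat_trans F G. comp_trans \<kappa>' (comp_trans \<kappa> f) = f"
    using inverse_trans_cancel[OF F inv] by blast
  show "\<forall>f\<in>nat_trans F H. comp_trans \<kappa> (comp_trans \<kappa>' f) = f"
    using inverse_trans_cancel[OF F inverse_trans_sym[OF inv]] by blast
  show "comp_trans \<kappa> ` nat_trans F G \<subseteq> nat_trans F H" "comp_trans \<kappa>' ` nat_trans F H \<subseteq> nat_trans F G"
    using inv comp_trans_in_nat_trans[OF G] comp_trans_in_nat_trans[OF H]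
    unfolding inverse_trans_def by blast+
qed

section \<open>Passage between \<Gamma> and \<Lambda>^0 \<otimes> \<Gamma>\<close>

lemma lam0_tensor_in:
  assumes "f \<in> nat_trans (Gam t) (Gam b)"
  shows "lam0_tensor t f \<in> nat_trans (LG (0, t)) (LG (0, b))"
  unfolding lam0_tensor_eq[OF assms]
  using inverse_trans_lam0[of t] inverse_trans_lam0[of b] assms
  unfolding inverse_trans_def
  by (metis comp_trans_in_nat_trans linear_functor_Gam)

lemma lam0_conj_in:
  assumes "g \<in> nat_trans (LG (0, t)) (LG (0, b))"
  shows "comp_trans (comp_trans (lam0_proj b) g) (lam0_incl t) \<in> nat_trans (Gam t) (Gam b)"
  using inverse_trans_lam0[of t] inverse_trans_lam0[of b] assms
  unfolding inverse_trans_def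
  by (metis comp_trans_in_nat_trans linear_functor_LG)

lemma lam0_conj_tensor:
  assumes "f \<in> nat_trans (Gam t) (Gam b)"
  shows "comp_trans (comp_trans (lam0_proj b) (lam0_tensor t f)) (lam0_incl t) = f"
  using inverse_trans_cancel_right[OF linear_functor_Gam inverse_trans_lam0 assms]
    inverse_trans_cancel[OF linear_functor_Gam inverse_trans_lam0 assms]
  unfolding lam0_tensor_eq[OF assms] by (simp add: comp_trans_assoc)

lemma lam0_tensor_conj:
  assumes "g \<in> nat_trans (LG (0, t)) (LG (0, b))"
  shows "lam0_tensor t (comp_trans (comp_trans (lam0_proj b) g) (lam0_incl t)) = g"
  using inverse_trans_cancel_right[OF linear_functor_LG inverse_trans_sym[OF inverse_trans_lam0] assms]
    inverse_trans_cancel[OF linear_functor_LG inverse_trans_sym[OF inverse_trans_lam0] assms]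
  unfolding lam0_tensor_eq[OF lam0_conj_in[OF assms]] by (simp add: comp_trans_assoc)

lemma bij_lam0_tensor:
  "bij_betw (lam0_tensor t) (nat_trans (Gam t) (Gam b)) (nat_trans (LG (0, t)) (LG (0, b)))"
  by (rule bij_betw_byWitness[of _ "\<lambda>g. comp_trans (comp_trans (lam0_proj b) g) (lam0_incl t)"])
    (auto simp: lam0_conj_tensor lam0_tensor_conj lam0_tensor_in lam0_conj_in)

lemma lin_on_lam0_tensor:
  "lin_on tscale (nat_trans (Gam t) (Gam b)) tscale (lam0_tensor t)"
  by (auto simp: lin_on_def lam0_tensor_def tscale_def fscale_def fun_eq_iff)

text \<open>The projection and inclusion in the middle of the composite of two conjugates
  cancel.\<close>

lemma lam0_tensor_comp:
  assumes "f \<in> nat_trans (Gam s) (Gam t)" "g \<in> nat_trans (Gam t) (Gam b)"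
  shows "lam0_tensor s (comp_trans g f) = comp_trans (lam0_tensor t g) (lam0_tensor s f)"
  using inverse_trans_cancel[OF linear_functor_Gam inverse_trans_lam0 assms(1)]
  unfolding lam0_tensor_eq[OF assms(1)] lam0_tensor_eq[OF assms(2)]
    lam0_tensor_eq[OF comp_trans_in_nat_trans[OF linear_functor_Gam assms]]
  by (simp add: comp_trans_assoc) (simp flip: comp_trans_assoc)

context dual_pairing
begin

lemma comp_trans_expand:
  assumes f: "f \<in> Hom st ab" and \<eta>: "\<eta> \<in> nat_trans (LG ab) G"
  shows "comp_trans \<eta> f = (\<Sum>z\<in>mons p UNIV st ab. tscale (\<theta> st ab (basis z) f) (comp_trans \<eta> (db z)))"
  by (subst Hom_expand[OF f], rule lin_on_sum[OF vector_space_tscale subspace_nat_trans[OF linear_functor_LG]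
        vector_space_tscale lin_on_comp_right[OF linear_functor_LG \<eta>] db_in])

lemma sum_delta_tscale:
  assumes "finite M" "z \<in> M" "\<And>y. y \<in> M \<Longrightarrow> d y = (if y = z then 1 else 0)"
  shows "(\<Sum>y\<in>M. tscale (d y) (c y)) = c z"
proof -
  have "(\<Sum>y\<in>M. tscale (d y) (c y)) = (\<Sum>y\<in>M. if y = z then c y else 0)"
    by (intro sum.cong refl) (simp add: assms(3) tscale_def fscale_def fun_eq_iff)
  then show ?thesis using assms(1,2) by simp
qed

text \<open>Resolves the definite description. Testing a family on the dual basis element
  \<open>db z\<close> leaves only \<open>c z\<close>, which gives uniqueness; expanding an arbitrary
  \<open>f\<close> in the dual basis gives existence.\<close>

lemma coact_r_B:
  assumes \<eta>: "\<eta> \<in> nat_trans (LG ab) G"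
  shows "coact (r_B p \<theta> G) ab \<eta> = (\<lambda>z. if rdeg z = ab then comp_trans \<eta> (db z) else 0)"
  unfolding r_B_def gcomod.simps
proof (rule the_equality)
  have db': "db z \<in> Hom (ldeg p z) ab" if "rdeg z = ab" for z
    using that by (intro db_in) (simp add: mons_def)
  show "(\<forall>z. if rdeg z = ab then (if rdeg z = ab then comp_trans \<eta> (db z) else 0) \<in> nat_trans (LG (ldeg p z)) G
      else (if rdeg z = ab then comp_trans \<eta> (db z) else 0) = 0) \<and>
    (\<forall>st. \<forall>f\<in>Hom st ab. (\<Sum>z\<in>mons p UNIV st ab. tscale (\<theta> st ab (basis z) f)
      (if rdeg z = ab then comp_trans \<eta> (db z) else 0)) = comp_trans \<eta> f)"
  proof (intro conjI allI ballI)
    fix st f assume f: "f \<in> Hom st ab"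
    have "(\<Sum>z\<in>mons p UNIV st ab. tscale (\<theta> st ab (basis z) f)
        (if rdeg z = ab then comp_trans \<eta> (db z) else 0)) =
      (\<Sum>z\<in>mons p UNIV st ab. tscale (\<theta> st ab (basis z) f) (comp_trans \<eta> (db z)))"
      by (intro sum.cong refl) (simp add: mons_def)
    also have "\<dots> = comp_trans \<eta> f" by (rule comp_trans_expand[OF f \<eta>, symmetric])
    finally show "(\<Sum>z\<in>mons p UNIV st ab. tscale (\<theta> st ab (basis z) f)
        (if rdeg z = ab then comp_trans \<eta> (db z) else 0)) = comp_trans \<eta> f" .
  qed (use comp_trans_in_nat_trans[OF linear_functor_LG db' \<eta>] in simp)
next
  fix c
  assume c: "(\<forall>z. if rdeg z = ab then c z \<in> nat_trans (LG (ldeg p z)) G else c z = 0) \<and>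
    (\<forall>st. \<forall>f\<in>Hom st ab. (\<Sum>z\<in>mons p UNIV st ab. tscale (\<theta> st ab (basis z) f) (c z)) = comp_trans \<eta> f)"
  show "c = (\<lambda>z. if rdeg z = ab then comp_trans \<eta> (db z) else 0)"
  proof
    fix z
    show "c z = (if rdeg z = ab then comp_trans \<eta> (db z) else 0)"
    proof (cases "rdeg z = ab")
      case True
      then have z: "z \<in> mons p UNIV (ldeg p z) ab" by (simp add: mons_def)
      have "comp_trans \<eta> (db z) = (\<Sum>y\<in>mons p UNIV (ldeg p z) ab. tscale (\<theta> (ldeg p z) ab (basis y) (db z)) (c y))"
        by (rule c[THEN conjunct2, rule_format, OF db_in[OF z], symmetric])
      also have "\<dots> = c z"
        by (rule sum_delta_tscale[OF finite_mons[OF p] z theta_db[OF z]])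
      finally show ?thesis using True by simp
    next
      case False
      then show ?thesis using c by metis
    qed
  qed
qed

text \<open>For \<open>z\<close> in \<open>xi_mons\<close> both bidegrees of \<open>z\<close> have
  first entry 0, so \<open>db z\<close> comes from a transformation between divided powers. This is
  that transformation.\<close>

definition db_Gam :: "mon \<Rightarrow> ('k, nat list, nat list) trans" where
  "db_Gam z = comp_trans (comp_trans (lam0_proj (snd (rdeg z))) (db z)) (lam0_incl (snd (ldeg p z)))"

lemma xi_mons_mons:
  assumes "z \<in> xi_mons" "rdeg z = (0, b)"
  shows "z \<in> mons p UNIV (0, snd (ldeg p z)) (0, b)" "z \<in> mons p xi_mons (0, snd (ldeg p z)) (0, b)"
  using assms xi_mons_fst_ldeg[OF assms(1), of p] by (auto simp: mons_def prod_eq_iff)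

lemma db_Gam:
  assumes "z \<in> xi_mons" "rdeg z = (0, b)"
  shows "db_Gam z \<in> nat_trans (Gam (snd (ldeg p z))) (Gam b)"
    and "lam0_tensor (snd (ldeg p z)) (db_Gam z) = db z"
  using lam0_conj_in[OF db_in[OF xi_mons_mons(1)[OF assms]]]
    lam0_tensor_conj[OF db_in[OF xi_mons_mons(1)[OF assms]]]
  by (simp_all add: db_Gam_def assms(2))

lemma coact_O_r':
  fixes G :: "('k, 'x) vfunctor"
  assumes \<eta>: "\<eta> \<in> nat_trans (Gam b) G"
  shows "coact (O_r' p \<theta> G) (0, b) \<eta> =
    (\<lambda>z. if z \<in> xi_mons \<and> rdeg z = (0, b) then comp_trans \<eta> (db_Gam z) else 0)" (is "_ = ?c")
  unfolding O_r'_def gcomod.simps prod.case simp_thms if_True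
proof (rule the_equality)
  show "(\<forall>z. if z \<in> xi_mons \<and> rdeg z = (0, b) then ?c z \<in> nat_trans (Gam (snd (ldeg p z))) G else ?c z = 0) \<and>
    (\<forall>t. \<forall>f\<in>nat_trans (Gam t) (Gam b). (\<Sum>z\<in>mons p xi_mons (0, t) (0, b).
       tscale (xi_pairing \<theta> t b (basis z) f) (?c z)) = comp_trans \<eta> f)"
  proof (intro conjI allI ballI)
    fix t and f :: "('k, nat list, nat list) trans"
    assume f: "f \<in> nat_trans (Gam t) (Gam b)"
    note sub = subspace_nat_trans[OF linear_functor_LG, of "LG (0, t)" "(0, b)"]
    have lf: "lam0_tensor t f \<in> Hom (0, t) (0, b)" by (rule lam0_tensor_in[OF f])
    \<comment> \<open>The dual basis lives on the functors \<open>LG\<close>, so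
      \<open>\<eta>\<close> is first moved there. Precomposing with \<open>lam0_incl t\<close>
      afterwards returns to \<Gamma>^t.\<close>
    have "comp_trans \<eta> (lam0_proj b) \<in> nat_trans (LG (0, b)) G"
      using inverse_trans_lam0[of b] \<eta> comp_trans_in_nat_trans[OF linear_functor_Gam]
      unfolding inverse_trans_def by blast
    from comp_trans_expand[OF lf this]
    have "comp_trans (comp_trans (comp_trans \<eta> (lam0_proj b)) (lam0_tensor t f)) (lam0_incl t) =
      comp_trans (\<Sum>z\<in>mons p UNIV (0, t) (0, b). tscale (\<theta> (0, t) (0, b) (basis z) (lam0_tensor t f))
        (comp_trans (comp_trans \<eta> (lam0_proj b)) (db z))) (lam0_incl t)" by simp
    also have "\<dots> = (\<Sum>z\<in>mons p UNIV (0, t) (0, b). tscale (\<theta> (0, t) (0, b) (basis z) (lam0_tensor t f))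
        (comp_trans (comp_trans (comp_trans \<eta> (lam0_proj b)) (db z)) (lam0_incl t)))"
      by (simp add: fun_eq_iff comp_trans_def sum_fun_apply tscale_def)
    also have "\<dots> = (\<Sum>z\<in>mons p xi_mons (0, t) (0, b). tscale (xi_pairing \<theta> t b (basis z) f) (?c z))"
      unfolding mons_0t_0b
      by (intro sum.cong refl) (auto simp: mons_def xi_pairing_def db_Gam_def comp_trans_assoc)
    finally show "(\<Sum>z\<in>mons p xi_mons (0, t) (0, b).
       tscale (xi_pairing \<theta> t b (basis z) f) (?c z)) = comp_trans \<eta> f"
      using lam0_conj_tensor[OF f] by (simp add: comp_trans_assoc)
  qed (use comp_trans_in_nat_trans[OF linear_functor_Gam db_Gam(1) \<eta>] in simp)
next
  fix c
  assume c: "(\<forall>z. if z \<in> xi_mons \<and> rdeg z = (0, b) then c z \<in> nat_trans (Gam (snd (ldeg p z))) G else c z = 0) \<and>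
    (\<forall>t. \<forall>f\<in>nat_trans (Gam t) (Gam b). (\<Sum>z\<in>mons p xi_mons (0, t) (0, b).
       tscale (xi_pairing \<theta> t b (basis z) f) (c z)) = comp_trans \<eta> f)"
  show "c = ?c"
  proof
    fix z
    show "c z = ?c z"
    proof (cases "z \<in> xi_mons \<and> rdeg z = (0, b)")
      case True
      let ?t = "snd (ldeg p z)"
      note z = xi_mons_mons[OF conjunct1[OF True] conjunct2[OF True]]
        and dbG = db_Gam[OF conjunct1[OF True] conjunct2[OF True]]
      have "comp_trans \<eta> (db_Gam z) =
        (\<Sum>y\<in>mons p xi_mons (0, ?t) (0, b). tscale (xi_pairing \<theta> ?t b (basis y) (db_Gam z)) (c y))"
        using c dbG(1) by simp
      also have "\<dots> = c z"
        unfolding xi_pairing_def dbG(2)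
        by (intro sum_delta_tscale[OF finite_mons[OF p] z(2)] theta_db[OF z(1)]) (simp add: mons_0t_0b)
      finally show ?thesis using True by simp
    next
      case False
      then show ?thesis using c by metis
    qed
  qed
qed

section \<open>The two isomorphisms\<close>

lemma lin_on_comp:
  assumes "lin_on s V t f" "lin_on t V' u g" "f ` V \<subseteq> V'"
  shows "lin_on s V u (\<lambda>x. g (f x))"
  using assms unfolding lin_on_def by (metis image_subset_iff)

text \<open>No monomial of right bidegree \<open>(a, 0)\<close> contains \<open>w\<close>, so
  pairing is bijective in every left bidegree. Identifying \<Lambda>^a with \<open>LG (a, 0)\<close>
  gives \<open>Q\<close>, and \<open>\<Phi>\<close> is its inverse. The second conjunct determines
  \<open>\<Phi>\<close> on the graded pieces and so records which isomorphism is meant.\<close>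

lemma F_proj_a0_iso:
  "\<exists>\<Phi>. U_bigr_iso p (F_proj p (a, 0)) (Psi (r_B p \<theta> (Lam a))) \<Phi> \<and>
     (\<forall>st. \<forall>\<phi>\<in>gr (F_proj p (a, 0)) st. \<forall>l\<in>bcomp p wfree st (a, 0).
        \<phi> l = \<theta> st (a, 0) l (comp_trans (tensor_gam0 a) (\<Phi> st \<phi>)))"
proof -
  let ?N = "Psi (r_B p \<theta> (Lam a))"
  let ?\<kappa> = "tensor_gam0 a :: ('k, nat set, nat set \<times> nat list) trans"
  have \<kappa>: "?\<kappa> \<in> nat_trans (Lam a) (LG (a, 0))"
    using inverse_trans_tensor_gam0 unfolding inverse_trans_def by blast
  define Q where "Q st \<eta> = pairing_with st (a, 0) (comp_trans ?\<kappa> \<eta>)" for st \<eta>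
  have grN: "gr ?N = (\<lambda>ab. nat_trans (LG ab) (Lam a))" and sclN: "scl ?N = tscale"
    by (simp_all add: Psi_def r_B_def)
  have coactN: "coact ?N st \<eta> z = (if z \<in> wfree \<and> rdeg z = st then comp_trans \<eta> (db z) else 0)"
    if "\<eta> \<in> nat_trans (LG st) (Lam a)" for st \<eta> z
    using coact_r_B[OF that] by (simp add: Psi_def)
  have bij\<kappa>: "bij_betw (comp_trans ?\<kappa>) (nat_trans (LG st) (Lam a)) (Hom st (a, 0))" for st
    by (rule bij_betw_comp_iso[OF linear_functor_LG linear_functor_Lam linear_functor_LG
          inverse_trans_tensor_gam0])
  have bij: "bij_betw (Q st) (nat_trans (LG st) (Lam a)) (dual_space pscale (bcomp p wfree st (a, 0)))" for st
    using bij_betw_trans[OF bij\<kappa> bij_pairing_with[OF mons_rdeg_a0]] by (simp add: Q_def[abs_def] o_def)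
  have iso: "U_bigr_iso p (F_proj p (a, 0)) ?N (\<lambda>st. inv_into (gr ?N st) (Q st))"
  proof (rule U_bigr_transport[OF U_bigr_F_proj])
    show "vector_space (scl ?N)" by (simp add: sclN vector_space_tscale)
    fix st
    show "module.subspace (scl ?N) (gr ?N st)"
      by (simp add: sclN grN subspace_nat_trans[OF linear_functor_Lam])
    show "bij_betw (Q st) (gr ?N st) (gr (F_proj p (a, 0)) st)" by (simp add: grN bij)
    show "lin_on (scl ?N) (gr ?N st) (scl (F_proj p (a, 0))) (Q st)"
      unfolding Q_def[abs_def] sclN grN F_proj_simps
      by (rule lin_on_comp[OF lin_on_comp_right[OF linear_functor_Lam \<kappa>] lin_on_pairing_with])
        (use bij\<kappa>[of st] in \<open>simp add: bij_betw_def\<close>)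
    fix \<eta> z assume \<eta>: "\<eta> \<in> gr ?N st"
    then have \<eta>': "\<eta> \<in> nat_trans (LG st) (Lam a)" by (simp add: grN)
    show "coact ?N st \<eta> z = 0" if "\<not> (z \<in> wfree \<and> rdeg z = st)"
      using that unfolding coactN[OF \<eta>'] by (simp only: if_False)
    assume z: "z \<in> wfree" "rdeg z = st"
    then have "db z \<in> Hom (ldeg p z) st" by (intro db_in) (simp add: mons_def)
    then have "comp_trans \<eta> (db z) \<in> nat_trans (LG (ldeg p z)) (Lam a)"
      using \<eta>' by (rule comp_trans_in_nat_trans[OF linear_functor_LG])
    moreover have "Q (ldeg p z) (comp_trans \<eta> (db z)) = coact (F_proj p (a, 0)) st (Q st \<eta>) z"
      using pairing_with_comp_db[OF comp_trans_in_nat_trans[OF linear_functor_Lam \<eta>' \<kappa>] z mons_rdeg_a0]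
      by (simp add: Q_def comp_trans_assoc)
    ultimately show "coact ?N st \<eta> z \<in> gr ?N (ldeg p z) \<and>
        Q (ldeg p z) (coact ?N st \<eta> z) = coact (F_proj p (a, 0)) st (Q st \<eta>) z"
      using z by (simp add: coactN[OF \<eta>'] grN)
  qed
  moreover have "\<phi> l = \<theta> st (a, 0) l (comp_trans ?\<kappa> (inv_into (gr ?N st) (Q st) \<phi>))"
    if "\<phi> \<in> gr (F_proj p (a, 0)) st" "l \<in> bcomp p wfree st (a, 0)" for st \<phi> l
  proof -
    have "Q st (inv_into (gr ?N st) (Q st) \<phi>) = \<phi>"
      using that(1) by (simp add: grN bij_betw_inv_into_right[OF bij])
    then have "\<phi> l = Q st (inv_into (gr ?N st) (Q st) \<phi>) l" by simp
    also have "\<dots> = \<theta> st (a, 0) l (comp_trans ?\<kappa> (inv_into (gr ?N st) (Q st) \<phi>))"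
      using that(2) by (simp add: Q_def pairing_with_def)
    finally show ?thesis .
  qed
  ultimately show ?thesis by blast
qed

text \<open>Only the components \<open>(0, t)\<close> carry information. There every monomial is one
  in the \<open>\<xi>\<close>, so \<open>w\<close> cannot interfere, and \<open>Q\<close> is pairing
  after \<open>lam0_tensor\<close>; elsewhere both sides are 0.\<close>

lemma F_proj_0b_iso:
  "\<exists>\<Phi>. U_bigr_iso p (F_proj p (0, b)) (O_r' p \<theta> (Gam b)) \<Phi> \<and>
     (\<forall>t. \<forall>\<phi>\<in>gr (F_proj p (0, b)) (0, t). \<forall>l\<in>bcomp p wfree (0, t) (0, b).
        \<phi> l = xi_pairing \<theta> t b l (\<Phi> (0, t) \<phi>))"
proof -
  let ?N = "O_r' p \<theta> (Gam b :: ('k, nat list) vfunctor)"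
  let ?F = "F_proj p (0, b) :: ('k, _) gcomod"
  define Q where "Q st \<eta> = (if fst st = 0 then pairing_with (0, snd st) (0, b) (lam0_tensor (snd st) \<eta>) else 0)"
    for st :: bideg and \<eta>
  have grN0: "gr ?N (0, t) = nat_trans (Gam t) (Gam b)" and sclN: "scl ?N = tscale" for t
    by (simp_all add: O_r'_def)
  have grN: "gr ?N (s, t) = {0}" if "s \<noteq> 0" for s t
    using that by (simp add: O_r'_def)
  have coactN: "coact ?N (0, t) \<eta> z =
      (if z \<in> wfree \<and> rdeg z = (0, t) then comp_trans \<eta> (db_Gam z) else 0)"
    if "\<eta> \<in> nat_trans (Gam t) (Gam b)" for t \<eta> z
    using coact_O_r'[OF that] wfree_0b_xi_mons[of z t] xi_mons_wfree by auto
  have coactN_s: "coact ?N (s, t) \<eta> = 0" if "s \<noteq> 0" for s t \<eta>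
    using that by (simp add: O_r'_def)
  have mons_eq: "mons p UNIV (0, t) (0, b) = mons p wfree (0, t) (0, b)" for t
    by (simp add: mons_0t_0b)
  have bij0: "bij_betw (Q (0, t)) (nat_trans (Gam t) (Gam b))
      (dual_space pscale (bcomp p wfree (0, t) (0, b)))" for t
    using bij_betw_trans[OF bij_lam0_tensor bij_pairing_with[OF mons_eq]] by (simp add: Q_def[abs_def] o_def)
  have bij: "bij_betw (Q st) (gr ?N st) (gr ?F st)" for st
  proof (cases "fst st = 0")
    case True
    then show ?thesis using bij0[of "snd st"] by (cases st) (simp add: grN0)
  next
    \<comment> \<open>With no monomials in this component, \<open>F_proj\<close> is the dual of the
      zero space; the zero map is the bijection.\<close>
    case False
    interpret vector_space "pscale :: 'k \<Rightarrow> (mon \<Rightarrow>\<^sub>0 'k) \<Rightarrow> _" by (rule vector_space_pscale)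
    have "bcomp p wfree st (0, b) = ({0} :: (mon \<Rightarrow>\<^sub>0 'k) set)"
      using False by (simp add: bcomp_def mons_wfree_0b_empty)
    moreover have "dual_space pscale {0 :: mon \<Rightarrow>\<^sub>0 'k} = {0}"
    proof (intro equalityI subsetI)
      fix \<phi> assume \<phi>: "\<phi> \<in> dual_space pscale {0 :: mon \<Rightarrow>\<^sub>0 'k}"
      then have "\<phi> 0 = 0"
        by (intro lin_on_0[OF vector_space_pscale subspace_single_0 vector_space_mult])
          (simp add: dual_space_def)
      then have "\<phi> x = 0" for x
        using \<phi> by (cases "x = 0") (simp_all add: dual_space_def)
      then show "\<phi> \<in> {0}" by (simp add: fun_eq_iff)
    qed (simp add: dual_space_def lin_on_def)
    ultimately have "gr ?F st = {0}" by simp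
    then show ?thesis
      using False grN[of "fst st" "snd st"] by (simp add: Q_def bij_betw_def)
  qed
  interpret vector_space "tscale :: 'k \<Rightarrow> ('k, nat list, nat list) trans \<Rightarrow> _" by (rule vector_space_tscale)
  have sub: "module.subspace (scl ?N) (gr ?N st)" for st
    using subspace_nat_trans[OF linear_functor_Gam]
    by (cases st; cases "fst st = 0") (simp_all add: sclN grN0 grN subspace_single_0)
  have linQ: "lin_on (scl ?N) (gr ?N st) (scl ?F) (Q st)" for st
  proof -
    obtain s t where st: "st = (s, t)" by (cases st)
    show ?thesis
    proof (cases "s = 0")
      case True
      have "lin_on tscale (nat_trans (Gam t) (Gam b)) fscale (\<lambda>\<eta>. pairing_with (0, t) (0, b) (lam0_tensor t \<eta>))"
        by (rule lin_on_comp[OF lin_on_lam0_tensor lin_on_pairing_with]) (auto intro: lam0_tensor_in)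
      then show ?thesis by (simp add: st True sclN grN0 Q_def[abs_def])
    next
      case False
      then show ?thesis by (simp add: st lin_on_def Q_def fscale_def fun_eq_iff)
    qed
  qed
  have Q0: "0 \<in> gr ?N st" "Q st 0 = 0" for st
    using sub[of st] lin_on_0[OF _ sub[of st] _ linQ[of st]]
    by (simp_all add: sclN subspace_0 vector_space_tscale vector_space_fscale)
  have iso: "U_bigr_iso p ?F ?N (\<lambda>st. inv_into (gr ?N st) (Q st))"
  proof (rule U_bigr_transport[OF U_bigr_F_proj])
    show "vector_space (scl ?N)" by (simp add: sclN vector_space_tscale)
    fix st :: bideg
    obtain s t where st: "st = (s, t)" by (cases st)
    show "module.subspace (scl ?N) (gr ?N st)" by (rule sub)
    show "bij_betw (Q st) (gr ?N st) (gr ?F st)" by (rule bij)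
    show "lin_on (scl ?N) (gr ?N st) (scl ?F) (Q st)" by (rule linQ)
    fix \<eta> z assume \<eta>: "\<eta> \<in> gr ?N st"
    show "coact ?N st \<eta> z = 0" if "\<not> (z \<in> wfree \<and> rdeg z = st)"
    proof (cases "s = 0")
      case True
      then have "\<eta> \<in> nat_trans (Gam t) (Gam b)" using \<eta> by (simp add: st grN0)
      then show ?thesis using that True coactN by (simp only: st if_False)
    qed (simp add: st coactN_s)
    assume z: "z \<in> wfree" "rdeg z = st"
    show "coact ?N st \<eta> z \<in> gr ?N (ldeg p z) \<and>
        Q (ldeg p z) (coact ?N st \<eta> z) = coact ?F st (Q st \<eta>) z"
    proof (cases "s = 0")
      case True
      then have \<eta>': "\<eta> \<in> nat_trans (Gam t) (Gam b)" using \<eta> by (simp add: st grN0)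
      have rz: "rdeg z = (0, t)" using z st True by simp
      then have xi: "z \<in> xi_mons" using wfree_0b_xi_mons z(1) by blast
      obtain t' where t': "ldeg p z = (0, t')"
        using xi_mons_fst_ldeg[OF xi, of p] by (metis prod.collapse)
      note dbG = db_Gam[OF xi rz, unfolded t' snd_conv]
      have "comp_trans \<eta> (db_Gam z) \<in> nat_trans (Gam t') (Gam b)"
        by (rule comp_trans_in_nat_trans[OF linear_functor_Gam dbG(1) \<eta>'])
      \<comment> \<open>Since \<open>lam0_tensor\<close> turns \<open>db_Gam z\<close> into
        \<open>db z\<close> and respects composition, this is the required compatibility for
        \<open>\<eta>\<close>.\<close>
      moreover have "pairing_with (0, t') (0, b) (comp_trans (lam0_tensor t \<eta>) (db z)) =
          coact ?F (0, t) (pairing_with (0, t) (0, b) (lam0_tensor t \<eta>)) z"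
        using pairing_with_comp_db[OF lam0_tensor_in[OF \<eta>'] z(1) rz mons_eq] by (simp add: t')
      ultimately show ?thesis
        using z(1) rz lam0_tensor_comp[OF dbG(1) \<eta>'] dbG(2)
        by (simp add: st True coactN[OF \<eta>'] t' grN0 Q_def)
    next
      case False
      then have "Q st \<eta> = 0" by (simp add: st Q_def)
      moreover have "coact ?F st 0 z = 0" by (auto simp: coact_F_proj fun_eq_iff)
      ultimately show ?thesis using False Q0[of "ldeg p z"] by (simp add: st coactN_s)
    qed
  qed
  moreover have "\<phi> l = xi_pairing \<theta> t b l (inv_into (gr ?N (0, t)) (Q (0, t)) \<phi>)"
    if "\<phi> \<in> gr ?F (0, t)" "l \<in> bcomp p wfree (0, t) (0, b)" for t \<phi> l
  proof -
    have "Q (0, t) (inv_into (gr ?N (0, t)) (Q (0, t)) \<phi>) = \<phi>"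
      using that(1) by (intro bij_betw_inv_into_right[OF bij])
    then have "\<phi> l = Q (0, t) (inv_into (gr ?N (0, t)) (Q (0, t)) \<phi>) l" by simp
    also have "\<dots> = xi_pairing \<theta> t b l (inv_into (gr ?N (0, t)) (Q (0, t)) \<phi>)"
      using that(2) by (simp add: Q_def pairing_with_def xi_pairing_def)
    finally show ?thesis .
  qed
  ultimately show ?thesis by blast
qed

end

theorem proposition7p2p3:
  fixes p a b :: nat and \<theta> :: "'k::field pairing"
  assumes "prime p" and "odd p" and "card (UNIV :: 'k set) = p"
    and "bialgebra_iso p \<theta>"
  shows
    "(\<exists>\<Phi>. U_bigr_iso p (F_proj p (0, b)) (O_r' p \<theta> (Gam b)) \<Phi> \<and>
        (\<forall>t. \<forall>\<phi>\<in>gr (F_proj p (0, b)) (0, t). \<forall>l\<in>bcomp p wfree (0, t) (0, b).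
           \<phi> l = xi_pairing \<theta> t b l (\<Phi> (0, t) \<phi>))) \<and>
     (\<exists>\<Phi>. U_bigr_iso p (F_proj p (a, 0)) (Psi (r_B p \<theta> (Lam a))) \<Phi> \<and>
        (\<forall>st. \<forall>\<phi>\<in>gr (F_proj p (a, 0)) st. \<forall>l\<in>bcomp p wfree st (a, 0).
           \<phi> l = \<theta> st (a, 0) l (comp_trans (tensor_gam0 a) (\<Phi> st \<phi>))))"
proof -
  interpret dual_pairing p \<theta>
    using assms(1,4) by unfold_locales (simp_all add: bialgebra_iso_def prime_ge_2_nat)
  show ?thesis using F_proj_0b_iso F_proj_a0_iso by blast
qed

end
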